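(* Let $R_0>3/2$ be fixed, and let $u\in\dot H^1(\mathbb{R}^3)$ (a vector field with values in $\mathbb{R}^3$) be a solution of the stationary Navier--Stokes equations $$-\Delta u+u\cdot\nabla u+\nabla P=0,\qquad \nabla\cdot u=0\qquad\text{in }\mathbb{R}^3 .$$ Let $\varepsilon:\mathbb{R}^3\to\mathbb{R}$ be the function defined by $$\varepsilon(x)=\frac32\ \text{ for } |x|<R_0,\qquad \varepsilon(x)=\frac32\,\frac{R_0}{|x|}\ \text{ for } |x|\ge R_0 .$$ If in addition $u\in L^{\frac92+\varepsilon(\cdot)}(\mathbb{R}^3)$, then $u\equiv 0$.
   Context: A vector field $u$ is called a solution of the stationary Navier--Stokes equations if there is an associated scalar pressure $P$ on $\mathbb{R}^3$ such that both equations hold in the sense of distributions. The homogeneous Sobolev space $\dot H^1(\mathbb{R}^3)$ is understood with the convention that the Sobolev embedding $\dot H^1(\mathbb{R}^3)\subset L^6(\mathbb{R}^3)$ holds; that is, $u\in L^6(\mathbb{R}^3)$ and $\nabla u\in L^2(\mathbb{R}^3)$. Variable exponent Lebesgue spaces: for a domain $\Omega\subseteq\mathbb{R}^n$ and a measurable $p(\cdot):\Omega\to[1,+\infty)$ with $1<\operatorname{ess\,inf}_\Omega p\le\operatorname{ess\,sup}_\Omega p<+\infty$, the space $L^{p(\cdot)}(\Omega)$ is the set of measurable functions $u$ on $\Omega$ such that $$\|u\|_{L^{p(\cdot)}(\Omega)}:=\inf\Big\{\lambda>0:\ \int_\Omega \Big|\frac{u(x)}{\lambda}\Big|^{p(x)}dx\le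 1\Big\}<+\infty ,$$ with the convention that the infimum of the empty set is $+\infty$. *)

theory Defs
  imports "HOL-Analysis.Analysis"
begin

section \<open>Test functions and distributions on a Euclidean space\<close>

definition partial_deriv :: "'a::euclidean_space \<Rightarrow> ('a \<Rightarrow> real) \<Rightarrow> 'a \<Rightarrow> real" where
  "partial_deriv b f = (\<lambda>x. frechet_derivative f (at x) b)"

definition iter_partial :: "'a::euclidean_space list \<Rightarrow> ('a \<Rightarrow> real) \<Rightarrow> 'a \<Rightarrow> real" where
  "iter_partial bs f = foldr partial_deriv bs f"

text \<open>Differentiability of every iterated partial derivative makes all of them continuous,
  so this is \<open>C\<^sup>\<infinity>\<close>.\<close>

definition smooth_fun :: "('a::euclidean_space \<Rightarrow> real) \<Rightarrow> bool" where
  "smooth_fun f \<longleftrightarrow>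
     (\<forall>bs. set bs \<subseteq> Basis \<longrightarrow> (\<forall>x. iter_partial bs f differentiable (at x)))"

definition test_functions :: "('a::euclidean_space \<Rightarrow> real) set" where
  "test_functions = {\<phi>. smooth_fun \<phi> \<and> compact (closure {x. \<phi> x \<noteq> 0})}"

text \<open>A distribution is represented by a functional on all real functions, of which only the
  values on test functions are meaningful. Continuity is expressed by the usual
  seminorm estimates on each compact set.\<close>

definition distribution :: "(('a::euclidean_space \<Rightarrow> real) \<Rightarrow> real) \<Rightarrow> bool" where
  "distribution T \<longleftrightarrow>
     (\<forall>\<phi>\<in>test_functions. \<forall>\<psi>\<in>test_functions. T (\<lambda>x. \<phi> x + \<psi> x) = T \<phi> + T \<psi>) \<and>
     (\<forall>c. \<forall>\<phi>\<in>test_functions. T (\<lambda>x. c * \<phi> x) = c * T \<phi>) \<and>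
     (\<forall>K. compact K \<longrightarrow> (\<exists>C N. \<forall>\<phi>\<in>test_functions. closure {x. \<phi> x \<noteq> 0} \<subseteq> K \<longrightarrow>
        \<bar>T \<phi>\<bar> \<le> C * (\<Sum>bs | set bs \<subseteq> Basis \<and> length bs \<le> N. SUP x. \<bar>iter_partial bs \<phi> x\<bar>)))"

definition locally_integrable :: "('a::euclidean_space \<Rightarrow> 'b::euclidean_space) \<Rightarrow> bool" where
  "locally_integrable f \<longleftrightarrow> (\<forall>K. compact K \<longrightarrow> f absolutely_integrable_on K)"

text \<open>\<open>distr_of f\<close> is the regular distribution of \<open>f\<close>; it is only meaningful for locally
  integrable \<open>f\<close>.\<close>

definition distr_of :: "('a::euclidean_space \<Rightarrow> real) \<Rightarrow> ('a \<Rightarrow> real) \<Rightarrow> real" where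
  "distr_of f \<phi> = (LINT x|lebesgue. f x * \<phi> x)"

definition distr_deriv ::
    "'a::euclidean_space \<Rightarrow> (('a \<Rightarrow> real) \<Rightarrow> real) \<Rightarrow> ('a \<Rightarrow> real) \<Rightarrow> real" where
  "distr_deriv b T \<phi> = - T (partial_deriv b \<phi>)"

abbreviation distr_partial ::
    "'n::finite \<Rightarrow> ((real ^ 'n \<Rightarrow> real) \<Rightarrow> real) \<Rightarrow> (real ^ 'n \<Rightarrow> real) \<Rightarrow> real" where
  "distr_partial j \<equiv> distr_deriv (axis j 1)"


section \<open>Function spaces\<close>

definition Lp_space :: "real \<Rightarrow> ('a::euclidean_space \<Rightarrow> 'b::euclidean_space) set" where
  "Lp_space p = {u \<in> borel_measurable lebesgue.
     (\<integral>\<^sup>+ x. ennreal (norm (u x) powr p) \<partial>lebesgue) < \<infinity>}"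

text \<open>The Luxemburg norm. The infimum of the empty set in \<^typ>\<open>ennreal\<close> is \<open>\<infinity>\<close>.\<close>

definition var_Lp_norm ::
    "'a::euclidean_space set \<Rightarrow> ('a \<Rightarrow> real) \<Rightarrow> ('a \<Rightarrow> 'b::euclidean_space) \<Rightarrow> ennreal" where
  "var_Lp_norm \<Omega> p u =
     (INF l\<in>{l::real. l > 0 \<and>
         (\<integral>\<^sup>+ x\<in>\<Omega>. ennreal ((norm (u x) / l) powr p x) \<partial>lebesgue) \<le> 1}. ennreal l)"

text \<open>Used only for measurable exponents with essential infimum above 1 and finite essential
  supremum.\<close>

definition var_Lp_space ::
    "'a::euclidean_space set \<Rightarrow> ('a \<Rightarrow> real) \<Rightarrow> ('a \<Rightarrow> 'b::euclidean_space) set" where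
  "var_Lp_space \<Omega> p = {u \<in> borel_measurable (lebesgue_on \<Omega>). var_Lp_norm \<Omega> p u < \<infinity>}"

text \<open>\<open>G x $ i $ j\<close> is \<open>\<partial>\<^sub>j u\<^sub>i\<close> at \<open>x\<close>.\<close>

definition has_weak_gradient ::
    "(real ^ 'n::finite \<Rightarrow> real ^ 'm::finite) \<Rightarrow> (real ^ 'n \<Rightarrow> real ^ 'n ^ 'm) \<Rightarrow> bool" where
  "has_weak_gradient u G \<longleftrightarrow>
     locally_integrable u \<and> locally_integrable G \<and>
     (\<forall>i j. \<forall>\<phi>\<in>test_functions.
        distr_partial j (distr_of (\<lambda>x. u x $ i)) \<phi> = distr_of (\<lambda>x. G x $ i $ j) \<phi>)"

definition homogeneous_H1 :: "(real ^ 3 \<Rightarrow> real ^ 3) set" where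
  "homogeneous_H1 = {u \<in> Lp_space 6. \<exists>G. has_weak_gradient u G \<and> G \<in> Lp_space 2}"


section \<open>The stationary Navier--Stokes equations\<close>

text \<open>The pressure is an arbitrary distribution. The term \<open>u \<cdot> \<nabla>u\<close> is the function
  \<open>\<lambda>x. G x *v u x\<close>, with components \<open>\<Sum>\<^sub>j u\<^sub>j \<partial>\<^sub>j u\<^sub>i\<close>; its local integrability is what makes the
  equation meaningful, and it is automatic for \<open>u\<close> in \<open>homogeneous_H1\<close>.\<close>

definition stationary_NS_solution :: "(real ^ 3 \<Rightarrow> real ^ 3) \<Rightarrow> bool" where
  "stationary_NS_solution u \<longleftrightarrow>
     (\<exists>P G. distribution P \<and> has_weak_gradient u G \<and>
        locally_integrable (\<lambda>x. G x *v u x) \<and>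
        (\<forall>i. \<forall>\<phi>\<in>test_functions.
           - (\<Sum>j\<in>UNIV. distr_partial j (distr_partial j (distr_of (\<lambda>x. u x $ i))) \<phi>)
           + distr_of (\<lambda>x. (G x *v u x) $ i) \<phi>
           + distr_partial i P \<phi> = 0) \<and>
        (\<forall>\<phi>\<in>test_functions.
           (\<Sum>j\<in>UNIV. distr_partial j (distr_of (\<lambda>x. u x $ j)) \<phi>) = 0))"

definition eps_exponent :: "real \<Rightarrow> real ^ 3 \<Rightarrow> real" where
  "eps_exponent R0 x = (if norm x < R0 then 3/2 else 3/2 * (R0 / norm x))"

text \<open>The exponent \<open>9/2 + \<epsilon>\<close> is admissible.\<close>

lemma eps_exponent_admissible:
  assumes "R0 > 3/2"
  shows "(\<lambda>x. 9/2 + eps_exponent R0 x) \<in> borel_measurable lebesgue"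
    and "9/2 < 9/2 + eps_exponent R0 x" and "9/2 + eps_exponent R0 x \<le> 6"
proof -
  have "(\<lambda>x. 9/2 + eps_exponent R0 x) \<in> borel_measurable borel"
    unfolding eps_exponent_def by measurable
  then show "(\<lambda>x. 9/2 + eps_exponent R0 x) \<in> borel_measurable lebesgue"
    by (intro measurable_completion) simp
  show "9/2 < 9/2 + eps_exponent R0 x"
    using assms by (auto simp: eps_exponent_def intro!: divide_pos_pos)
  show "9/2 + eps_exponent R0 x \<le> 6"
  proof (cases "norm x < R0")
    case False
    then have "R0 / norm x \<le> 1" using assms by (simp add: divide_le_eq)
    with False show ?thesis unfolding eps_exponent_def by simp
  qed (simp add: eps_exponent_def)
qed

end

theory Submission
  imports Defs
begin

text \<open>
  The variable exponent enters only through one fact: since the excess \<open>\<epsilon>\<close> decays like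
  \<open>1/|x|\<close>, the velocity belongs to \<open>L\<^bsup>9/2\<^esup>\<close> (\<open>powr_le_eps_exponent\<close>).
  Where \<open>|u|\<close> is not smaller than a fixed negative power of \<open>|x|\<close>, the factor
  \<open>|u|\<^bsup>-\<epsilon>\<^esup>\<close> is bounded by a power \<open>|x|\<^bsup>c/|x|\<^esup>\<close>, hence by a constant, and where \<open>|u|\<close> is smaller,
  \<open>|u|\<^bsup>9/2\<^esup>\<close> is integrable at infinity. The rest is a Liouville theorem for
  \<open>u \<in> L\<^bsup>9/2\<^esup> \<inter> L\<^sup>6\<close> with \<open>\<nabla>u \<in> L\<^sup>2\<close>.

  The natural idea is to test the equation with \<open>\<phi>\<^sub>R u\<close>, where \<open>\<phi>\<^sub>R\<close> is a cut-off at scale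
  \<open>R\<close>. This field is not divergence free, so the pressure does not drop out. It is corrected as
  follows. Let \<open>v = \<phi>\<^sub>R u\<close>, let \<open>N\<close> be the Newtonian kernel and
  \<open>A\<^sub>i\<^sub>k = \<partial>\<^sub>i(N * v\<^sub>k) - \<partial>\<^sub>k(N * v\<^sub>i)\<close>. With a second cut-off \<open>\<eta>\<close>, equal to one on the support
  of \<open>v\<close>, the field \<open>\<psi>\<^sub>i = \<Sum>\<^sub>k \<partial>\<^sub>k(\<eta> A\<^sub>i\<^sub>k)\<close> has compact support and is divergence free, because
  \<open>A\<close> is antisymmetric. Since \<open>curl curl = \<nabla> div - \<Delta>\<close>, it equals \<open>v\<close> plus \<open>\<eta> \<nabla>g\<close> plus terms in
  which a derivative falls on \<open>\<eta>\<close>; here \<open>g = N * (u \<cdot> \<nabla>\<phi>\<^sub>R)\<close>, as \<open>u\<close> is divergence free. The kernel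
  is regularised to \<open>(d\<^sup>2 + |x|\<^sup>2)\<^bsup>-1/2\<^esup>\<close> up to a constant. Then \<open>\<psi>\<close> is smooth for merely
  integrable \<open>v\<close>, and minus the Laplacian of the kernel is an explicit positive approximate identity
  (\<open>scaled_eq_laplacian_newton\<close>), so that the same family of kernels serves as mollifier.
  All bounds on the error terms are uniform in \<open>d\<close>, and \<open>flux_limit\<close> lets \<open>d\<close> tend to zero.

  Two kinds of error terms remain. Those containing a derivative of \<open>\<eta>\<close> live far from the
  support of \<open>v\<close> and are bounded pointwise by the decay of the kernel (\<open>outer_err_bound\<close>). The term
  \<open>\<eta> \<nabla>\<^sup>2 g\<close> is bounded in \<open>L\<^sup>2\<close> by \<open>u \<cdot> \<nabla>\<phi>\<^sub>R\<close> (\<open>potential_hessian_bound\<close>); only the exponent two is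
  needed, because \<open>u \<otimes> u\<close> is locally in \<open>L\<^sup>2\<close>, so two integrations by parts
  (\<open>hessian_energy_identity\<close>) suffice in place of Calderon-Zygmund theory.

  Every term on the right of the resulting inequality \<open>energy_at_scale\<close> is controlled by the
  finite integral of \<open>|\<nabla>u|\<^sup>2\<close> and by integrals of powers of \<open>|u|\<close>. The exponent \<open>9/2\<close> is critical: at \<open>R = n\<^sup>3\<close> the integrals of
  \<open>|u|\<^sup>q\<close> with \<open>1 \<le> q \<le> 4\<close> over balls of radius comparable to \<open>R\<close> are at most of order
  \<open>n\<^bsup>9-2q\<^esup>\<close>, and of smaller order over annuli. The powers of \<open>n\<close> cancel in the
  leading terms, each of which contains an integral over an annulus; hence
  \<open>\<integral> \<phi>\<^sub>R |\<nabla>u|\<^sup>2\<close> tends to zero (\<open>energy_vanishes\<close>). So \<open>\<nabla>u = 0\<close>, and a field in \<open>L\<^sup>6\<close> with zero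
  gradient vanishes (\<open>weakly_constant_L6_zero\<close>).
\<close>


section \<open>Calculus of smooth functions\<close>

lemma partial_derivI:
  assumes "(f has_derivative f') (at x)"
  shows "partial_deriv b f x = f' b"
  using frechet_derivative_at[OF assms] by (simp add: partial_deriv_def)

text \<open>Differentiability up to a finite order; closure properties of \<^const>\<open>smooth_fun\<close> are proved by
  induction on the order.\<close>

primrec ck_fun :: "nat \<Rightarrow> ('a::euclidean_space \<Rightarrow> real) \<Rightarrow> bool" where
  "ck_fun 0 f \<longleftrightarrow> (\<forall>x. f differentiable at x)"
| "ck_fun (Suc n) f \<longleftrightarrow> (\<forall>x. f differentiable at x) \<and> (\<forall>b\<in>Basis. ck_fun n (partial_deriv b f))"

lemma ck_fun_iff:
  "ck_fun n f \<longleftrightarrow> (\<forall>bs. set bs \<subseteq> Basis \<and> length bs \<le> n \<longrightarrow> (\<forall>x. iter_partial bs f differentiable (at x)))"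
proof (induction n arbitrary: f)
  case 0
  then show ?case by (auto simp: iter_partial_def)
next
  case (Suc n)
  show ?case (is "_ \<longleftrightarrow> ?R")
  proof
    assume L: "ck_fun (Suc n) f"
    show ?R
    proof (intro allI impI)
      fix bs x assume bs: "set bs \<subseteq> (Basis::'a set) \<and> length bs \<le> Suc n"
      show "iter_partial bs f differentiable (at x)"
      proof (cases bs rule: rev_cases)
        case Nil then show ?thesis using L by (simp add: iter_partial_def)
      next
        case (snoc cs c)
        then have "ck_fun n (partial_deriv c f)" using L bs by auto
        then have "iter_partial cs (partial_deriv c f) differentiable (at x)"
          using Suc.IH bs snoc by auto
        then show ?thesis by (simp add: snoc iter_partial_def)
      qed
    qed
  next
    assume R: ?R
    have "f differentiable at x" for x
      using R[rule_format, of "[]" x] by (simp add: iter_partial_def)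
    moreover have "ck_fun n (partial_deriv b f)" if "b \<in> Basis" for b
      unfolding Suc.IH
    proof (intro allI impI)
      fix bs x assume "set bs \<subseteq> (Basis::'a set) \<and> length bs \<le> n"
      then show "iter_partial bs (partial_deriv b f) differentiable (at x)"
        using R[rule_format, of "bs @ [b]" x] that by (simp add: iter_partial_def)
    qed
    ultimately show "ck_fun (Suc n) f" by simp
  qed
qed

lemma smooth_fun_iff_ck: "smooth_fun f \<longleftrightarrow> (\<forall>n. ck_fun n f)"
  unfolding smooth_fun_def ck_fun_iff by auto

lemma ck_fun_differentiable: "ck_fun n f \<Longrightarrow> f differentiable at x"
  by (cases n) auto

lemma ck_fun_SucD: "ck_fun (Suc n) f \<Longrightarrow> ck_fun n f"
  unfolding ck_fun_iff by auto

lemma smooth_differentiable: "smooth_fun f \<Longrightarrow> f differentiable at x"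
  using ck_fun_differentiable smooth_fun_iff_ck by blast

lemma smooth_partial: "smooth_fun f \<Longrightarrow> b \<in> Basis \<Longrightarrow> smooth_fun (partial_deriv b f)"
  unfolding smooth_fun_iff_ck by (metis ck_fun.simps(2))

lemma smooth_has_derivative:
  assumes "smooth_fun f"
  shows "(f has_derivative (\<lambda>h. \<Sum>b\<in>Basis. (h \<bullet> b) * partial_deriv b f x)) (at x)"
proof -
  have d: "(f has_derivative frechet_derivative f (at x)) (at x)"
    using smooth_differentiable[OF assms] frechet_derivative_works by blast
  have lin: "linear (frechet_derivative f (at x))"
    using d has_derivative_linear by blast
  have "frechet_derivative f (at x) h = (\<Sum>b\<in>Basis. (h \<bullet> b) * partial_deriv b f x)" for h
  proof -
    have "frechet_derivative f (at x) h = frechet_derivative f (at x) (\<Sum>b\<in>Basis. (h \<bullet> b) *\<^sub>R b)"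
      by (simp add: euclidean_representation)
    also have "\<dots> = (\<Sum>b\<in>Basis. (h \<bullet> b) * partial_deriv b f x)"
      using lin by (simp add: linear_sum linear_scale partial_deriv_def)
    finally show ?thesis .
  qed
  then show ?thesis using d by (metis (no_types, lifting) ext)
qed

lemma smooth_continuous_on: "smooth_fun f \<Longrightarrow> continuous_on S f"
  by (meson differentiable_imp_continuous_on differentiable_on_def differentiable_at_withinI smooth_differentiable)

lemma smooth_borel [measurable_dest]: "smooth_fun f \<Longrightarrow> f \<in> borel_measurable borel"
  by (intro borel_measurable_continuous_onI smooth_continuous_on)

lemma partial_deriv_const: "partial_deriv b (\<lambda>_. c) = (\<lambda>_. 0)"
  by (rule ext, rule partial_derivI) (auto intro: derivative_intros)

lemma partial_deriv_add:
  assumes "\<And>x. f differentiable at x" "\<And>x. g differentiable at x"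
  shows "partial_deriv b (\<lambda>x. f x + g x) = (\<lambda>x. partial_deriv b f x + partial_deriv b g x)"
proof (rule ext)
  fix x
  show "partial_deriv b (\<lambda>x. f x + g x) x = partial_deriv b f x + partial_deriv b g x"
    using partial_derivI[OF has_derivative_add[OF assms[THEN frechet_derivative_works[THEN iffD1]]]]
    by (simp add: partial_deriv_def)
qed

lemma partial_deriv_mult:
  assumes "\<And>x. f differentiable at x" "\<And>x. g differentiable at x"
  shows "partial_deriv b (\<lambda>x. f x * g x) = (\<lambda>x. f x * partial_deriv b g x + partial_deriv b f x * g x)"
proof (rule ext)
  fix x
  show "partial_deriv b (\<lambda>x. f x * g x) x = f x * partial_deriv b g x + partial_deriv b f x * g x"
    using partial_derivI[OF has_derivative_mult[OF assms[THEN frechet_derivative_works[THEN iffD1]]]]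
    by (simp add: partial_deriv_def)
qed

lemma smooth_const: "smooth_fun (\<lambda>_::'a::euclidean_space. c)"
proof -
  have "ck_fun n (\<lambda>_::'a. c)" for n and c :: real
    by (induction n arbitrary: c) (auto simp: partial_deriv_const)
  then show ?thesis by (simp add: smooth_fun_iff_ck)
qed

lemma ck_fun_add: "ck_fun n f \<Longrightarrow> ck_fun n g \<Longrightarrow> ck_fun n (\<lambda>x. f x + g x)"
  by (induction n arbitrary: f g) (auto simp: partial_deriv_add)

lemma ck_fun_mult: "ck_fun n f \<Longrightarrow> ck_fun n g \<Longrightarrow> ck_fun n (\<lambda>x. f x * g x)"
proof (induction n arbitrary: f g)
  case (Suc n)
  have "ck_fun n f" "ck_fun n g" using Suc.prems ck_fun_SucD by blast+
  then show ?case using Suc by (auto simp: partial_deriv_mult intro!: ck_fun_add)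
qed auto

lemma smooth_add: "smooth_fun f \<Longrightarrow> smooth_fun g \<Longrightarrow> smooth_fun (\<lambda>x. f x + g x)"
  by (simp add: smooth_fun_iff_ck ck_fun_add)

lemma smooth_mult: "smooth_fun f \<Longrightarrow> smooth_fun g \<Longrightarrow> smooth_fun (\<lambda>x. f x * g x)"
  by (simp add: smooth_fun_iff_ck ck_fun_mult)

lemma smooth_minus: "smooth_fun f \<Longrightarrow> smooth_fun (\<lambda>x. - f x)"
  using smooth_mult[OF smooth_const[of "-1"]] by fastforce

lemma smooth_diff: "smooth_fun f \<Longrightarrow> smooth_fun g \<Longrightarrow> smooth_fun (\<lambda>x. f x - g x)"
  using smooth_add[OF _ smooth_minus] by fastforce

lemma smooth_sum: "(\<And>i. i \<in> I \<Longrightarrow> smooth_fun (f i)) \<Longrightarrow> smooth_fun (\<lambda>x. \<Sum>i\<in>I. f i x)"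
  by (induction I rule: infinite_finite_induct) (auto simp: smooth_const smooth_add)

lemma partial_add:
  "smooth_fun f \<Longrightarrow> smooth_fun g \<Longrightarrow>
    partial_deriv b (\<lambda>x. f x + g x) = (\<lambda>x. partial_deriv b f x + partial_deriv b g x)"
  by (simp add: partial_deriv_add smooth_differentiable)

lemma partial_mult:
  "smooth_fun f \<Longrightarrow> smooth_fun g \<Longrightarrow>
    partial_deriv b (\<lambda>x. f x * g x) = (\<lambda>x. f x * partial_deriv b g x + partial_deriv b f x * g x)"
  by (simp add: partial_deriv_mult smooth_differentiable)

lemma partial_cmult:
  "smooth_fun f \<Longrightarrow> partial_deriv b (\<lambda>x. c * f x) = (\<lambda>x. c * partial_deriv b f x)"
  by (simp add: partial_mult smooth_const partial_deriv_const)

lemma partial_minus: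
  "smooth_fun f \<Longrightarrow> partial_deriv b (\<lambda>x. - f x) = (\<lambda>x. - partial_deriv b f x)"
  using partial_cmult[of f b "-1"] by simp

lemma partial_diff:
  "smooth_fun f \<Longrightarrow> smooth_fun g \<Longrightarrow>
    partial_deriv b (\<lambda>x. f x - g x) = (\<lambda>x. partial_deriv b f x - partial_deriv b g x)"
  using partial_add[of f "\<lambda>x. - g x" b] by (simp add: smooth_minus partial_minus)

lemma partial_sum:
  "(\<And>i. i \<in> I \<Longrightarrow> smooth_fun (f i)) \<Longrightarrow>
    partial_deriv b (\<lambda>x. \<Sum>i\<in>I. f i x) = (\<lambda>x. \<Sum>i\<in>I. partial_deriv b (f i) x)"
  by (induction I rule: infinite_finite_induct)
    (auto simp: partial_deriv_const partial_add smooth_sum)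

lemma partial_affine:
  assumes "smooth_fun f"
  shows "partial_deriv b (\<lambda>x. f (a + c *\<^sub>R x)) = (\<lambda>x. c * partial_deriv b f (a + c *\<^sub>R x))"
proof (rule ext)
  fix x
  have "((\<lambda>x. f (a + c *\<^sub>R x)) has_derivative
      (\<lambda>h. frechet_derivative f (at (a + c *\<^sub>R x)) (c *\<^sub>R h))) (at x)"
    by (rule has_derivative_compose[of "\<lambda>x. a + c *\<^sub>R x", OF _ smooth_differentiable[OF assms, THEN frechet_derivative_works[THEN iffD1]]])
      (auto intro!: derivative_eq_intros)
  moreover have "linear (frechet_derivative f (at (a + c *\<^sub>R x)))"
    by (rule linear_frechet_derivative, rule smooth_differentiable[OF assms])
  ultimately show "partial_deriv b (\<lambda>x. f (a + c *\<^sub>R x)) x = c * partial_deriv b f (a + c *\<^sub>R x)"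
    by (subst partial_derivI) (auto simp: partial_deriv_def linear_scale)
qed

lemma smooth_affine:
  assumes "smooth_fun f"
  shows "smooth_fun (\<lambda>x. f (a + c *\<^sub>R x))"
proof -
  have "ck_fun n (\<lambda>x. f (a + c *\<^sub>R x))" if "smooth_fun f" for n and f :: "'a \<Rightarrow> real"
    using that
  proof (induction n arbitrary: f)
    have *: "(\<lambda>x. f (a + c *\<^sub>R x)) differentiable at x" if "smooth_fun f" for f :: "'a \<Rightarrow> real" and x
      by (rule differentiable_compose[of f "\<lambda>x. a + c *\<^sub>R x"]) (auto intro: that smooth_differentiable)
    {
      case 0 then show ?case using * by simp
    next
      case (Suc n)
      have "ck_fun n (\<lambda>_::'a. c)" using smooth_const smooth_fun_iff_ck by blast
      then show ?case using Suc * by (auto simp: partial_affine smooth_partial intro!: ck_fun_mult)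
    }
  qed
  then show ?thesis using assms by (simp add: smooth_fun_iff_ck)
qed

lemma partial_inner: "partial_deriv b (\<lambda>x. x \<bullet> a) = (\<lambda>x. b \<bullet> a)"
  by (rule ext, rule partial_derivI) (auto intro!: derivative_eq_intros)

lemma smooth_inner: "smooth_fun (\<lambda>x. x \<bullet> a)"
proof -
  have "ck_fun n (\<lambda>x. x \<bullet> a)" for n
    using smooth_const[unfolded smooth_fun_iff_ck] by (cases n) (auto simp: partial_inner)
  then show ?thesis by (simp add: smooth_fun_iff_ck)
qed

lemma partial_radial:
  assumes "\<And>t. t \<ge> 0 \<Longrightarrow> (g has_real_derivative g' t) (at t)"
  shows "partial_deriv b (\<lambda>x::'a::euclidean_space. g (x \<bullet> x)) = (\<lambda>x. (2 * (x \<bullet> b)) * g' (x \<bullet> x))"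
proof (rule ext)
  fix x :: 'a
  have "((\<lambda>x. x \<bullet> x) has_derivative (\<lambda>h. 2 * (x \<bullet> h))) (at x)"
    by (auto intro!: derivative_eq_intros simp: inner_commute)
  from has_derivative_compose[OF this assms[of "x \<bullet> x", THEN has_field_derivative_imp_has_derivative]]
  have "((\<lambda>x. g (x \<bullet> x)) has_derivative (\<lambda>h. (2 * (x \<bullet> h)) * g' (x \<bullet> x))) (at x)"
    by (simp add: mult.commute)
  then show "partial_deriv b (\<lambda>x::'a. g (x \<bullet> x)) x = (2 * (x \<bullet> b)) * g' (x \<bullet> x)"
    by (rule partial_derivI)
qed

text \<open>Differentiating a radial function only produces polynomials times radial functions of the
  next derivative, so smoothness follows from a whole sequence of successive derivatives of the profile.\<close>

lemma smooth_radial: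
  assumes "\<And>n t. t \<ge> 0 \<Longrightarrow> (g n has_real_derivative g (Suc n) t) (at t)"
  shows "smooth_fun (\<lambda>x::'a::euclidean_space. g m (x \<bullet> x))"
proof -
  have d: "(\<lambda>x::'a. g m (x \<bullet> x)) differentiable at x" for m x
  proof -
    have "((\<lambda>x. x \<bullet> x) has_derivative (\<lambda>h. 2 * (x \<bullet> h))) (at x)"
      by (auto intro!: derivative_eq_intros simp: inner_commute)
    from has_derivative_compose[OF this assms[of "x \<bullet> x" m, THEN has_field_derivative_imp_has_derivative]]
    show ?thesis unfolding differentiable_def by auto
  qed
  have "ck_fun n (\<lambda>x::'a. g m (x \<bullet> x))" for n m
  proof (induction n arbitrary: m)
    case (Suc n)
    have lin: "ck_fun n (\<lambda>x::'a. 2 * (x \<bullet> b))" for b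
      using smooth_mult[OF smooth_const[of 2] smooth_inner[of b]] by (simp add: smooth_fun_iff_ck)
    have "ck_fun n (partial_deriv b (\<lambda>x::'a. g m (x \<bullet> x)))" for b
      by (subst partial_radial[where g="g m" and g'="g (Suc m)"]) (auto intro!: assms ck_fun_mult Suc lin)
    then show ?case using d by simp
  qed (use d in auto)
  then show ?thesis by (simp add: smooth_fun_iff_ck)
qed

lemma partial_along_line:
  assumes g: "smooth_fun g"
  shows "((\<lambda>t. g (y + t *\<^sub>R b)) has_real_derivative partial_deriv b g (y + t *\<^sub>R b)) (at t)"
proof -
  have lin: "linear (frechet_derivative g (at (y + t *\<^sub>R b)))"
    by (rule linear_frechet_derivative, rule smooth_differentiable[OF g])
  have "((\<lambda>t. g (y + t *\<^sub>R b)) has_derivative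
      (\<lambda>h. frechet_derivative g (at (y + t *\<^sub>R b)) (h *\<^sub>R b))) (at t)"
    by (rule has_derivative_compose[of "\<lambda>t. y + t *\<^sub>R b", OF _ smooth_differentiable[OF g, THEN frechet_derivative_works[THEN iffD1]]])
      (auto intro!: derivative_eq_intros)
  then show ?thesis
    using lin by (auto simp: has_field_derivative_def partial_deriv_def linear_scale mult.commute
      elim!: has_derivative_eq_rhs)
qed

text \<open>Both mixed derivatives are limits of the same second difference
  \<open>f (x + s b + s c) - f (x + s b) - f (x + s c) + f x\<close>, divided by \<open>s\<^sup>2\<close>.\<close>

lemma second_difference_mean_value:
  assumes f: "smooth_fun f" and b: "b \<in> Basis" and c: "c \<in> Basis" and s: "s > (0::real)"
  obtains p q where "0 < p" "p < s" "0 < q" "q < s"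
    "f (x + s *\<^sub>R b + s *\<^sub>R c) - f (x + s *\<^sub>R b) - f (x + s *\<^sub>R c) + f x
      = s * s * partial_deriv c (partial_deriv b f) (x + p *\<^sub>R b + q *\<^sub>R c)"
proof -
  define F where "F t = f ((x + s *\<^sub>R c) + t *\<^sub>R b) - f (x + t *\<^sub>R b)" for t
  have "(F has_real_derivative partial_deriv b f ((x + s *\<^sub>R c) + t *\<^sub>R b) - partial_deriv b f (x + t *\<^sub>R b)) (at t)" for t
    unfolding F_def by (rule DERIV_diff; rule partial_along_line[OF f])
  from MVT2[OF s this] obtain p where p: "0 < p" "p < s"
    "F s - F 0 = (s - 0) * (partial_deriv b f ((x + s *\<^sub>R c) + p *\<^sub>R b) - partial_deriv b f (x + p *\<^sub>R b))"
    by blast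
  from MVT2[OF s partial_along_line[OF smooth_partial[OF f b], of "x + p *\<^sub>R b" c]] obtain q where q: "0 < q" "q < s"
    "partial_deriv b f ((x + p *\<^sub>R b) + s *\<^sub>R c) - partial_deriv b f ((x + p *\<^sub>R b) + 0 *\<^sub>R c)
       = (s - 0) * partial_deriv c (partial_deriv b f) ((x + p *\<^sub>R b) + q *\<^sub>R c)" by blast
  have "F s - F 0 = f (x + s *\<^sub>R b + s *\<^sub>R c) - f (x + s *\<^sub>R b) - f (x + s *\<^sub>R c) + f x"
    by (simp add: F_def algebra_simps)
  moreover have "F s - F 0 = s * s * partial_deriv c (partial_deriv b f) (x + p *\<^sub>R b + q *\<^sub>R c)"
    using p(3) q(3) by (simp add: algebra_simps)
  ultimately show ?thesis using that p(1,2) q(1,2) by metis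
qed

text \<open>Both iterated derivatives are continuous, and at nearby points they take the same value.\<close>

lemma partial_commute:
  assumes f: "smooth_fun f" and b: "b \<in> Basis" and c: "c \<in> Basis"
  shows "partial_deriv b (partial_deriv c f) = partial_deriv c (partial_deriv b f)"
proof (rule ext)
  fix x
  define A where "A = partial_deriv c (partial_deriv b f)"
  define B where "B = partial_deriv b (partial_deriv c f)"
  have cont: "isCont A x" "isCont B x"
    using smooth_continuous_on[of A UNIV] smooth_continuous_on[of B UNIV]
    by (auto simp: A_def B_def f b c smooth_partial continuous_on_eq_continuous_at)
  have "\<bar>A x - B x\<bar> \<le> 0 + e" if e: "e > 0" for e
  proof -
    obtain d1 where d1: "d1 > 0" "\<And>y. dist y x < d1 \<Longrightarrow> dist (A y) (A x) < e/2"
      using cont(1) e unfolding continuous_at_eps_delta by (meson half_gt_zero)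
    obtain d2 where d2: "d2 > 0" "\<And>y. dist y x < d2 \<Longrightarrow> dist (B y) (B x) < e/2"
      using cont(2) e unfolding continuous_at_eps_delta by (meson half_gt_zero)
    \<comment> \<open>The two intermediate points lie within distance \<open>2 s\<close> of \<open>x\<close>.\<close>
    define s where "s = min d1 d2 / 2"
    have s: "s > 0" using d1 d2 by (simp add: s_def)
    have near: "dist (x + p *\<^sub>R v + q *\<^sub>R w) x < min d1 d2"
      if "0 < p" "p < s" "0 < q" "q < s" "v \<in> Basis" "w \<in> Basis" for p q and v w :: 'a
    proof -
      have "dist (x + p *\<^sub>R v + q *\<^sub>R w) x = norm (p *\<^sub>R v + q *\<^sub>R w)"
        by (simp add: dist_norm algebra_simps)
      also have "\<dots> \<le> p + q" using norm_triangle_ineq[of "p *\<^sub>R v" "q *\<^sub>R w"] that by simp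
      finally show ?thesis using that by (simp add: s_def)
    qed
    obtain p q where pq: "0 < p" "p < s" "0 < q" "q < s"
      "f (x + s *\<^sub>R b + s *\<^sub>R c) - f (x + s *\<^sub>R b) - f (x + s *\<^sub>R c) + f x = s * s * A (x + p *\<^sub>R b + q *\<^sub>R c)"
      using second_difference_mean_value[OF f b c s] unfolding A_def by metis
    obtain p' q' where pq': "0 < p'" "p' < s" "0 < q'" "q' < s"
      "f (x + s *\<^sub>R c + s *\<^sub>R b) - f (x + s *\<^sub>R c) - f (x + s *\<^sub>R b) + f x = s * s * B (x + p' *\<^sub>R c + q' *\<^sub>R b)"
      using second_difference_mean_value[OF f c b s] unfolding B_def by metis
    have "s * s * A (x + p *\<^sub>R b + q *\<^sub>R c) = s * s * B (x + p' *\<^sub>R c + q' *\<^sub>R b)"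
      using pq(5) pq'(5) by (simp add: algebra_simps)
    then have "A (x + p *\<^sub>R b + q *\<^sub>R c) = B (x + p' *\<^sub>R c + q' *\<^sub>R b)" using s by simp
    moreover have "dist (A (x + p *\<^sub>R b + q *\<^sub>R c)) (A x) < e/2"
      using d1(2) near[OF pq(1-4) b c] by simp
    moreover have "dist (B (x + p' *\<^sub>R c + q' *\<^sub>R b)) (B x) < e/2"
      using d2(2) near[OF pq'(1-4) c b] by simp
    ultimately show ?thesis unfolding dist_real_def by linarith
  qed
  then have "\<bar>A x - B x\<bar> \<le> 0" by (rule field_le_epsilon)
  then show "partial_deriv b (partial_deriv c f) x = partial_deriv c (partial_deriv b f) x"
    by (simp add: A_def B_def)
qed

section \<open>Test functions\<close>

lemma smooth_inverse:
  assumes f: "smooth_fun f" and nz: "\<And>x. f x \<noteq> 0"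
  shows "smooth_fun (\<lambda>x. inverse (f x))"
proof -
  have fd: "(f has_derivative frechet_derivative f (at x)) (at x)" for x
    using smooth_differentiable[OF f] frechet_derivative_works by blast
  have d: "((\<lambda>x. inverse (f x)) has_derivative (\<lambda>h. - (inverse (f x) * frechet_derivative f (at x) h * inverse (f x)))) (at x)" for x
    by (rule Deriv.has_derivative_inverse[OF nz fd])
  have p: "partial_deriv b (\<lambda>x. inverse (f x)) =
      (\<lambda>x. (-1) * (inverse (f x) * partial_deriv b f x * inverse (f x)))" for b
    by (rule ext, unfold partial_derivI[OF d]) (simp add: partial_deriv_def)
  have "ck_fun n (\<lambda>x. inverse (f x))" for n
  proof (induction n)
    case 0 then show ?case using d differentiable_def by auto
  next
    case (Suc n)
    have "ck_fun n (partial_deriv b f)" if "b \<in> Basis" for b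
      using smooth_partial[OF f that] smooth_fun_iff_ck by blast
    moreover have "ck_fun n (\<lambda>_::'a. -1)" using smooth_const smooth_fun_iff_ck by blast
    ultimately have "ck_fun n (partial_deriv b (\<lambda>x. inverse (f x)))" if "b \<in> Basis" for b
      unfolding p using Suc that by (intro ck_fun_mult) auto
    then show ?case using d by (auto simp: differentiable_def)
  qed
  then show ?thesis by (simp add: smooth_fun_iff_ck)
qed

lemma partial_cong_open:
  assumes "open S" "x \<in> S" "\<And>y. y \<in> S \<Longrightarrow> f y = g y"
  shows "partial_deriv b f x = partial_deriv b g x"
proof -
  have "(f has_derivative D) (at x) \<longleftrightarrow> (g has_derivative D) (at x)" for D
    using has_derivative_transform_within_open[OF _ assms(1,2)] assms(3) by metis
  then show ?thesis by (simp add: partial_deriv_def frechet_derivative_def)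
qed

lemma partial_zero_outside:
  assumes "\<And>x. norm x > r \<Longrightarrow> f x = 0" "norm x > r"
  shows "partial_deriv b f x = 0"
proof -
  have "partial_deriv b f x = partial_deriv b (\<lambda>_. 0) x"
    by (rule partial_cong_open[of "{x. norm x > r}"]) (use assms in \<open>auto intro!: open_Collect_less continuous_intros\<close>)
  then show ?thesis by (simp add: partial_deriv_const)
qed

lemma test_function_smooth: "\<phi> \<in> test_functions \<Longrightarrow> smooth_fun \<phi>"
  by (simp add: test_functions_def)

lemma test_functionI:
  assumes "smooth_fun \<phi>" "\<And>x. norm x > r \<Longrightarrow> \<phi> x = 0"
  shows "\<phi> \<in> test_functions"
proof -
  have "closure {x. \<phi> x \<noteq> 0} \<subseteq> cball 0 r"
    by (rule closure_minimal) (use assms(2) in \<open>force simp: not_less[symmetric]\<close>)+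
  then have "bounded (closure {x. \<phi> x \<noteq> 0})" using bounded_cball bounded_subset by blast
  then show ?thesis using assms(1) by (simp add: test_functions_def compact_eq_bounded_closed)
qed

lemma test_function_support:
  assumes "\<phi> \<in> test_functions"
  obtains r where "r > 0" "\<And>x. norm x > r \<Longrightarrow> \<phi> x = 0"
proof -
  have "bounded (closure {x. \<phi> x \<noteq> 0})"
    using assms by (simp add: test_functions_def compact_imp_bounded)
  then obtain r where "r > 0" "\<And>x. x \<in> closure {x. \<phi> x \<noteq> 0} \<Longrightarrow> norm x \<le> r"
    unfolding bounded_pos by blast
  then show ?thesis using that[of r] closure_subset[of "{x. \<phi> x \<noteq> 0}"] by (force simp: not_less[symmetric])
qed

lemma test_function_partial:
  assumes "\<phi> \<in> test_functions" "b \<in> Basis"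
  shows "partial_deriv b \<phi> \<in> test_functions"
proof -
  obtain r where "\<And>x. norm x > r \<Longrightarrow> \<phi> x = 0" using test_function_support[OF assms(1)] by metis
  then show ?thesis
    using partial_zero_outside[of r \<phi>] by (intro test_functionI[OF smooth_partial[OF test_function_smooth[OF assms(1)] assms(2)], of r]) auto
qed

lemma test_function_mult:
  assumes "\<phi> \<in> test_functions" "smooth_fun f"
  shows "(\<lambda>x. \<phi> x * f x) \<in> test_functions"
proof -
  obtain r where "\<And>x. norm x > r \<Longrightarrow> \<phi> x = 0" using test_function_support[OF assms(1)] by metis
  then show ?thesis
    by (intro test_functionI[OF smooth_mult[OF test_function_smooth[OF assms(1)] assms(2)], of r]) auto
qed

lemma test_function_add:
  assumes "\<phi> \<in> test_functions" "\<psi> \<in> test_functions"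
  shows "(\<lambda>x. \<phi> x + \<psi> x) \<in> test_functions"
proof -
  obtain r where r: "\<And>x. norm x > r \<Longrightarrow> \<phi> x = 0" using test_function_support[OF assms(1)] by metis
  obtain s where s: "\<And>x. norm x > s \<Longrightarrow> \<psi> x = 0" using test_function_support[OF assms(2)] by metis
  show ?thesis
    by (rule test_functionI[of _ "max r s"]) (auto simp: r s smooth_add[OF assms[THEN test_function_smooth]])
qed

lemma test_function_zero: "(\<lambda>_. 0) \<in> test_functions"
  by (rule test_functionI[of _ 0]) (auto simp: smooth_const)

lemma test_function_sum:
  "(\<And>i. i \<in> I \<Longrightarrow> \<phi> i \<in> test_functions) \<Longrightarrow> (\<lambda>x. \<Sum>i\<in>I. \<phi> i x) \<in> test_functions"
  by (induction I rule: infinite_finite_induct) (auto simp: test_function_zero intro!: test_function_add)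

lemma continuous_bounded_on_cball:
  fixes f :: "'a::euclidean_space \<Rightarrow> real"
  assumes "continuous_on UNIV f"
  obtains B where "B \<ge> 0" "\<And>x. norm x \<le> r \<Longrightarrow> \<bar>f x\<bar> \<le> B"
proof -
  have "bounded (f ` cball 0 r)"
    by (intro compact_imp_bounded compact_continuous_image continuous_on_subset[OF assms]) auto
  then obtain B where "B > 0" "\<And>x. x \<in> cball 0 r \<Longrightarrow> \<bar>f x\<bar> \<le> B" unfolding bounded_pos by force
  then show ?thesis using that[of B] by auto
qed

lemma test_function_bounded:
  assumes "\<phi> \<in> test_functions"
  obtains B where "B > 0" "\<And>x. \<bar>\<phi> x\<bar> \<le> B"
proof -
  obtain r where r: "\<And>x. norm x > r \<Longrightarrow> \<phi> x = 0" using test_function_support[OF assms] by metis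
  obtain B where "B \<ge> 0" "\<And>x. norm x \<le> r \<Longrightarrow> \<bar>\<phi> x\<bar> \<le> B"
    using continuous_bounded_on_cball[OF smooth_continuous_on[OF test_function_smooth[OF assms]]] by blast
  then show ?thesis using that[of "B + 1"] r by (smt (verit))
qed

lemma integrable_bounded_support:
  fixes f :: "'a::euclidean_space \<Rightarrow> real"
  assumes "f \<in> borel_measurable borel" "\<And>x. \<bar>f x\<bar> \<le> B" "\<And>x. norm x > r \<Longrightarrow> f x = 0"
  shows "integrable lborel f"
proof (rule Bochner_Integration.integrable_bound[where f="\<lambda>x. B * indicator (cball 0 r) x"])
  have "emeasure lborel (cball (0::'a) r) < \<infinity>" by (intro emeasure_bounded_finite) auto
  then show "integrable lborel (\<lambda>x::'a. B * indicator (cball 0 r) x)"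
    by (intro integrable_mult_right integrable_real_indicator) auto
  have "\<bar>f x\<bar> \<le> \<bar>B * indicator (cball 0 r) x\<bar>" for x
    using assms(2,3)[of x] by (cases "norm x > r") (auto simp: indicator_def)
  then show "AE x in lborel. norm (f x) \<le> norm (B * indicator (cball 0 r) x)" by simp
qed (use assms in simp)

lemma test_function_integrable: 
  assumes "\<phi> \<in> test_functions" shows "integrable lborel \<phi>"
proof -
  obtain r where "\<And>x. norm x > r \<Longrightarrow> \<phi> x = 0" using test_function_support[OF assms] by metis
  moreover obtain B where "\<And>x. \<bar>\<phi> x\<bar> \<le> B" using test_function_bounded[OF assms] by metis
  ultimately show ?thesis
    by (intro integrable_bounded_support[of _ B r] smooth_borel test_function_smooth assms) auto
qed

lemma integral_shift:
  fixes f :: "'a::euclidean_space \<Rightarrow> real"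
  assumes [measurable]: "f \<in> borel_measurable borel"
  shows "(LBINT x. f (c + x)) = (LBINT x. f x)"
  by (subst lborel_distr_plus[of c, symmetric], subst integral_distr) auto

lemma nn_integral_shift:
  fixes f :: "'a::euclidean_space \<Rightarrow> ennreal"
  assumes [measurable]: "f \<in> borel_measurable borel"
  shows "(\<integral>\<^sup>+x. f (c + x) \<partial>lborel) = (\<integral>\<^sup>+x. f x \<partial>lborel)"
  by (subst lborel_distr_plus[of c, symmetric], subst nn_integral_distr) auto

lemma integrable_shift:
  fixes f :: "'a::euclidean_space \<Rightarrow> real"
  assumes "integrable lborel f"
  shows "integrable lborel (\<lambda>x. f (c + x))"
proof -
  have [measurable]: "f \<in> borel_measurable borel" using assms by auto
  have "integrable (distr lborel borel ((+) c)) f" using assms lborel_distr_plus[of c] by simp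
  then show ?thesis by (subst (asm) integrable_distr_eq) auto
qed

text \<open>The integral of \<open>\<phi> (x + t b)\<close> does not depend on \<open>t\<close>; its derivative at \<open>t = 0\<close> is the
  integral below.\<close>

lemma integral_partial_test_function:
  assumes \<phi>: "\<phi> \<in> test_functions" and b: "b \<in> Basis"
  shows "(LBINT x. partial_deriv b \<phi> x) = 0"
proof -
  obtain r where r: "r > 0" "\<And>x. norm x > r \<Longrightarrow> \<phi> x = 0" using test_function_support[OF \<phi>] by metis
  have s: "smooth_fun \<phi>" using \<phi> test_function_smooth by blast
  obtain B where B: "B > 0" "\<And>x. \<bar>partial_deriv b \<phi> x\<bar> \<le> B"
    using test_function_bounded[OF test_function_partial[OF \<phi> b]] by metis
  have [measurable]: "\<phi> \<in> borel_measurable borel" "partial_deriv b \<phi> \<in> borel_measurable borel"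
    using smooth_borel s smooth_partial b by blast+
  define h where "h n = 1 / real (Suc n)" for n
  have h: "0 < h n" "h n \<le> 1" for n by (auto simp: h_def field_simps)
  define q where "q n x = (\<phi> (h n *\<^sub>R b + x) - \<phi> x) / h n" for n x
  have q0: "(LBINT x. q n x) = 0" for n
    unfolding q_def using integrable_shift[OF test_function_integrable[OF \<phi>], of "h n *\<^sub>R b"] test_function_integrable[OF \<phi>]
    by (simp add: integral_shift)
  have qB: "\<bar>q n x\<bar> \<le> B * indicator (cball 0 (r+1)) x" for n x
  proof (cases "norm x > r + 1")
    case True
    have "norm x \<le> norm (h n *\<^sub>R b + x) + norm (h n *\<^sub>R b)"
      using norm_triangle_ineq4[of "h n *\<^sub>R b + x" "h n *\<^sub>R b"] by simp
    also have "norm (h n *\<^sub>R b) \<le> 1" using b h[of n] by simp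
    finally have "norm (h n *\<^sub>R b + x) > r" using True by simp
    then show ?thesis using r True B by (simp add: q_def)
  next
    case False
    obtain z where "0 < z" "z < h n" "\<phi> (x + h n *\<^sub>R b) - \<phi> (x + 0 *\<^sub>R b) = (h n - 0) * partial_deriv b \<phi> (x + z *\<^sub>R b)"
      using MVT2[OF h(1) partial_along_line[OF s, of x b]] by blast
    then have "q n x = partial_deriv b \<phi> (x + z *\<^sub>R b)" using h(1)[of n] by (simp add: q_def add.commute)
    then show ?thesis using False B by (simp add: indicator_def)
  qed
  have qlim: "(\<lambda>n. q n x) \<longlonglongrightarrow> partial_deriv b \<phi> x" for x
  proof -
    have "((\<lambda>t. \<phi> (x + t *\<^sub>R b)) has_real_derivative partial_deriv b \<phi> x) (at 0)"
      using partial_along_line[OF s, of x b 0] by simp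
    then have *: "((\<lambda>t. (\<phi> (x + t *\<^sub>R b) - \<phi> x) / t) \<longlongrightarrow> partial_deriv b \<phi> x) (at 0)"
      by (simp add: DERIV_def)
    have "filterlim h (at 0) sequentially"
    proof -
      have "h \<longlonglongrightarrow> 0" using LIMSEQ_inverse_real_of_nat by (simp add: h_def[abs_def] inverse_eq_divide)
      then show ?thesis using h(1) by (auto simp: filterlim_at less_imp_neq[symmetric])
    qed
    from filterlim_compose[OF * this] show ?thesis by (simp add: q_def[abs_def] add.commute)
  qed
  have "integrable lborel (\<lambda>x::'a. B * indicator (cball 0 (r+1)) x)"
    by (intro integrable_mult_right integrable_real_indicator emeasure_bounded_finite) auto
  then have "(\<lambda>n. LBINT x. q n x) \<longlonglongrightarrow> (LBINT x. partial_deriv b \<phi> x)"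
    by (intro integral_dominated_convergence[where w="\<lambda>x. B * indicator (cball 0 (r+1)) x"] AE_I2)
      (use qlim qB in \<open>auto simp: q_def[abs_def]\<close>)
  then show ?thesis using q0 LIMSEQ_unique[OF _ tendsto_const] by fastforce
qed

subsection \<open>A cut-off function\<close>

text \<open>\<open>flat_exp p\<close> is \<open>p (1/t) exp (-1/t)\<close>, continued by zero; the class of these functions is
  closed under differentiation.\<close>

definition flat_exp :: "real poly \<Rightarrow> real \<Rightarrow> real" where
  "flat_exp p t = (if t > 0 then poly p (1/t) * exp (- (1/t)) else 0)"

definition flat_exp_deriv :: "real poly \<Rightarrow> real poly" where
  "flat_exp_deriv p = [:0,0,1:] * (p - pderiv p)"

lemma poly_exp_decay: "((\<lambda>s. poly p s * exp (- s)) \<longlongrightarrow> (0::real)) at_top"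
proof -
  have "((\<lambda>s. \<Sum>i\<le>degree p. coeff p i * (s ^ i / exp s)) \<longlongrightarrow> (\<Sum>i\<le>degree p. coeff p i * 0)) at_top"
    by (intro tendsto_sum tendsto_mult tendsto_const tendsto_power_div_exp_0)
  then show ?thesis by (simp add: poly_altdef sum_distrib_right sum_divide_distrib exp_minus field_simps)
qed

lemma flat_exp_has_derivative:
  "(flat_exp p has_real_derivative flat_exp (flat_exp_deriv p) t) (at t)"
proof -
  consider "t > 0" | "t < 0" | "t = 0" by linarith
  then show ?thesis
  proof cases
    case 1
    have "((\<lambda>t. poly p (1/t) * exp (- (1/t))) has_real_derivative flat_exp (flat_exp_deriv p) t) (at t)"
      using 1 by (auto intro!: derivative_eq_intros DERIV_chain'[where g="poly p", OF _ poly_DERIV]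
        simp: flat_exp_def flat_exp_deriv_def field_simps power2_eq_square)
    then show ?thesis
      by (rule has_field_derivative_transform_within_open[of _ _ _ "{0<..}"]) (use 1 in \<open>auto simp: flat_exp_def\<close>)
  next
    case 2
    have "((\<lambda>t. 0) has_real_derivative flat_exp (flat_exp_deriv p) t) (at t)"
      using 2 by (simp add: flat_exp_def)
    then show ?thesis
      by (rule has_field_derivative_transform_within_open[of _ _ _ "{..<0}"]) (use 2 in \<open>auto simp: flat_exp_def\<close>)
  next
    case 3
    have right: "((\<lambda>h. flat_exp p h / h) \<longlongrightarrow> 0) (at_right 0)"
    proof (rule Lim_transform_eventually)
      have "filterlim (\<lambda>h::real. 1/h) at_top (at_right 0)"
        using filterlim_inverse_at_top_right by (simp add: inverse_eq_divide)
      from filterlim_compose[OF poly_exp_decay[of "[:0,1:] * p"] this]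
      show "((\<lambda>h. poly ([:0,1:] * p) (1/h) * exp (- (1/h))) \<longlongrightarrow> 0) (at_right 0)" .
      show "\<forall>\<^sub>F h in at_right 0. poly ([:0,1:] * p) (1/h) * exp (- (1/h)) = flat_exp p h / h"
        unfolding eventually_at_filter by (auto simp: flat_exp_def)
    qed
    have left: "((\<lambda>h. flat_exp p h / h) \<longlongrightarrow> 0) (at_left 0)"
      by (rule Lim_transform_eventually[OF tendsto_const])
        (auto simp: flat_exp_def eventually_at_filter)
    have "((\<lambda>h. flat_exp p h / h) \<longlongrightarrow> 0) (at 0)"
      using left right filterlim_split_at by blast
    then show ?thesis by (simp add: 3 DERIV_def flat_exp_def)
  qed
qed

definition flat_exp_iter :: "nat \<Rightarrow> real \<Rightarrow> real" where
  "flat_exp_iter n = flat_exp ((flat_exp_deriv ^^ n) 1)"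

lemma flat_exp_iter_derivative:
  "(flat_exp_iter n has_real_derivative flat_exp_iter (Suc n) t) (at t)"
  using flat_exp_has_derivative by (simp add: flat_exp_iter_def)

lemma flat_exp_iter_0: "flat_exp_iter 0 t = (if t > 0 then exp (- (1/t)) else 0)"
  by (simp add: flat_exp_iter_def flat_exp_def)

text \<open>The quotient \<open>e (4 - |x|\<^sup>2) / (e (4 - |x|\<^sup>2) + e (|x|\<^sup>2 - 1))\<close> with \<open>e t = exp (-1/t)\<close> for positive
  \<open>t\<close> and \<open>e t = 0\<close> otherwise. The denominator never vanishes, as one of the arguments is positive.\<close>

definition cutoff :: "'a::euclidean_space \<Rightarrow> real" where
  "cutoff x = flat_exp_iter 0 (4 - x \<bullet> x) *
     inverse (flat_exp_iter 0 (4 - x \<bullet> x) + flat_exp_iter 0 (x \<bullet> x - 1))"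

lemma smooth_cutoff: "smooth_fun (cutoff :: 'a::euclidean_space \<Rightarrow> real)"
proof -
  have "((\<lambda>t. flat_exp_iter n (4 - t)) has_real_derivative - flat_exp_iter (Suc n) (4 - t)) (at t)" for n t
  proof -
    have "((\<lambda>t::real. 4 - t) has_real_derivative -1) (at t)" by (auto intro!: derivative_eq_intros)
    from DERIV_chain2[OF flat_exp_iter_derivative this] show ?thesis by simp
  qed
  then have d: "((\<lambda>t. (- 1) ^ n * flat_exp_iter n (4 - t)) has_real_derivative
      (- 1) ^ Suc n * flat_exp_iter (Suc n) (4 - t)) (at t)" for n t
    using DERIV_cmult[of "\<lambda>t. flat_exp_iter n (4 - t)" _ t UNIV "(- 1) ^ n"] by fastforce
  have 1: "smooth_fun (\<lambda>x::'a. (- 1) ^ 0 * flat_exp_iter 0 (4 - x \<bullet> x))"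
    by (rule smooth_radial[where g="\<lambda>n t. (- 1) ^ n * flat_exp_iter n (4 - t)" and m=0]) (rule d)
  have "((\<lambda>t. flat_exp_iter n (t - 1)) has_real_derivative flat_exp_iter (Suc n) (t - 1)) (at t)" for n t
  proof -
    have "((\<lambda>t::real. t - 1) has_real_derivative 1) (at t)" by (auto intro!: derivative_eq_intros)
    from DERIV_chain2[OF flat_exp_iter_derivative this] show ?thesis by simp
  qed
  then have 2: "smooth_fun (\<lambda>x::'a. flat_exp_iter 0 (x \<bullet> x - 1))"
    by (intro smooth_radial[where g="\<lambda>n t. flat_exp_iter n (t - 1)" and m=0])
  have nz: "flat_exp_iter 0 (4 - x \<bullet> x) + flat_exp_iter 0 (x \<bullet> x - 1) \<noteq> 0" for x :: 'a
    using exp_gt_zero by (auto simp: flat_exp_iter_0 add_pos_pos less_imp_neq[symmetric])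
  show ?thesis unfolding cutoff_def[abs_def]
    using 1 2 nz by (intro smooth_mult smooth_inverse smooth_add) auto
qed

lemma cutoff_nonneg: "0 \<le> cutoff x"
  by (auto simp: cutoff_def flat_exp_iter_0)

lemma cutoff_le_1: "cutoff x \<le> 1"
proof -
  have *: "a * inverse (a + b) \<le> 1" if "a \<ge> 0" "b \<ge> 0" for a b :: real
    using that by (cases "a + b = 0") (auto simp: field_simps)
  show ?thesis unfolding cutoff_def by (rule *) (auto simp: flat_exp_iter_0)
qed

lemma cutoff_1: assumes "norm x \<le> 1" shows "cutoff x = 1"
proof -
  have "x \<bullet> x \<le> 1" using assms by (simp add: dot_square_norm power_le_one)
  then show ?thesis by (simp add: cutoff_def flat_exp_iter_0)
qed

lemma cutoff_0: assumes "norm x \<ge> 2" shows "cutoff x = 0"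
proof -
  have "x \<bullet> x \<ge> 2^2" using assms unfolding dot_square_norm by (intro power_mono) auto
  then show ?thesis by (simp add: cutoff_def flat_exp_iter_0)
qed

definition cutoff_at :: "real \<Rightarrow> 'a::euclidean_space \<Rightarrow> real" where
  "cutoff_at R x = cutoff (x /\<^sub>R R)"

lemma smooth_cutoff_at: "smooth_fun (cutoff_at R)"
  using smooth_affine[OF smooth_cutoff, of 0 "inverse R"] by (simp add: cutoff_at_def[abs_def])

lemma cutoff_at_nonneg: "0 \<le> cutoff_at R x"
  by (simp add: cutoff_at_def cutoff_nonneg)

lemma cutoff_at_le_1: "cutoff_at R x \<le> 1"
  by (simp add: cutoff_at_def cutoff_le_1)

lemma cutoff_at_1: "R > 0 \<Longrightarrow> norm x \<le> R \<Longrightarrow> cutoff_at R x = 1"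
  by (simp add: cutoff_at_def cutoff_1 field_simps)

lemma cutoff_at_0: "R > 0 \<Longrightarrow> norm x \<ge> 2 * R \<Longrightarrow> cutoff_at R x = 0"
  by (simp add: cutoff_at_def cutoff_0 field_simps)

lemma cutoff_at_test: "R > 0 \<Longrightarrow> cutoff_at R \<in> test_functions"
  by (rule test_functionI[of _ "2*R"]) (auto simp: smooth_cutoff_at cutoff_at_0)

lemma partial_cutoff_at: "partial_deriv b (cutoff_at R) x = partial_deriv b cutoff (x /\<^sub>R R) / R"
  using partial_affine[OF smooth_cutoff, of b 0 "inverse R"]
  by (simp add: cutoff_at_def[abs_def] divide_inverse mult.commute)

lemma partial2_cutoff_at:
  assumes "b \<in> Basis"
  shows "partial_deriv c (partial_deriv b (cutoff_at R)) x
    = partial_deriv c (partial_deriv b cutoff) (x /\<^sub>R R) / R^2"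
proof -
  have "partial_deriv b (cutoff_at R) = (\<lambda>x. inverse R * partial_deriv b cutoff (0 + inverse R *\<^sub>R x))"
    by (rule ext) (simp add: partial_cutoff_at divide_inverse mult.commute)
  then show ?thesis
    using smooth_partial[OF smooth_cutoff assms]
    by (simp add: partial_cmult smooth_affine partial_affine[of "partial_deriv b cutoff" _ 0, simplified] smooth_affine[of _ 0, simplified]
      power2_eq_square divide_inverse)
qed

lemma partial_cutoff_at_inner:
  assumes "R > 0" "norm x < R" shows "partial_deriv b (cutoff_at R) x = 0"
proof -
  have "partial_deriv b (cutoff_at R) x = partial_deriv b (\<lambda>_. 1) x"
    by (rule partial_cong_open[of "ball 0 R"]) (use assms in \<open>auto simp: cutoff_at_1\<close>)
  then show ?thesis by (simp add: partial_deriv_const)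
qed

lemma partial_cutoff_at_outer:
  assumes "R > 0" "norm x > 2 * R" shows "partial_deriv b (cutoff_at R) x = 0"
  by (rule partial_zero_outside[of "2*R"]) (use assms in \<open>auto simp: cutoff_at_0\<close>)

lemma partial2_cutoff_at_inner:
  assumes "R > 0" "norm x < R" shows "partial_deriv c (partial_deriv b (cutoff_at R)) x = 0"
proof -
  have "partial_deriv c (partial_deriv b (cutoff_at R)) x = partial_deriv c (\<lambda>_. 0) x"
    by (rule partial_cong_open[of "ball 0 R"]) (use assms in \<open>auto simp: partial_cutoff_at_inner\<close>)
  then show ?thesis by (simp add: partial_deriv_const)
qed

lemma partial2_cutoff_at_outer:
  assumes "R > 0" "norm x > 2 * R" shows "partial_deriv c (partial_deriv b (cutoff_at R)) x = 0"
  by (rule partial_zero_outside[of "2*R"]) (use assms in \<open>auto simp: partial_cutoff_at_outer\<close>)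

lemma cutoff_derivatives_bounded:
  obtains C where "C \<ge> 1"
    "\<And>b R x. b \<in> Basis \<Longrightarrow> R > 0 \<Longrightarrow> \<bar>partial_deriv b (cutoff_at R) (x::'a::euclidean_space)\<bar> \<le> C / R"
    "\<And>b c R x. b \<in> Basis \<Longrightarrow> c \<in> Basis \<Longrightarrow> R > 0 \<Longrightarrow>
       \<bar>partial_deriv c (partial_deriv b (cutoff_at R)) (x::'a)\<bar> \<le> C / R^2"
proof -
  have t: "(cutoff :: 'a \<Rightarrow> real) \<in> test_functions"
    by (rule test_functionI[of _ 2]) (auto simp: smooth_cutoff cutoff_0)
  have "\<forall>b\<in>Basis. \<exists>B>0. \<forall>x::'a. \<bar>partial_deriv b cutoff x\<bar> \<le> B"
    using test_function_bounded[OF test_function_partial[OF t]] by metis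
  then obtain B1 where B1: "\<And>b x. b \<in> Basis \<Longrightarrow> B1 b > 0 \<and> \<bar>partial_deriv b cutoff (x::'a)\<bar> \<le> B1 b" by metis
  have "\<forall>b\<in>Basis. \<forall>c\<in>Basis. \<exists>B>0. \<forall>x::'a. \<bar>partial_deriv c (partial_deriv b cutoff) x\<bar> \<le> B"
    using test_function_bounded[OF test_function_partial[OF test_function_partial[OF t]]] by metis
  then obtain B2 where B2: "\<And>b c x. b \<in> Basis \<Longrightarrow> c \<in> Basis \<Longrightarrow> B2 b c > 0 \<and> \<bar>partial_deriv c (partial_deriv b cutoff) (x::'a)\<bar> \<le> B2 b c" by metis
  define C where "C = 1 + (\<Sum>b\<in>Basis. B1 b) + (\<Sum>b\<in>Basis. \<Sum>c\<in>Basis. B2 b c)"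
  have p1: "(\<Sum>b\<in>(Basis::'a set). B1 b) \<ge> 0" and p2: "(\<Sum>b\<in>(Basis::'a set). \<Sum>c\<in>Basis. B2 b c) \<ge> 0"
    using B1 B2 by (auto intro!: sum_nonneg simp: less_imp_le)
  have C1: "B1 b \<le> C" if "b \<in> Basis" for b
    using member_le_sum[of b Basis B1] that B1 p2 unfolding C_def by (simp add: less_imp_le)
  have C2: "B2 b c \<le> C" if "b \<in> Basis" "c \<in> Basis" for b c
  proof -
    have "B2 b c \<le> (\<Sum>c\<in>Basis. B2 b c)"
      by (rule member_le_sum) (use that B2 in \<open>auto simp: less_imp_le\<close>)
    also have "\<dots> \<le> (\<Sum>b\<in>Basis. \<Sum>c\<in>Basis. B2 b c)"
      by (rule member_le_sum[where f="\<lambda>b. \<Sum>c\<in>Basis. B2 b c"]) (use that B2 in \<open>auto simp: less_imp_le intro!: sum_nonneg\<close>)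
    finally show ?thesis using p1 unfolding C_def by simp
  qed
  show ?thesis
  proof (rule that[of C])
    show "C \<ge> 1" using p1 p2 by (simp add: C_def)
    show "\<bar>partial_deriv b (cutoff_at R) x\<bar> \<le> C / R" if "b \<in> Basis" "R > 0" for b :: 'a and R x
      using B1[OF that(1), of "x /\<^sub>R R"] C1[OF that(1)] that by (simp add: partial_cutoff_at divide_right_mono)
    show "\<bar>partial_deriv c (partial_deriv b (cutoff_at R)) x\<bar> \<le> C / R^2"
      if "b \<in> Basis" "c \<in> Basis" "R > 0" for b c :: 'a and R x
      using B2[OF that(1,2), of "x /\<^sub>R R"] C2[OF that(1,2)] that by (simp add: partial2_cutoff_at divide_right_mono)
  qed
qed

section \<open>Convolution with a smooth kernel\<close>

definition conv :: "('a::euclidean_space \<Rightarrow> real) \<Rightarrow> ('a \<Rightarrow> real) \<Rightarrow> 'a \<Rightarrow> real" where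
  "conv K v x = (LBINT y. K (x - y) * v y)"

definition compact_L1 :: "('a::euclidean_space \<Rightarrow> real) \<Rightarrow> bool" where
  "compact_L1 v \<longleftrightarrow> integrable lborel v \<and> (\<exists>r. \<forall>y. norm y > r \<longrightarrow> v y = 0)"

lemma conv_integrable:
  assumes K: "continuous_on UNIV K" and v: "compact_L1 v"
  shows "integrable lborel (\<lambda>y. K (x - y) * v y)"
proof -
  obtain r where r: "\<And>y. norm y > r \<Longrightarrow> v y = 0" using v unfolding compact_L1_def by blast
  have vi: "integrable lborel v" using v by (simp add: compact_L1_def)
  obtain B where B: "B \<ge> 0" "\<And>z. norm z \<le> norm x + r \<Longrightarrow> \<bar>K z\<bar> \<le> B"
    using continuous_bounded_on_cball[OF K] by metis
  have [measurable]: "K \<in> borel_measurable borel" "v \<in> borel_measurable borel"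
    using K vi by (auto intro: borel_measurable_continuous_onI)
  show ?thesis
  proof (rule Bochner_Integration.integrable_bound[OF integrable_mult_right[OF vi, of B]])
    show "AE y in lborel. norm (K (x - y) * v y) \<le> norm (B * v y)"
    proof (rule AE_I2)
      fix y
      show "norm (K (x - y) * v y) \<le> norm (B * v y)"
      proof (cases "norm y > r")
        case False
        have "norm (x - y) \<le> norm x + r" using norm_triangle_ineq4[of x y] False by simp
        then show ?thesis using B by (simp add: abs_mult mult_right_mono)
      qed (simp add: r)
    qed
  qed simp
qed

text \<open>The bounds refer to a ball, because the derivatives of a smooth kernel need not be bounded.\<close>

lemma smooth_lipschitz:
  assumes K: "smooth_fun K" and B: "\<And>b z. b \<in> Basis \<Longrightarrow> norm z \<le> r \<Longrightarrow> \<bar>partial_deriv b K z\<bar> \<le> B b"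
    and zw: "norm z \<le> r" "norm w \<le> r"
  shows "\<bar>K z - K w\<bar> \<le> (\<Sum>b\<in>Basis. B b) * norm (z - w)"
proof -
  have "norm (K z - K w) \<le> (\<Sum>b\<in>Basis. B b) * norm (z - w)"
  proof (rule differentiable_bound[of "cball 0 r"])
    show "(K has_derivative (\<lambda>h. \<Sum>b\<in>Basis. (h \<bullet> b) * partial_deriv b K x)) (at x within cball 0 r)" for x
      using smooth_has_derivative[OF K] has_derivative_at_withinI by blast
    show "onorm (\<lambda>h. \<Sum>b\<in>Basis. (h \<bullet> b) * partial_deriv b K x) \<le> (\<Sum>b\<in>Basis. B b)" if "x \<in> cball 0 r" for x
    proof (rule onorm_le)
      fix h :: 'a
      have "norm (\<Sum>b\<in>Basis. (h \<bullet> b) * partial_deriv b K x) \<le> (\<Sum>b\<in>Basis. norm h * B b)"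
        using B that by (intro sum_norm_le) (auto simp: abs_mult intro!: mult_mono Basis_le_norm)
      then show "norm (\<Sum>b\<in>Basis. (h \<bullet> b) * partial_deriv b K x) \<le> (\<Sum>b\<in>Basis. B b) * norm h"
        by (simp add: sum_distrib_right mult.commute sum_distrib_left)
    qed
  qed (use zw in auto)
  then show ?thesis by simp
qed

text \<open>Dominated convergence for the difference quotients along a sequence of increments: for \<open>y\<close> in the
  support of \<open>v\<close> all arguments of \<open>K\<close> stay in one ball, where \<open>K\<close> is Lipschitz.\<close>

lemma conv_has_derivative:
  fixes K :: "'a::euclidean_space \<Rightarrow> real"
  assumes K: "smooth_fun K" and v: "compact_L1 v"
  shows "(conv K v has_derivative (\<lambda>h. \<Sum>b\<in>Basis. (h \<bullet> b) * conv (partial_deriv b K) v x)) (at x)"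
proof -
  obtain r where r: "\<And>y. norm y > r \<Longrightarrow> v y = 0" using v unfolding compact_L1_def by blast
  have vi: "integrable lborel v" using v by (simp add: compact_L1_def)
  have ci: "integrable lborel (\<lambda>y. K (x - y) * v y)" for x
    by (rule conv_integrable[OF smooth_continuous_on[OF K] v])
  have cb: "integrable lborel (\<lambda>y. partial_deriv b K (x - y) * v y)" if "b \<in> Basis" for b x
    by (rule conv_integrable[OF smooth_continuous_on[OF smooth_partial[OF K that]] v])
  have [measurable]: "K \<in> borel_measurable borel" "v \<in> borel_measurable borel"
    using K vi by (auto intro: smooth_borel)
  have [measurable]: "partial_deriv b K \<in> borel_measurable borel" if "b \<in> Basis" for b
    using smooth_borel smooth_partial[OF K that] by blast
  define D where "D h = (\<Sum>b\<in>Basis. (h \<bullet> b) * conv (partial_deriv b K) v x)" for h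
  define E where "E h y = K (x + h - y) - K (x - y) - (\<Sum>b\<in>Basis. (h \<bullet> b) * partial_deriv b K (x - y))" for h y
  have Em [measurable]: "E h \<in> borel_measurable borel" for h unfolding E_def by measurable
  have rem: "conv K v (x + h) - conv K v x - D h = (LBINT y. E h y * v y)" for h
  proof -
    have "D h = (LBINT y. (\<Sum>b\<in>Basis. (h \<bullet> b) * (partial_deriv b K (x - y) * v y)))"
      unfolding D_def conv_def by (subst Bochner_Integration.integral_sum) (auto intro!: cb integrable_mult_right)
    moreover have "integrable lborel (\<lambda>y. (\<Sum>b\<in>Basis. (h \<bullet> b) * (partial_deriv b K (x - y) * v y)))"
      by (intro Bochner_Integration.integrable_sum integrable_mult_right cb)
    ultimately have "conv K v (x + h) - conv K v x - D h =
        (LBINT y. K (x + h - y) * v y - K (x - y) * v y - (\<Sum>b\<in>Basis. (h \<bullet> b) * (partial_deriv b K (x - y) * v y)))"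
      unfolding conv_def by (simp add: ci)
    also have "\<dots> = (LBINT y. E h y * v y)"
      by (simp add: E_def algebra_simps sum_distrib_left)
    finally show ?thesis .
  qed
  have "((\<lambda>h. norm (conv K v (x + h) - conv K v x - D h) / norm h) \<longlongrightarrow> 0) (at 0)"
    unfolding tendsto_at_iff_sequentially
  proof (intro allI impI)
    fix X :: "nat \<Rightarrow> 'a"
    assume X: "\<forall>i. X i \<in> UNIV - {0}" "X \<longlonglongrightarrow> 0"
    then have Xnz: "X i \<noteq> 0" for i by auto
    have "Bseq X" using X(2) convergent_imp_Bseq convergentI by blast
    then obtain M where M: "M > 0" "\<And>i. norm (X i) \<le> M" unfolding Bseq_def by blast
    define \<rho> where "\<rho> = norm x + M + r"
    have "\<forall>b\<in>Basis. \<exists>B\<ge>0. \<forall>z. norm z \<le> \<rho> \<longrightarrow> \<bar>partial_deriv b K z\<bar> \<le> B"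
      using continuous_bounded_on_cball[OF smooth_continuous_on[OF smooth_partial[OF K]]] by metis
    then obtain B where B: "\<And>b. b \<in> Basis \<Longrightarrow> B b \<ge> 0"
      "\<And>b z. b \<in> Basis \<Longrightarrow> norm z \<le> \<rho> \<Longrightarrow> \<bar>partial_deriv b K z\<bar> \<le> B b" by metis
    define S where "S = (\<Sum>b\<in>Basis. B b)"
    have S0: "S \<ge> 0" unfolding S_def by (intro sum_nonneg B)
    have bound: "\<bar>E (X i) y * v y / norm (X i)\<bar> \<le> 2 * S * \<bar>v y\<bar>" for i y
    proof (cases "norm y > r")
      case False
      have n1: "norm (x + X i - y) \<le> \<rho>"
        using norm_triangle_ineq4[of "x + X i" y] norm_triangle_ineq[of x "X i"] M(2)[of i] False by (simp add: \<rho>_def)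
      have n2: "norm (x - y) \<le> \<rho>" using norm_triangle_ineq4[of x y] False M(1) by (simp add: \<rho>_def)
      have "\<bar>K (x + X i - y) - K (x - y)\<bar> \<le> S * norm (X i)"
        using smooth_lipschitz[OF K B(2) n1 n2] by (simp add: S_def)
      moreover have "\<bar>\<Sum>b\<in>Basis. (X i \<bullet> b) * partial_deriv b K (x - y)\<bar> \<le> (\<Sum>b\<in>Basis. norm (X i) * B b)"
        by (rule order_trans[OF sum_abs sum_mono]) (use B n2 in \<open>auto simp: abs_mult intro!: mult_mono Basis_le_norm\<close>)
      moreover have "(\<Sum>b\<in>Basis. norm (X i) * B b) = S * norm (X i)" by (simp add: S_def sum_distrib_right mult.commute)
      ultimately have "\<bar>E (X i) y\<bar> \<le> 2 * S * norm (X i)" unfolding E_def by linarith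
      then have "\<bar>E (X i) y\<bar> / norm (X i) \<le> 2 * S" using Xnz[of i] by (simp add: field_simps)
      then have "\<bar>E (X i) y\<bar> / norm (X i) * \<bar>v y\<bar> \<le> 2 * S * \<bar>v y\<bar>" by (rule mult_right_mono) simp
      then show ?thesis by (simp add: abs_mult)
    qed (simp add: r)
    have lim: "(\<lambda>i. E (X i) y * v y / norm (X i)) \<longlonglongrightarrow> 0" for y
    proof -
      have "((\<lambda>h. norm (K (x - y + h) - K (x - y) - (\<Sum>b\<in>Basis. (h \<bullet> b) * partial_deriv b K (x - y))) / norm h) \<longlongrightarrow> 0) (at 0)"
        using smooth_has_derivative[OF K, of "x - y"] unfolding has_derivative_at by blast
      then have "((\<lambda>h. norm (E h y) / norm h) \<longlongrightarrow> 0) (at 0)" by (simp add: E_def algebra_simps)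
      moreover have "filterlim X (at 0) sequentially" using X by (auto simp: filterlim_at)
      ultimately have "(\<lambda>i. norm (E (X i) y) / norm (X i)) \<longlonglongrightarrow> 0" by (rule filterlim_compose)
      then have "(\<lambda>i. norm (E (X i) y) / norm (X i) * \<bar>v y\<bar>) \<longlonglongrightarrow> 0 * \<bar>v y\<bar>" by (intro tendsto_mult tendsto_const)
      then have "(\<lambda>i. \<bar>E (X i) y * v y / norm (X i)\<bar>) \<longlonglongrightarrow> 0" by (simp add: abs_mult)
      then show ?thesis using tendsto_rabs_zero_iff by blast
    qed
    have "(\<lambda>i. LBINT y. E (X i) y * v y / norm (X i)) \<longlonglongrightarrow> (\<integral>y. 0 \<partial>(lborel :: 'a measure))"
      by (intro integral_dominated_convergence[where w="\<lambda>y. 2 * S * \<bar>v y\<bar>"] AE_I2)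
        (use bound lim vi in auto)
    then have "(\<lambda>i. \<bar>LBINT y. E (X i) y * v y / norm (X i)\<bar>) \<longlonglongrightarrow> 0"
      using tendsto_rabs_zero by fastforce
    then show "((\<lambda>h. norm (conv K v (x + h) - conv K v x - D h) / norm h) \<circ> X) \<longlonglongrightarrow> 0"
      by (simp add: o_def rem abs_mult)
  qed
  moreover have "bounded_linear D"
    unfolding D_def by (intro bounded_linear_sum bounded_linear_mult_const bounded_linear_inner_left)
  ultimately show ?thesis unfolding has_derivative_at D_def by blast
qed

lemma partial_conv:
  assumes "smooth_fun K" "compact_L1 v" "b \<in> Basis"
  shows "partial_deriv b (conv K v) = conv (partial_deriv b K) v"
proof (rule ext)
  fix x
  have "(\<Sum>c\<in>Basis. (b \<bullet> c) * conv (partial_deriv c K) v x)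
      = (\<Sum>c\<in>Basis. if b = c then conv (partial_deriv b K) v x else 0)"
    by (rule sum.cong) (auto simp: inner_Basis assms(3))
  then show "partial_deriv b (conv K v) x = conv (partial_deriv b K) v x"
    using partial_derivI[OF conv_has_derivative[OF assms(1,2)]] assms(3) by simp
qed

text \<open>All derivatives fall on the kernel; \<open>v\<close> enters only through integrals over its bounded support.\<close>

lemma smooth_conv:
  assumes K: "smooth_fun K" and v: "compact_L1 v"
  shows "smooth_fun (conv K v)"
proof -
  have d: "conv K v differentiable at x" if "smooth_fun K" for K x
    using conv_has_derivative[OF that v] unfolding differentiable_def by blast
  have "ck_fun n (conv K v)" if "smooth_fun K" for n K
    using that
  proof (induction n arbitrary: K)
    case 0
    then show ?case using d by simp
  next
    case (Suc n)
    then show ?case using d by (simp add: partial_conv[OF _ v] smooth_partial)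
  qed
  then show ?thesis using K by (simp add: smooth_fun_iff_ck)
qed

lemma conv_bound:
  assumes K: "continuous_on UNIV K" and v: "compact_L1 v"
    and B: "\<And>y. v y \<noteq> 0 \<Longrightarrow> \<bar>K (x - y)\<bar> \<le> B"
  shows "\<bar>conv K v x\<bar> \<le> B * (LBINT y. \<bar>v y\<bar>)"
proof -
  have vi: "integrable lborel v" using v by (simp add: compact_L1_def)
  have "\<bar>conv K v x\<bar> \<le> (LBINT y. \<bar>K (x - y) * v y\<bar>)"
    unfolding conv_def using integral_norm_bound[of lborel "\<lambda>y. K (x - y) * v y"] by simp
  also have "\<dots> \<le> (LBINT y. B * \<bar>v y\<bar>)"
  proof (rule integral_mono)
    show "integrable lborel (\<lambda>y. \<bar>K (x - y) * v y\<bar>)" using conv_integrable[OF K v] by auto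
    show "integrable lborel (\<lambda>y. B * \<bar>v y\<bar>)" using vi by auto
    show "\<bar>K (x - y) * v y\<bar> \<le> B * \<bar>v y\<bar>" for y
      using B[of y] by (cases "v y = 0") (auto simp: abs_mult mult_right_mono)
  qed
  finally show ?thesis by simp
qed

section \<open>Approximation of \<open>L\<^sup>p\<close> functions by convolution\<close>

definition in_Lp :: "nat \<Rightarrow> ('a::euclidean_space \<Rightarrow> real) \<Rightarrow> bool" where
  "in_Lp p f \<longleftrightarrow> f \<in> borel_measurable borel \<and> integrable lborel (\<lambda>x. \<bar>f x\<bar> ^ p)"

definition Lp_tendsto :: "nat \<Rightarrow> (nat \<Rightarrow> 'a::euclidean_space \<Rightarrow> real) \<Rightarrow> ('a \<Rightarrow> real) \<Rightarrow> bool" where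
  "Lp_tendsto p X f \<longleftrightarrow> (\<forall>n. in_Lp p (X n)) \<and> in_Lp p f \<and>
     (\<lambda>n. LBINT x. \<bar>X n x - f x\<bar> ^ p) \<longlonglongrightarrow> 0"

lemma in_Lp_integrable: "in_Lp p f \<Longrightarrow> integrable lborel (\<lambda>x. \<bar>f x\<bar> ^ p)"
  by (simp add: in_Lp_def)

lemma abs_add_power_le: "\<bar>a + b\<bar> ^ p \<le> 2 ^ p * (\<bar>a\<bar> ^ p + \<bar>b\<bar> ^ p)" for a b :: real
proof -
  have "\<bar>a + b\<bar> ^ p \<le> (2 * max \<bar>a\<bar> \<bar>b\<bar>) ^ p" by (intro power_mono) auto
  also have "\<dots> = 2 ^ p * (max \<bar>a\<bar> \<bar>b\<bar>) ^ p" by (simp add: power_mult_distrib)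
  also have "(max \<bar>a\<bar> \<bar>b\<bar>) ^ p \<le> \<bar>a\<bar> ^ p + \<bar>b\<bar> ^ p" by (simp add: max_def)
  finally show ?thesis by simp
qed

lemma in_Lp_add: "in_Lp p f \<Longrightarrow> in_Lp p g \<Longrightarrow> in_Lp p (\<lambda>x. f x + g x)"
proof -
  assume f: "in_Lp p f" and g: "in_Lp p g"
  have [measurable]: "f \<in> borel_measurable borel" "g \<in> borel_measurable borel" using f g by (auto simp: in_Lp_def)
  have "integrable lborel (\<lambda>x. 2 ^ p * (\<bar>f x\<bar> ^ p + \<bar>g x\<bar> ^ p))"
    using f g by (intro integrable_mult_right Bochner_Integration.integrable_add) (auto simp: in_Lp_def)
  then have "integrable lborel (\<lambda>x. \<bar>f x + g x\<bar> ^ p)"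
    by (rule Bochner_Integration.integrable_bound) (auto intro!: AE_I2 order_trans[OF abs_add_power_le])
  then show ?thesis by (simp add: in_Lp_def)
qed

lemma in_Lp_cmult: "in_Lp p f \<Longrightarrow> in_Lp p (\<lambda>x. c * f x)"
  by (auto simp: in_Lp_def abs_mult power_mult_distrib)

lemma in_Lp_diff: "in_Lp p f \<Longrightarrow> in_Lp p g \<Longrightarrow> in_Lp p (\<lambda>x. f x - g x)"
  using in_Lp_add[of p f "\<lambda>x. -1 * g x"] in_Lp_cmult[of p g "-1"] by simp

lemma in_Lp_sum: "p > 0 \<Longrightarrow> (\<And>i. i \<in> I \<Longrightarrow> in_Lp p (f i)) \<Longrightarrow> in_Lp p (\<lambda>x. \<Sum>i\<in>I. f i x)"
proof (induction I rule: infinite_finite_induct)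
  case (insert i I)
  then show ?case by (simp add: in_Lp_add)
qed (simp_all add: in_Lp_def power_0_left)

lemma in_Lp_mult_bounded:
  assumes f: "in_Lp p f" and h: "h \<in> borel_measurable borel" "\<And>x. \<bar>h x\<bar> \<le> B"
  shows "in_Lp p (\<lambda>x. h x * f x)"
proof -
  have [measurable]: "f \<in> borel_measurable borel" "h \<in> borel_measurable borel" using f h by (auto simp: in_Lp_def)
  have B: "B \<ge> 0" using h(2)[of 0] by simp
  have "integrable lborel (\<lambda>x. B ^ p * \<bar>f x\<bar> ^ p)" using f by (intro integrable_mult_right in_Lp_integrable)
  then have "integrable lborel (\<lambda>x. \<bar>h x * f x\<bar> ^ p)"
  proof (rule Bochner_Integration.integrable_bound)
    have "\<bar>h x * f x\<bar> ^ p \<le> B ^ p * \<bar>f x\<bar> ^ p" for x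
      using h(2)[of x] by (simp add: abs_mult power_mult_distrib power_mono mult_right_mono)
    then show "AE x in lborel. norm (\<bar>h x * f x\<bar> ^ p) \<le> norm (B ^ p * \<bar>f x\<bar> ^ p)"
      using B by (intro AE_I2) simp
  qed measurable
  then show ?thesis by (simp add: in_Lp_def)
qed

lemma Lp_dominated_convergence:
  assumes X: "\<And>n. X n \<in> borel_measurable borel" and p: "p > 0"
    and dom: "\<And>n x. \<bar>X n x\<bar> \<le> w x" and w: "in_Lp p w"
    and lim: "AE x in lborel. (\<lambda>n. X n x) \<longlonglongrightarrow> 0"
  shows "(\<lambda>n. LBINT x. \<bar>X n x\<bar> ^ p) \<longlonglongrightarrow> 0"
proof -
  have [measurable]: "X n \<in> borel_measurable borel" for n using X by blast
  have "(\<lambda>n. LBINT x. \<bar>X n x\<bar> ^ p) \<longlonglongrightarrow> (\<integral>x. 0 \<partial>(lborel::'a measure))"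
  proof (rule integral_dominated_convergence[where w="\<lambda>x. \<bar>w x\<bar> ^ p"])
    show "integrable lborel (\<lambda>x. \<bar>w x\<bar> ^ p)" by (rule in_Lp_integrable[OF w])
    show "AE x in lborel. (\<lambda>n. \<bar>X n x\<bar> ^ p) \<longlonglongrightarrow> 0"
      using lim
    proof eventually_elim
      case (elim x)
      have "(\<lambda>n. \<bar>X n x\<bar> ^ p) \<longlonglongrightarrow> \<bar>0\<bar> ^ p" by (intro tendsto_power tendsto_rabs elim)
      moreover have "\<bar>0::real\<bar> ^ p = 0" using p by simp
      ultimately show ?case by (simp only:)
    qed
    show "AE x in lborel. norm (\<bar>X n x\<bar> ^ p) \<le> \<bar>w x\<bar> ^ p" for n
    proof (rule AE_I2)
      fix x have "\<bar>X n x\<bar> \<le> \<bar>w x\<bar>" using dom[of n x] by linarith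
      then show "norm (\<bar>X n x\<bar> ^ p) \<le> \<bar>w x\<bar> ^ p" by (simp add: power_mono)
    qed
  qed measurable
  then show ?thesis by simp
qed

lemma in_Lp_indicator_cball: "p > 0 \<Longrightarrow> in_Lp p (\<lambda>x::'a::euclidean_space. B * indicator (cball 0 r) x)"
proof -
  assume p: "p > 0"
  have "integrable lborel (\<lambda>x::'a. \<bar>B\<bar> ^ p * indicator (cball 0 r) x)"
    by (intro integrable_mult_right integrable_real_indicator emeasure_bounded_finite) auto
  moreover have "\<bar>B * indicator (cball 0 r) x\<bar> ^ p = \<bar>B\<bar> ^ p * indicator (cball 0 r) x" for x :: 'a
    using p by (simp add: indicator_def)
  moreover have "(\<lambda>x::'a. B * indicator (cball 0 r) x) \<in> borel_measurable borel"
    by (intro borel_measurable_times borel_measurable_const borel_measurable_indicator borel_closed closed_cball)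
  ultimately show ?thesis by (simp add: in_Lp_def)
qed

lemma tendsto_zero_dominated:
  fixes X Y :: "nat \<Rightarrow> real"
  assumes "\<And>n. 0 \<le> X n" "\<And>n. X n \<le> Y n" "Y \<longlonglongrightarrow> 0"
  shows "X \<longlonglongrightarrow> 0"
  by (rule tendsto_sandwich[OF _ _ tendsto_const assms(3)]) (use assms in auto)

lemma in_Lp_bounded_support:
  assumes f: "f \<in> borel_measurable borel" and B: "\<And>x. \<bar>f x\<bar> \<le> B" and r: "\<And>x. norm x > r \<Longrightarrow> f x = 0"
    and p: "p > 0"
  shows "in_Lp p f"
  unfolding in_Lp_def
proof
  show "integrable lborel (\<lambda>x. \<bar>f x\<bar> ^ p)"
    by (rule integrable_bounded_support[of _ "B ^ p" r]) (use f B r p in \<open>auto intro!: power_mono\<close>)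
qed (rule f)

text \<open>Truncation reduces to bounded functions vanishing outside a ball; such a function is an
  almost everywhere limit of continuous functions, which may be truncated in the same way.\<close>

lemma Lp_dense_continuous:
  fixes h :: "'a::euclidean_space \<Rightarrow> real"
  assumes h: "in_Lp p h" and p: "p > 0" and e: "e > 0"
  obtains g B r where "continuous_on UNIV g" "\<And>x. \<bar>g x\<bar> \<le> B" "\<And>x. norm x > r \<Longrightarrow> g x = 0"
    "(LBINT x. \<bar>h x - g x\<bar> ^ p) < e"
proof -
  have [measurable]: "h \<in> borel_measurable borel" using h by (simp add: in_Lp_def)
  define clamp where "clamp k t = max (- k) (min k t)" for k t :: real
  define T where "T k x = indicator (cball 0 (real k)) x * clamp (real k) (h x)" for k x
  have [measurable]: "cball (0::'a) r \<in> sets borel" for r by (simp add: borel_closed)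
  have [measurable]: "T k \<in> borel_measurable borel" for k unfolding T_def clamp_def by measurable
  have "(\<lambda>k. LBINT x. \<bar>h x - T k x\<bar> ^ p) \<longlonglongrightarrow> 0"
  proof (rule Lp_dominated_convergence[OF _ p, where w="\<lambda>x. \<bar>h x\<bar>"])
    show "in_Lp p (\<lambda>x. \<bar>h x\<bar>)" using h by (simp add: in_Lp_def)
    show "\<bar>h x - T k x\<bar> \<le> \<bar>h x\<bar>" for k x
      by (auto simp: T_def clamp_def indicator_def max_def min_def)
    have "(\<lambda>k. h x - T k x) \<longlonglongrightarrow> 0" for x
    proof (rule tendsto_eventually)
      obtain k0 where k0: "norm x + \<bar>h x\<bar> \<le> real k0" using real_arch_simple by blast
      have "h x - T k x = 0" if "k \<ge> k0" for k
      proof -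
        have "norm x + \<bar>h x\<bar> \<le> real k" using k0 that by linarith
        then have "norm x \<le> real k" "\<bar>h x\<bar> \<le> real k" using norm_ge_zero[of x] by linarith+
        then show ?thesis by (auto simp: T_def clamp_def indicator_def max_def min_def)
      qed
      then show "\<forall>\<^sub>F k in sequentially. h x - T k x = 0" unfolding eventually_sequentially by blast
    qed
    then show "AE x in lborel. (\<lambda>k. h x - T k x) \<longlonglongrightarrow> 0" by simp
  qed measurable
  moreover have e2: "e / 2 ^ p / 2 > 0" using e by simp
  ultimately obtain k0 where k0: "\<And>k. k \<ge> k0 \<Longrightarrow> \<bar>LBINT x. \<bar>h x - T k x\<bar> ^ p\<bar> < e / 2 ^ p / 2"
    unfolding LIMSEQ_def dist_real_def by (metis diff_zero)
  \<comment> \<open>A positive radius, so that the cut-off at scale \<open>k\<close> is available.\<close>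
  define k where "k = Suc k0"
  have k: "(LBINT x. \<bar>h x - T k x\<bar> ^ p) < e / 2 ^ p / 2" "k > 0"
    using k0[of k] by (auto simp: k_def)
  have "T k measurable_on UNIV"
    by (rule lebesgue_measurable_imp_measurable_on) (auto intro!: measurable_completion)
  then obtain N g where N: "negligible N" and g: "\<And>n. continuous_on UNIV (g n)"
    and lim: "\<And>x. x \<notin> N \<Longrightarrow> (\<lambda>n. g n x) \<longlonglongrightarrow> T k x"
    unfolding measurable_on_def by auto
  define G where "G n x = cutoff_at (real k) x * clamp (real k) (g n x)" for n x
  have Gc: "continuous_on UNIV (G n)" for n
    unfolding G_def clamp_def using g
    by (intro continuous_intros smooth_continuous_on[OF smooth_cutoff_at]) auto
  have [measurable]: "G n \<in> borel_measurable borel" for n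
    using Gc by (rule borel_measurable_continuous_onI)
  have clamp_bd: "\<bar>clamp (real k) t\<bar> \<le> real k" for t by (auto simp: clamp_def)
  have Gb: "\<bar>G n x\<bar> \<le> real k" for n x
    using mult_mono[OF cutoff_at_le_1[of "real k" x] clamp_bd[of "g n x"]]
    by (simp add: G_def abs_mult cutoff_at_nonneg)
  have G0: "G n x = 0" if "norm x > 2 * real k" for n x
    using that k(2) by (simp add: G_def cutoff_at_0)
  have Tb: "\<bar>T k x\<bar> \<le> real k" for x using clamp_bd by (auto simp: T_def indicator_def)
  have T0: "T k x = 0" if "norm x > real k" for x using that by (simp add: T_def)
  have "(\<lambda>n. LBINT x. \<bar>T k x - G n x\<bar> ^ p) \<longlonglongrightarrow> 0"
  proof (rule Lp_dominated_convergence[OF _ p, where w="\<lambda>x. (2 * real k) * indicator (cball 0 (2 * real k)) x"])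
    show "in_Lp p (\<lambda>x::'a. (2 * real k) * indicator (cball 0 (2 * real k)) x)"
      by (rule in_Lp_indicator_cball[OF p])
    show "\<bar>T k x - G n x\<bar> \<le> (2 * real k) * indicator (cball 0 (2 * real k)) x" for n x
      using Tb[of x] Gb[of n x] T0[of x] G0[of x n] by (cases "norm x > 2 * real k") (auto simp: indicator_def)
    have "(\<lambda>n. T k x - G n x) \<longlonglongrightarrow> 0" if "x \<notin> N" for x
    proof -
      have "(\<lambda>n. G n x) \<longlonglongrightarrow> cutoff_at (real k) x * clamp (real k) (T k x)"
        unfolding G_def clamp_def by (intro tendsto_intros lim that)
      moreover have "cutoff_at (real k) x * clamp (real k) (T k x) = T k x"
      proof (cases "norm x > real k")
        case True then show ?thesis using T0[of x] by (simp add: clamp_def)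
      next
        case False
        then have "cutoff_at (real k) x = 1" using k(2) by (simp add: cutoff_at_1)
        then show ?thesis using Tb[of x] by (auto simp: clamp_def)
      qed
      ultimately have "(\<lambda>n. G n x) \<longlonglongrightarrow> T k x" by simp
      from tendsto_diff[OF tendsto_const this, of "T k x"] show ?thesis by simp
    qed
    moreover have "AE x in lborel. x \<notin> N"
    proof -
      have "AE x in lebesgue. x \<notin> N" using N by (simp add: negligible_iff_null_sets AE_not_in)
      then show ?thesis by (simp add: AE_completion_iff)
    qed
    ultimately show "AE x in lborel. (\<lambda>n. T k x - G n x) \<longlonglongrightarrow> 0" by (auto elim: AE_mp)
  qed measurable
  then obtain n where n: "\<bar>LBINT x. \<bar>T k x - G n x\<bar> ^ p\<bar> < e / 2 ^ p / 2"
    using e2 unfolding LIMSEQ_def dist_real_def by (metis diff_zero order_refl)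
  have Gp: "in_Lp p (G n)" using Gb G0 p by (intro in_Lp_bounded_support[of _ "real k" "2 * real k"]) auto
  have Tp: "in_Lp p (T k)" using Tb T0 p by (intro in_Lp_bounded_support[of _ "real k" "real k"]) auto
  have "(LBINT x. \<bar>h x - G n x\<bar> ^ p) \<le> (LBINT x. 2 ^ p * (\<bar>h x - T k x\<bar> ^ p + \<bar>T k x - G n x\<bar> ^ p))"
  proof (rule integral_mono)
    show "\<bar>h x - G n x\<bar> ^ p \<le> 2 ^ p * (\<bar>h x - T k x\<bar> ^ p + \<bar>T k x - G n x\<bar> ^ p)" for x
      using abs_add_power_le[of "h x - T k x" "T k x - G n x" p] by simp
  qed (auto intro!: in_Lp_integrable in_Lp_diff h Tp Gp)
  also have "\<dots> = 2 ^ p * ((LBINT x. \<bar>h x - T k x\<bar> ^ p) + (LBINT x. \<bar>T k x - G n x\<bar> ^ p))"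
    using in_Lp_integrable[OF in_Lp_diff[OF h Tp]] in_Lp_integrable[OF in_Lp_diff[OF Tp Gp]] by simp
  also have "\<dots> < 2 ^ p * (e / 2 ^ p / 2 + e / 2 ^ p / 2)"
    using k(1) n by (intro mult_strict_left_mono add_strict_mono) auto
  also have "\<dots> = e" by (simp add: field_simps)
  finally show ?thesis using that[OF Gc Gb G0] by blast
qed

lemma in_Lp_shift: "in_Lp p f \<Longrightarrow> in_Lp p (\<lambda>x. f (c + x))"
  unfolding in_Lp_def using integrable_shift[of "\<lambda>x. \<bar>f x\<bar> ^ p" c] by auto

text \<open>For a continuous function of bounded support this is dominated convergence; the general case follows
  by density, because translations preserve the norm.\<close>

lemma Lp_translation_continuous:
  fixes h :: "'a::euclidean_space \<Rightarrow> real"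
  assumes h: "in_Lp p h" and p: "p > 0" and z: "z \<longlonglongrightarrow> 0"
  shows "(\<lambda>n. LBINT x. \<bar>h (z n + x) - h x\<bar> ^ p) \<longlonglongrightarrow> 0"
proof (rule LIMSEQ_I)
  fix e :: real assume e: "e > 0"
  \<comment> \<open>Three error terms, each below \<open>d\<close>, are multiplied by \<open>4\<^sup>p\<close>.\<close>
  define d where "d = e / 4 ^ p / 4"
  have d: "d > 0" using e by (simp add: d_def)
  obtain g B r where g: "continuous_on UNIV g" "\<And>x. \<bar>g x\<bar> \<le> B" "\<And>x. norm x > r \<Longrightarrow> g x = 0"
    "(LBINT x. \<bar>h x - g x\<bar> ^ p) < d" using Lp_dense_continuous[OF h p d] by blast
  have [measurable]: "h \<in> borel_measurable borel" "g \<in> borel_measurable borel"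
    using h g(1) by (auto simp: in_Lp_def borel_measurable_continuous_onI)
  have gp: "in_Lp p g" using g(2,3) p by (intro in_Lp_bounded_support[of _ B r]) auto
  obtain M where M: "M > 0" "\<And>n. norm (z n) \<le> M"
    using convergent_imp_Bseq[OF convergentI[OF z]] unfolding Bseq_def by blast
  have B0: "B \<ge> 0" using g(2)[of 0] by simp
  have "(\<lambda>n. LBINT x. \<bar>g (z n + x) - g x\<bar> ^ p) \<longlonglongrightarrow> 0"
  proof (rule Lp_dominated_convergence[OF _ p, where w="\<lambda>x. (2 * B) * indicator (cball 0 (r + M)) x"])
    show "in_Lp p (\<lambda>x::'a. (2 * B) * indicator (cball 0 (r + M)) x)"
      by (rule in_Lp_indicator_cball[OF p])
    show "\<bar>g (z n + x) - g x\<bar> \<le> (2 * B) * indicator (cball 0 (r + M)) x" for n x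
    proof (cases "norm x > r + M")
      case True
      have "norm x \<le> norm (z n + x) + norm (z n)" using norm_triangle_ineq4[of "z n + x" "z n"] by simp
      then show ?thesis using True M(2)[of n] M(1) g(3)[of "z n + x"] g(3)[of x] B0 by simp
    next
      case False
      then show ?thesis using g(2)[of "z n + x"] g(2)[of x] by (simp add: indicator_def)
    qed
    have "(\<lambda>n. g (z n + x) - g x) \<longlonglongrightarrow> 0" for x
    proof -
      have "(\<lambda>n. z n + x) \<longlonglongrightarrow> 0 + x" by (intro tendsto_intros z)
      then have "(\<lambda>n. g (z n + x)) \<longlonglongrightarrow> g (0 + x)"
        by (rule continuous_on_tendsto_compose[OF g(1)]) auto
      from tendsto_diff[OF this tendsto_const, of "g x"] show ?thesis by simp
    qed
    then show "AE x in lborel. (\<lambda>n. g (z n + x) - g x) \<longlonglongrightarrow> 0" by simp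
  qed measurable
  then obtain n0 where n0: "\<And>n. n \<ge> n0 \<Longrightarrow> \<bar>LBINT x. \<bar>g (z n + x) - g x\<bar> ^ p\<bar> < d"
    using d unfolding LIMSEQ_def dist_real_def by (metis diff_zero)
  show "\<exists>n0. \<forall>n\<ge>n0. norm ((LBINT x. \<bar>h (z n + x) - h x\<bar> ^ p) - 0) < e"
  proof (intro exI allI impI)
    fix n assume n: "n \<ge> n0"
    define a where "a x = h x - g x" for x
    have ap: "in_Lp p a" unfolding a_def by (rule in_Lp_diff[OF h gp])
    have [measurable]: "a \<in> borel_measurable borel" using ap by (simp add: in_Lp_def)
    have int: "integrable lborel (\<lambda>x. \<bar>a (z n + x)\<bar> ^ p)" "integrable lborel (\<lambda>x. \<bar>a x\<bar> ^ p)"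
      "integrable lborel (\<lambda>x. \<bar>g (z n + x) - g x\<bar> ^ p)"
      by (intro in_Lp_integrable in_Lp_shift in_Lp_diff ap gp)+
    have "(LBINT x. \<bar>h (z n + x) - h x\<bar> ^ p) \<le>
        (LBINT x. 4 ^ p * (\<bar>a (z n + x)\<bar> ^ p + \<bar>a x\<bar> ^ p + \<bar>g (z n + x) - g x\<bar> ^ p))"
    proof (rule integral_mono)
      show "\<bar>h (z n + x) - h x\<bar> ^ p \<le> 4 ^ p * (\<bar>a (z n + x)\<bar> ^ p + \<bar>a x\<bar> ^ p + \<bar>g (z n + x) - g x\<bar> ^ p)" for x
      proof -
        have "\<bar>h (z n + x) - h x\<bar> ^ p = \<bar>(a (z n + x) + (- a x)) + (g (z n + x) - g x)\<bar> ^ p" by (simp add: a_def)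
        also have "\<dots> \<le> 2 ^ p * (\<bar>a (z n + x) + (- a x)\<bar> ^ p + \<bar>g (z n + x) - g x\<bar> ^ p)" by (rule abs_add_power_le)
        also have "\<bar>a (z n + x) + (- a x)\<bar> ^ p \<le> 2 ^ p * (\<bar>a (z n + x)\<bar> ^ p + \<bar>- a x\<bar> ^ p)" by (rule abs_add_power_le)
        also have "\<bar>g (z n + x) - g x\<bar> ^ p \<le> 2 ^ p * \<bar>g (z n + x) - g x\<bar> ^ p"
          using mult_right_mono[of 1 "2 ^ p" "\<bar>g (z n + x) - g x\<bar> ^ p"] by simp
        finally have "\<bar>h (z n + x) - h x\<bar> ^ p \<le> 2 ^ p * (2 ^ p * (\<bar>a (z n + x)\<bar> ^ p + \<bar>- a x\<bar> ^ p) + 2 ^ p * \<bar>g (z n + x) - g x\<bar> ^ p)"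
          by simp
        also have "\<dots> = (2 ^ p * 2 ^ p) * (\<bar>a (z n + x)\<bar> ^ p + \<bar>a x\<bar> ^ p + \<bar>g (z n + x) - g x\<bar> ^ p)" by (simp add: algebra_simps)
        also have "(2::real) ^ p * 2 ^ p = 4 ^ p" by (simp flip: power_mult_distrib)
        finally show ?thesis .
      qed
    qed (auto intro!: int in_Lp_integrable in_Lp_diff in_Lp_shift h)
    also have "\<dots> = 4 ^ p * ((LBINT x. \<bar>a (z n + x)\<bar> ^ p) + (LBINT x. \<bar>a x\<bar> ^ p) + (LBINT x. \<bar>g (z n + x) - g x\<bar> ^ p))"
      using int by simp
    also have "(LBINT x. \<bar>a (z n + x)\<bar> ^ p) = (LBINT x. \<bar>a x\<bar> ^ p)"
      by (rule integral_shift[where f="\<lambda>x. \<bar>a x\<bar> ^ p"]) measurable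
    also have "4 ^ p * ((LBINT x. \<bar>a x\<bar> ^ p) + (LBINT x. \<bar>a x\<bar> ^ p) + (LBINT x. \<bar>g (z n + x) - g x\<bar> ^ p))
        < 4 ^ p * (d + d + d)"
      using g(4) n0[OF n] by (intro mult_strict_left_mono add_strict_mono) (auto simp: a_def)
    also have "\<dots> \<le> e" using e by (simp add: d_def field_simps)
    finally have "(LBINT x. \<bar>h (z n + x) - h x\<bar> ^ p) < e" .
    moreover have "0 \<le> (LBINT x. \<bar>h (z n + x) - h x\<bar> ^ p)" by (rule integral_nonneg_AE) simp
    ultimately show "norm ((LBINT x. \<bar>h (z n + x) - h x\<bar> ^ p) - 0) < e" by simp
  qed
qed

subsection \<open>Jensen's inequality for powers\<close>

text \<open>The graph of a power lies above its tangent at \<open>m\<close>.\<close>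

lemma power_tangent_le:
  fixes a m :: real
  assumes "a \<ge> 0" "m \<ge> 0"
  shows "m ^ Suc n + real (Suc n) * m ^ n * (a - m) \<le> a ^ Suc n"
proof (induction n)
  case (Suc n)
  have "0 \<le> a * (a ^ Suc n - m ^ Suc n - real (Suc n) * m ^ n * (a - m)) + real (Suc n) * m ^ n * (a - m)^2"
    using Suc assms by (intro add_nonneg_nonneg mult_nonneg_nonneg) auto
  also have "\<dots> = a ^ Suc (Suc n) - (m ^ Suc (Suc n) + real (Suc (Suc n)) * m ^ Suc n * (a - m))"
    by (simp add: algebra_simps power2_eq_square)
  finally show ?case by simp
qed simp

text \<open>The tangent line to the power function at the mean of \<open>|w|\<close> is integrated against \<open>\<rho>\<close>.\<close>

lemma jensen_power:
  fixes \<rho> w :: "'a::euclidean_space \<Rightarrow> real"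
  assumes \<rho>: "\<And>z. \<rho> z \<ge> 0" "integrable lborel \<rho>" "(LBINT z. \<rho> z) = 1"
    and w: "w \<in> borel_measurable borel" "integrable lborel (\<lambda>z. \<rho> z * w z)"
    and p: "p > 0"
  shows "ennreal (\<bar>LBINT z. \<rho> z * w z\<bar> ^ p) \<le> (\<integral>\<^sup>+z. ennreal (\<rho> z * \<bar>w z\<bar> ^ p) \<partial>lborel)"
proof (cases "(\<integral>\<^sup>+z. ennreal (\<rho> z * \<bar>w z\<bar> ^ p) \<partial>lborel) = \<infinity>")
  case False
  have [measurable]: "\<rho> \<in> borel_measurable borel" "w \<in> borel_measurable borel" using \<rho> w by auto
  have int: "integrable lborel (\<lambda>z. \<rho> z * \<bar>w z\<bar> ^ p)"
    using False \<rho>(1) by (intro integrableI_nonneg) (auto simp: top.not_eq_extremum)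
  have intw: "integrable lborel (\<lambda>z. \<rho> z * \<bar>w z\<bar>)"
    using integrable_abs[OF w(2)] \<rho>(1) by (simp add: abs_mult)
  define m where "m = (LBINT z. \<rho> z * \<bar>w z\<bar>)"
  have m: "m \<ge> 0" unfolding m_def using \<rho>(1) by (intro integral_nonneg_AE) auto
  obtain n where n: "p = Suc n" using p gr0_implies_Suc by blast
  have "\<bar>LBINT z. \<rho> z * w z\<bar> \<le> m"
    unfolding m_def using integral_norm_bound[of lborel "\<lambda>z. \<rho> z * w z"] \<rho>(1) by (simp add: abs_mult)
  then have "\<bar>LBINT z. \<rho> z * w z\<bar> ^ p \<le> m ^ p" by (simp add: power_mono)
  also have "m ^ p = (LBINT z. (m ^ p - real p * m ^ n * m) * \<rho> z + real p * m ^ n * (\<rho> z * \<bar>w z\<bar>))"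
    using \<rho>(2,3) intw by (simp add: m_def[symmetric])
  also have "\<dots> \<le> (LBINT z. \<rho> z * \<bar>w z\<bar> ^ p)"
  proof (rule integral_mono)
    show "(m ^ p - real p * m ^ n * m) * \<rho> z + real p * m ^ n * (\<rho> z * \<bar>w z\<bar>) \<le> \<rho> z * \<bar>w z\<bar> ^ p" for z
    proof -
      have "(m ^ p - real p * m ^ n * m) * \<rho> z + real p * m ^ n * (\<rho> z * \<bar>w z\<bar>)
          = \<rho> z * (m ^ Suc n + real (Suc n) * m ^ n * (\<bar>w z\<bar> - m))"
        by (simp add: n algebra_simps)
      also have "\<dots> \<le> \<rho> z * \<bar>w z\<bar> ^ Suc n"
        by (intro mult_left_mono power_tangent_le m \<rho>) auto
      finally show ?thesis by (simp add: n)
    qed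
  qed (use \<rho> intw int in auto)
  finally have "ennreal (\<bar>LBINT z. \<rho> z * w z\<bar> ^ p) \<le> ennreal (LBINT z. \<rho> z * \<bar>w z\<bar> ^ p)"
    by (rule ennreal_leI)
  also have "\<dots> = (\<integral>\<^sup>+z. ennreal (\<rho> z * \<bar>w z\<bar> ^ p) \<partial>lborel)"
    using int \<rho>(1) by (intro nn_integral_eq_integral[symmetric]) auto
  finally show ?thesis .
qed simp

subsection \<open>Approximate identities\<close>

lemma integral_scale_reflect:
  fixes F :: "'a::euclidean_space \<Rightarrow> real"
  assumes F: "F \<in> borel_measurable borel" and e: "e > 0"
  shows "(LBINT y. F y) = e ^ DIM('a) * (LBINT z. F (x - e *\<^sub>R z))"
    and "integrable lborel F \<Longrightarrow> integrable lborel (\<lambda>z. F (x - e *\<^sub>R z))"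
proof -
  note [measurable] = F
  have l: "lborel = density (distr lborel borel (\<lambda>z::'a. x - e *\<^sub>R z)) (\<lambda>_. ennreal (e ^ DIM('a)))"
    using lborel_affine[of "- e" x] e by simp
  show "(LBINT y. F y) = e ^ DIM('a) * (LBINT z. F (x - e *\<^sub>R z))"
    by (subst l, subst integral_density) (use e in \<open>auto simp: integral_distr\<close>)
  assume "integrable lborel F"
  then have "integrable (density (distr lborel borel (\<lambda>z::'a. x - e *\<^sub>R z)) (\<lambda>_. ennreal (e ^ DIM('a)))) F"
    using l by simp
  then have "integrable (distr lborel borel (\<lambda>z::'a. x - e *\<^sub>R z)) (\<lambda>z. e ^ DIM('a) * F z)"
    by (subst (asm) integrable_density) (use e in auto)
  then have "integrable (distr lborel borel (\<lambda>z::'a. x - e *\<^sub>R z)) F"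
    using e by simp
  then show "integrable lborel (\<lambda>z. F (x - e *\<^sub>R z))"
    by (subst (asm) integrable_distr_eq) auto
qed

text \<open>The density used below decays only polynomially, hence integrability in place of bounded support.\<close>

locale mollifier =
  fixes \<rho> :: "'a::euclidean_space \<Rightarrow> real"
  assumes rho_cont: "continuous_on UNIV \<rho>" and rho_nonneg: "\<And>z. \<rho> z \<ge> 0"
    and rho_integrable: "integrable lborel \<rho>" and rho_integral: "(LBINT z. \<rho> z) = 1"
begin

definition scaled :: "real \<Rightarrow> 'a \<Rightarrow> real" where
  "scaled e x = \<rho> (x /\<^sub>R e) / e ^ DIM('a)"

lemma rho_borel [measurable]: "\<rho> \<in> borel_measurable borel"
  using rho_cont by (rule borel_measurable_continuous_onI)

lemma scaled_cont: "continuous_on UNIV (scaled e)"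
  unfolding scaled_def divide_inverse
  by (intro continuous_intros continuous_on_compose2[OF rho_cont]) auto

lemma conv_scaled:
  assumes h: "compact_L1 h" and e: "e > 0"
  shows "conv (scaled e) h x = (LBINT z. \<rho> z * h (x - e *\<^sub>R z))"
    and "integrable lborel (\<lambda>z. \<rho> z * h (x - e *\<^sub>R z))"
proof -
  have hm [measurable]: "h \<in> borel_measurable borel" using h by (auto simp: compact_L1_def)
  have [measurable]: "scaled e \<in> borel_measurable borel"
    using scaled_cont by (rule borel_measurable_continuous_onI)
  have eq: "scaled e (x - (x - e *\<^sub>R z)) * h (x - e *\<^sub>R z) = \<rho> z * h (x - e *\<^sub>R z) / e ^ DIM('a)" for z
    using e by (simp add: scaled_def)
  have "conv (scaled e) h x = e ^ DIM('a) * (LBINT z. scaled e (x - (x - e *\<^sub>R z)) * h (x - e *\<^sub>R z))"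
    unfolding conv_def
    by (rule integral_scale_reflect(1)[of "\<lambda>y. scaled e (x - y) * h y", OF _ e]) measurable
  then show "conv (scaled e) h x = (LBINT z. \<rho> z * h (x - e *\<^sub>R z))"
    unfolding eq using e by simp
  have "integrable lborel (\<lambda>z. scaled e (x - (x - e *\<^sub>R z)) * h (x - e *\<^sub>R z))"
    by (rule integral_scale_reflect(2)[of "\<lambda>y. scaled e (x - y) * h y"])
      (auto intro!: conv_integrable scaled_cont h e)
  then have "integrable lborel (\<lambda>z. e ^ DIM('a) * (\<rho> z * h (x - e *\<^sub>R z) / e ^ DIM('a)))"
    unfolding eq by (rule integrable_mult_right)
  then show "integrable lborel (\<lambda>z. \<rho> z * h (x - e *\<^sub>R z))" using e by simp
qed

lemma conv_scaled_borel [measurable]: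
  assumes h: "compact_L1 h"
  shows "conv (scaled e) h \<in> borel_measurable borel"
proof -
  have [measurable]: "h \<in> borel_measurable borel" using h by (auto simp: compact_L1_def)
  have [measurable]: "scaled e \<in> borel_measurable borel"
    using scaled_cont by (rule borel_measurable_continuous_onI)
  have "(\<lambda>x. LBINT y. scaled e (x - y) * h y) \<in> borel_measurable borel"
    by (rule sigma_finite_measure.borel_measurable_lebesgue_integral[OF sigma_finite_lborel]) measurable
  then show ?thesis by (simp add: conv_def[abs_def])
qed

text \<open>Jensen for the average over \<open>z\<close>, then Tonelli and translation invariance.\<close>

lemma nn_integral_conv_power_le:
  assumes h: "compact_L1 h" and e: "e > 0" and p: "p > 0"
  shows "(\<integral>\<^sup>+x. ennreal (\<bar>conv (scaled e) h x\<bar> ^ p) \<partial>lborel) \<le> (\<integral>\<^sup>+x. ennreal (\<bar>h x\<bar> ^ p) \<partial>lborel)"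
proof -
  have [measurable]: "h \<in> borel_measurable borel" using h by (auto simp: compact_L1_def)
  have "(\<integral>\<^sup>+x. ennreal (\<bar>conv (scaled e) h x\<bar> ^ p) \<partial>lborel)
      \<le> (\<integral>\<^sup>+x. (\<integral>\<^sup>+z. ennreal (\<rho> z * \<bar>h (x - e *\<^sub>R z)\<bar> ^ p) \<partial>lborel) \<partial>lborel)"
    unfolding conv_scaled(1)[OF h e]
    by (intro nn_integral_mono jensen_power rho_nonneg rho_integrable rho_integral conv_scaled(2)[OF h e] p) measurable
  also have "\<dots> = (\<integral>\<^sup>+z. (\<integral>\<^sup>+x. ennreal (\<rho> z * \<bar>h (x - e *\<^sub>R z)\<bar> ^ p) \<partial>lborel) \<partial>lborel)"
    by (rule lborel_pair.Fubini') measurable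
  also have "\<dots> = (\<integral>\<^sup>+z. ennreal (\<rho> z) * (\<integral>\<^sup>+x. ennreal (\<bar>h x\<bar> ^ p) \<partial>lborel) \<partial>lborel)"
  proof (rule nn_integral_cong)
    fix z
    have "(\<integral>\<^sup>+x. ennreal (\<rho> z * \<bar>h (x - e *\<^sub>R z)\<bar> ^ p) \<partial>lborel)
        = (\<integral>\<^sup>+x. ennreal (\<rho> z) * ennreal (\<bar>h (- (e *\<^sub>R z) + x)\<bar> ^ p) \<partial>lborel)"
      by (simp add: ennreal_mult rho_nonneg)
    also have "\<dots> = ennreal (\<rho> z) * (\<integral>\<^sup>+x. ennreal (\<bar>h (- (e *\<^sub>R z) + x)\<bar> ^ p) \<partial>lborel)"
      by (rule nn_integral_cmult) measurable
    also have "(\<integral>\<^sup>+x. ennreal (\<bar>h (- (e *\<^sub>R z) + x)\<bar> ^ p) \<partial>lborel) = (\<integral>\<^sup>+x. ennreal (\<bar>h x\<bar> ^ p) \<partial>lborel)"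
      by (rule nn_integral_shift[where f="\<lambda>x. ennreal (\<bar>h x\<bar> ^ p)"]) measurable
    finally show "(\<integral>\<^sup>+x. ennreal (\<rho> z * \<bar>h (x - e *\<^sub>R z)\<bar> ^ p) \<partial>lborel) = ennreal (\<rho> z) * (\<integral>\<^sup>+x. ennreal (\<bar>h x\<bar> ^ p) \<partial>lborel)" .
  qed
  also have "\<dots> = (\<integral>\<^sup>+z. ennreal (\<rho> z) \<partial>lborel) * (\<integral>\<^sup>+x. ennreal (\<bar>h x\<bar> ^ p) \<partial>lborel)"
    by (rule nn_integral_multc) measurable
  also have "(\<integral>\<^sup>+z. ennreal (\<rho> z) \<partial>lborel) = 1"
    using nn_integral_eq_integral[OF rho_integrable] rho_nonneg rho_integral by simp
  finally show ?thesis by simp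
qed

lemma conv_in_Lp:
  assumes h: "compact_L1 h" and e: "e > 0" and p: "p > 0" and hp: "in_Lp p h"
  shows "in_Lp p (conv (scaled e) h)"
    and "(LBINT x. \<bar>conv (scaled e) h x\<bar> ^ p) \<le> (LBINT x. \<bar>h x\<bar> ^ p)"
proof -
  note [measurable] = conv_scaled_borel[OF h, of e]
  have le: "(\<integral>\<^sup>+x. ennreal (\<bar>conv (scaled e) h x\<bar> ^ p) \<partial>lborel) \<le> ennreal (LBINT x. \<bar>h x\<bar> ^ p)"
    using nn_integral_conv_power_le[OF h e p] nn_integral_eq_integral[OF in_Lp_integrable[OF hp]] by simp
  have int: "integrable lborel (\<lambda>x. \<bar>conv (scaled e) h x\<bar> ^ p)"
    using le by (intro integrableI_nonneg) (auto simp: le_less_trans)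
  then show "in_Lp p (conv (scaled e) h)" by (simp add: in_Lp_def)
  have "ennreal (LBINT x. \<bar>conv (scaled e) h x\<bar> ^ p) \<le> ennreal (LBINT x. \<bar>h x\<bar> ^ p)"
    using le nn_integral_eq_integral[OF int] by simp
  then show "(LBINT x. \<bar>conv (scaled e) h x\<bar> ^ p) \<le> (LBINT x. \<bar>h x\<bar> ^ p)"
    by (subst (asm) ennreal_le_iff) (auto intro!: integral_nonneg_AE)
qed

text \<open>By Jensen and Tonelli the error is at most the \<open>\<rho>\<close>-average over \<open>z\<close> of the translation errors
  for the shift by \<open>e z\<close>, which tend to zero boundedly.\<close>

theorem conv_Lp_tendsto:
  assumes h: "compact_L1 h" and hp: "in_Lp p h" and p: "p > 0"
  shows "Lp_tendsto p (\<lambda>n. conv (scaled (1 / real (Suc n))) h) h"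
proof -
  define e where "e n = 1 / real (Suc n)" for n
  have e: "e n > 0" for n by (simp add: e_def)
  have elim: "e \<longlonglongrightarrow> 0" using LIMSEQ_inverse_real_of_nat by (simp add: e_def[abs_def] inverse_eq_divide)
  have hm [measurable]: "h \<in> borel_measurable borel" using hp by (auto simp: in_Lp_def)
  note [measurable] = conv_scaled_borel[OF h]
  define W where "W z = (\<integral>\<^sup>+x. ennreal (\<bar>h (z + x) - h x\<bar> ^ p) \<partial>lborel)" for z
  have Wi: "W z = ennreal (LBINT x. \<bar>h (z + x) - h x\<bar> ^ p)" for z
    unfolding W_def by (intro nn_integral_eq_integral in_Lp_integrable in_Lp_diff in_Lp_shift hp) auto
  have [measurable]: "W \<in> borel_measurable borel"
    unfolding W_def[abs_def]
    by (rule sigma_finite_measure.borel_measurable_nn_integral[OF sigma_finite_lborel]) measurable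
  define I where "I = (LBINT x. \<bar>h x\<bar> ^ p)"
  have I0: "I \<ge> 0" unfolding I_def by (rule integral_nonneg_AE) simp
  have Wb: "W z \<le> ennreal (2 ^ p * (I + I))" for z
  proof -
    have "(LBINT x. \<bar>h (z + x) - h x\<bar> ^ p) \<le> (LBINT x. 2 ^ p * (\<bar>h (z + x)\<bar> ^ p + \<bar>h x\<bar> ^ p))"
    proof (rule integral_mono)
      show "\<bar>h (z + x) - h x\<bar> ^ p \<le> 2 ^ p * (\<bar>h (z + x)\<bar> ^ p + \<bar>h x\<bar> ^ p)" for x
        using abs_add_power_le[of "h (z + x)" "- h x" p] by simp
    qed (auto intro!: in_Lp_integrable in_Lp_diff in_Lp_shift hp)
    also have "\<dots> = 2 ^ p * ((LBINT x. \<bar>h (z + x)\<bar> ^ p) + I)"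
      using in_Lp_integrable[OF in_Lp_shift[OF hp]] in_Lp_integrable[OF hp] by (simp add: I_def)
    also have "(LBINT x. \<bar>h (z + x)\<bar> ^ p) = I"
      unfolding I_def by (rule integral_shift[where f="\<lambda>x. \<bar>h x\<bar> ^ p"]) measurable
    finally show ?thesis unfolding Wi by (rule ennreal_leI)
  qed
  define V where "V n z = ennreal (\<rho> z) * W (- (e n *\<^sub>R z))" for n z
  have Vm [measurable]: "V n \<in> borel_measurable borel" for n unfolding V_def by measurable
  have Vlim: "(\<lambda>n. V n z) \<longlonglongrightarrow> 0" for z
  proof -
    have "(\<lambda>n. - (e n *\<^sub>R z)) \<longlonglongrightarrow> - (0 *\<^sub>R z)" by (intro tendsto_intros elim)
    then have "(\<lambda>n. - (e n *\<^sub>R z)) \<longlonglongrightarrow> 0" by simp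
    from Lp_translation_continuous[OF hp p this]
    have "(\<lambda>n. W (- (e n *\<^sub>R z))) \<longlonglongrightarrow> ennreal 0" unfolding Wi by (rule tendsto_ennrealI)
    then have "(\<lambda>n. ennreal (\<rho> z) * W (- (e n *\<^sub>R z))) \<longlonglongrightarrow> ennreal (\<rho> z) * ennreal 0"
      by (intro ennreal_tendsto_cmult) auto
    then show ?thesis by (simp add: V_def)
  qed
  have VI: "(\<lambda>n. \<integral>\<^sup>+z. V n z \<partial>lborel) \<longlonglongrightarrow> (\<integral>\<^sup>+z. 0 \<partial>(lborel::'a measure))"
  proof (rule nn_integral_dominated_convergence[where w="\<lambda>z. ennreal (\<rho> z) * ennreal (2 ^ p * (I + I))"])
    show "AE z in lborel. V j z \<le> ennreal (\<rho> z) * ennreal (2 ^ p * (I + I))" for j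
      unfolding V_def by (intro AE_I2 mult_left_mono Wb) auto
    have "(\<integral>\<^sup>+z. ennreal (\<rho> z) * ennreal (2 ^ p * (I + I)) \<partial>lborel)
        = (\<integral>\<^sup>+z. ennreal (\<rho> z) \<partial>lborel) * ennreal (2 ^ p * (I + I))" by (rule nn_integral_multc) measurable
    also have "\<dots> < \<infinity>"
      using nn_integral_eq_integral[OF rho_integrable] rho_nonneg by (simp add: ennreal_mult_less_top)
    finally show "(\<integral>\<^sup>+z. ennreal (\<rho> z) * ennreal (2 ^ p * (I + I)) \<partial>lborel) < \<infinity>" .
  qed (use Vlim in auto)
  have cp: "in_Lp p (conv (scaled (e n)) h)" for n by (rule conv_in_Lp(1)[OF h e p hp])
  have bound: "ennreal (LBINT x. \<bar>conv (scaled (e n)) h x - h x\<bar> ^ p) \<le> (\<integral>\<^sup>+z. V n z \<partial>lborel)" for n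
  proof -
    have diff: "conv (scaled (e n)) h x - h x = (LBINT z. \<rho> z * (h (x - e n *\<^sub>R z) - h x))"
      and diffi: "integrable lborel (\<lambda>z. \<rho> z * (h (x - e n *\<^sub>R z) - h x))" for x
    proof -
      have i: "integrable lborel (\<lambda>z. \<rho> z * h (x - e n *\<^sub>R z))" "integrable lborel (\<lambda>z. \<rho> z * h x)"
        using conv_scaled(2)[OF h e] rho_integrable by auto
      show "integrable lborel (\<lambda>z. \<rho> z * (h (x - e n *\<^sub>R z) - h x))"
        using Bochner_Integration.integrable_diff[OF i] by (simp add: algebra_simps)
      show "conv (scaled (e n)) h x - h x = (LBINT z. \<rho> z * (h (x - e n *\<^sub>R z) - h x))"
        using Bochner_Integration.integral_diff[OF i] conv_scaled(1)[OF h e] rho_integral rho_integrable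
        by (simp add: algebra_simps)
    qed
    have "ennreal (LBINT x. \<bar>conv (scaled (e n)) h x - h x\<bar> ^ p) = (\<integral>\<^sup>+x. ennreal (\<bar>conv (scaled (e n)) h x - h x\<bar> ^ p) \<partial>lborel)"
      by (intro nn_integral_eq_integral[symmetric] in_Lp_integrable in_Lp_diff cp hp) auto
    also have "\<dots> \<le> (\<integral>\<^sup>+x. (\<integral>\<^sup>+z. ennreal (\<rho> z * \<bar>h (x - e n *\<^sub>R z) - h x\<bar> ^ p) \<partial>lborel) \<partial>lborel)"
      unfolding diff
      by (intro nn_integral_mono jensen_power rho_nonneg rho_integrable rho_integral diffi p) measurable
    also have "\<dots> = (\<integral>\<^sup>+z. (\<integral>\<^sup>+x. ennreal (\<rho> z * \<bar>h (x - e n *\<^sub>R z) - h x\<bar> ^ p) \<partial>lborel) \<partial>lborel)"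
      by (rule lborel_pair.Fubini') measurable
    also have "\<dots> = (\<integral>\<^sup>+z. V n z \<partial>lborel)"
    proof (rule nn_integral_cong)
      fix z
      have "(\<integral>\<^sup>+x. ennreal (\<rho> z * \<bar>h (x - e n *\<^sub>R z) - h x\<bar> ^ p) \<partial>lborel)
        = (\<integral>\<^sup>+x. ennreal (\<rho> z) * ennreal (\<bar>h (- (e n *\<^sub>R z) + x) - h x\<bar> ^ p) \<partial>lborel)"
        by (simp add: ennreal_mult rho_nonneg)
      also have "\<dots> = V n z" unfolding V_def W_def by (rule nn_integral_cmult) measurable
      finally show "(\<integral>\<^sup>+x. ennreal (\<rho> z * \<bar>h (x - e n *\<^sub>R z) - h x\<bar> ^ p) \<partial>lborel) = V n z" .
    qed
    finally show ?thesis .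
  qed
  have "(\<lambda>n. ennreal (LBINT x. \<bar>conv (scaled (e n)) h x - h x\<bar> ^ p)) \<longlonglongrightarrow> ennreal 0"
    by (rule tendsto_sandwich[OF _ _ tendsto_const]) (use VI bound in \<open>auto intro!: always_eventually\<close>)
  then have "(\<lambda>n. LBINT x. \<bar>conv (scaled (e n)) h x - h x\<bar> ^ p) \<longlonglongrightarrow> 0"
    by (subst (asm) tendsto_ennreal_iff) (auto intro!: always_eventually integral_nonneg_AE)
  then show ?thesis using cp hp by (simp add: Lp_tendsto_def e_def)
qed

end

subsection \<open>Limits of bilinear integrals\<close>

lemma integrable_product_L2:
  assumes f: "in_Lp 2 f" and g: "in_Lp 2 g"
  shows "integrable lborel (\<lambda>x. f x * g x)"
proof -
  have [measurable]: "f \<in> borel_measurable borel" "g \<in> borel_measurable borel" using f g by (auto simp: in_Lp_def)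
  have "integrable lborel (\<lambda>x. \<bar>f x\<bar>^2 + \<bar>g x\<bar>^2)"
    by (intro Bochner_Integration.integrable_add in_Lp_integrable f g)
  then show ?thesis
  proof (rule Bochner_Integration.integrable_bound)
    have "\<bar>f x * g x\<bar> \<le> \<bar>f x\<bar>^2 + \<bar>g x\<bar>^2" for x
    proof -
      have "0 \<le> \<bar>f x\<bar> * \<bar>g x\<bar>" by simp
      then show ?thesis using sum_squares_bound[of "\<bar>f x\<bar>" "\<bar>g x\<bar>"] unfolding abs_mult by linarith
    qed
    then show "AE x in lborel. norm (f x * g x) \<le> norm (\<bar>f x\<bar>^2 + \<bar>g x\<bar>^2)" by (intro AE_I2) simp
  qed measurable
qed

text \<open>The quadratic polynomial \<open>A - 2 t B + t\<^sup>2 C\<close> in \<open>t\<close>, the integral of \<open>(|f| - t |g|)\<^sup>2\<close>, is nonnegative.\<close>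

lemma integral_abs_product_le:
  assumes f: "in_Lp 2 f" and g: "in_Lp 2 g"
  shows "(LBINT x. \<bar>f x * g x\<bar>) \<le> sqrt (LBINT x. (f x)^2) * sqrt (LBINT x. (g x)^2)"
proof -
  define A where "A = (LBINT x. (f x)^2)"
  define C where "C = (LBINT x. (g x)^2)"
  define B where "B = (LBINT x. \<bar>f x * g x\<bar>)"
  have i: "integrable lborel (\<lambda>x. (f x)^2)" "integrable lborel (\<lambda>x. (g x)^2)" "integrable lborel (\<lambda>x. \<bar>f x * g x\<bar>)"
    using in_Lp_integrable[OF f] in_Lp_integrable[OF g] integrable_product_L2[OF f g] by auto
  have "0 \<le> A - 2 * t * B + t^2 * C" for t
  proof -
    have "0 \<le> (LBINT x. (\<bar>f x\<bar> - t * \<bar>g x\<bar>)^2)" by (rule integral_nonneg_AE) simp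
    also have "\<dots> = (LBINT x. (f x)^2 - 2 * t * \<bar>f x * g x\<bar> + t^2 * (g x)^2)"
      by (simp add: power2_diff power_mult_distrib abs_mult algebra_simps)
    also have "\<dots> = A - 2 * t * B + t^2 * C" using i by (simp add: A_def B_def C_def)
    finally show ?thesis .
  qed
  moreover have nn: "A \<ge> 0" "C \<ge> 0" "B \<ge> 0" unfolding A_def B_def C_def by (rule integral_nonneg_AE, simp)+
  ultimately have "B^2 \<le> A * C"
  proof (cases "C = 0")
    case True
    have "B = 0"
    proof (rule ccontr)
      assume "B \<noteq> 0"
      then have "B > 0" using nn by simp
      have "0 \<le> A - 2 * ((A + 1) / (2 * B)) * B + ((A + 1) / (2 * B))^2 * C" by fact
      then show False using \<open>B > 0\<close> True by simp
    qed
    then show ?thesis using nn by simp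
  next
    case False
    then have "C > 0" using nn by simp
    have "0 \<le> A - 2 * (B / C) * B + (B / C)^2 * C" by fact
    then show ?thesis using \<open>C > 0\<close> by (simp add: power2_eq_square field_simps)
  qed
  then have "B \<le> sqrt (A * C)" using nn real_le_rsqrt by blast
  then show ?thesis by (simp add: A_def B_def C_def real_sqrt_mult)
qed

lemma abs_integral_product_le:
  assumes f: "in_Lp 2 f" and g: "in_Lp 2 g"
  shows "\<bar>LBINT x. f x * g x\<bar> \<le> sqrt (LBINT x. (f x)^2) * sqrt (LBINT x. (g x)^2)"
  using integral_norm_bound[of lborel "\<lambda>x. f x * g x"] integral_abs_product_le[OF f g]
  unfolding real_norm_def by linarith

lemma Lp_tendstoD:
  assumes "Lp_tendsto p X f"
  shows "in_Lp p (X n)" "in_Lp p f" "(\<lambda>n. LBINT x. \<bar>X n x - f x\<bar> ^ p) \<longlonglongrightarrow> 0"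
  using assms by (auto simp: Lp_tendsto_def)

lemma Lp_tendsto_const: "in_Lp p f \<Longrightarrow> p > 0 \<Longrightarrow> Lp_tendsto p (\<lambda>_. f) f"
  by (simp add: Lp_tendsto_def power_0_left)

lemma in_Lp_product_L4:
  assumes h: "in_Lp 4 h" and f: "in_Lp 4 f"
  shows "in_Lp 2 (\<lambda>x. h x * f x)"
    and "(LBINT x. (h x * f x)^2) \<le> sqrt (LBINT x. (h x)^4) * sqrt (LBINT x. (f x)^4)"
proof -
  have sq: "in_Lp 2 (\<lambda>x. (g x)^2)" if "in_Lp 4 g" for g :: "'a \<Rightarrow> real"
    using that by (auto simp: in_Lp_def power_abs simp flip: power_mult)
  have [measurable]: "h \<in> borel_measurable borel" "f \<in> borel_measurable borel" using h f by (auto simp: in_Lp_def)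
  have "integrable lborel (\<lambda>x. (h x)^2 * (f x)^2)" by (rule integrable_product_L2[OF sq[OF h] sq[OF f]])
  moreover have "\<bar>h x * f x\<bar>^2 = (h x)^2 * (f x)^2" for x by (simp add: power_mult_distrib)
  ultimately show "in_Lp 2 (\<lambda>x. h x * f x)" by (simp add: in_Lp_def)
  show "(LBINT x. (h x * f x)^2) \<le> sqrt (LBINT x. (h x)^4) * sqrt (LBINT x. (f x)^4)"
    using integral_abs_product_le[OF sq[OF h] sq[OF f]] by (simp add: power_mult_distrib flip: power_mult)
qed

lemma Lp_tendsto_mult_L4:
  assumes X: "Lp_tendsto 4 X f" and h: "in_Lp 4 h"
  shows "Lp_tendsto 2 (\<lambda>n x. h x * X n x) (\<lambda>x. h x * f x)"
proof -
  have d: "in_Lp 4 (\<lambda>x. X n x - f x)" for n by (intro in_Lp_diff Lp_tendstoD[OF X])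
  have le: "(LBINT x. \<bar>h x * X n x - h x * f x\<bar> ^ 2)
      \<le> sqrt (LBINT x. (h x)^4) * sqrt (LBINT x. \<bar>X n x - f x\<bar> ^ 4)" for n
    using in_Lp_product_L4(2)[OF h d, of n] by (simp add: right_diff_distrib)
  have "(\<lambda>n. sqrt (LBINT x. (h x)^4) * sqrt (LBINT x. \<bar>X n x - f x\<bar> ^ 4)) \<longlonglongrightarrow> sqrt (LBINT x. (h x)^4) * sqrt 0"
    by (intro tendsto_mult tendsto_const tendsto_real_sqrt Lp_tendstoD(3)[OF X])
  then have "(\<lambda>n. LBINT x. \<bar>h x * X n x - h x * f x\<bar> ^ 2) \<longlonglongrightarrow> 0"
    by (intro tendsto_zero_dominated[OF _ le]) (auto intro!: integral_nonneg_AE)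
  then show ?thesis unfolding Lp_tendsto_def
    using in_Lp_product_L4(1)[OF h Lp_tendstoD(1)[OF X]] in_Lp_product_L4(1)[OF h Lp_tendstoD(2)[OF X]] by simp
qed

lemma L2_tendsto_inner:
  assumes X: "Lp_tendsto 2 X f" and Y: "Lp_tendsto 2 Y g"
  shows "(\<lambda>n. LBINT x. X n x * Y n x) \<longlonglongrightarrow> (LBINT x. f x * g x)"
proof -
  define a where "a n = sqrt (LBINT x. (X n x - f x)^2)" for n
  define b where "b n = sqrt (LBINT x. (Y n x - g x)^2)" for n
  have a0: "a \<longlonglongrightarrow> 0" and b0: "b \<longlonglongrightarrow> 0"
    using tendsto_real_sqrt[OF Lp_tendstoD(3)[OF X]] tendsto_real_sqrt[OF Lp_tendstoD(3)[OF Y]]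
    by (simp_all add: a_def[abs_def] b_def[abs_def])
  have dX: "in_Lp 2 (\<lambda>x. X n x - f x)" and dY: "in_Lp 2 (\<lambda>x. Y n x - g x)" for n
    by (intro in_Lp_diff Lp_tendstoD[OF X] Lp_tendstoD[OF Y])+
  define F where "F = sqrt (LBINT x. (f x)^2)"
  define H where "H = sqrt (LBINT x. (g x)^2)"
  have bound: "\<bar>(LBINT x. X n x * Y n x) - (LBINT x. f x * g x)\<bar> \<le> a n * b n + (a n * H + F * b n)" for n
  proof -
    have i: "integrable lborel (\<lambda>x. (X n x - f x) * (Y n x - g x))" "integrable lborel (\<lambda>x. (X n x - f x) * g x)"
      "integrable lborel (\<lambda>x. f x * (Y n x - g x))" "integrable lborel (\<lambda>x. f x * g x)"
      by (intro integrable_product_L2 dX dY Lp_tendstoD[OF X] Lp_tendstoD[OF Y])+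
    have "(LBINT x. X n x * Y n x) = (LBINT x. (X n x - f x) * (Y n x - g x) + ((X n x - f x) * g x + (f x * (Y n x - g x) + f x * g x)))"
      by (intro Bochner_Integration.integral_cong) (auto simp: algebra_simps)
    also have "\<dots> = (LBINT x. (X n x - f x) * (Y n x - g x)) + ((LBINT x. (X n x - f x) * g x) + ((LBINT x. f x * (Y n x - g x)) + (LBINT x. f x * g x)))"
      using i by simp
    finally show ?thesis
      using abs_integral_product_le[OF dX dY, of n n] abs_integral_product_le[OF dX Lp_tendstoD(2)[OF Y], of n]
        abs_integral_product_le[OF Lp_tendstoD(2)[OF X] dY, of n]
      unfolding a_def b_def F_def H_def by linarith
  qed
  have "(\<lambda>n. a n * b n + (a n * H + F * b n)) \<longlonglongrightarrow> 0 * 0 + (0 * H + F * 0)"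
    by (intro tendsto_add tendsto_mult tendsto_const a0 b0)
  then have lim: "(\<lambda>n. a n * b n + (a n * H + F * b n)) \<longlonglongrightarrow> 0" by simp
  have "(\<lambda>n. (LBINT x. X n x * Y n x) - (LBINT x. f x * g x)) \<longlonglongrightarrow> 0"
    by (rule Lim_null_comparison[OF always_eventually lim]) (use bound in simp)
  then show ?thesis by (rule LIM_zero_cancel)
qed

section \<open>The regularised Newtonian kernel\<close>

abbreviation pd :: "'n::finite \<Rightarrow> (real ^ 'n \<Rightarrow> real) \<Rightarrow> real ^ 'n \<Rightarrow> real" where
  "pd j \<equiv> partial_deriv (axis j 1)"

lemma axis_Basis: "axis j (1::real) \<in> Basis"
  by (simp add: axis_in_Basis_iff)

lemmas smooth_pd = smooth_partial[OF _ axis_Basis]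
  and test_pd = test_function_partial[OF _ axis_Basis]
  and pd_commute = partial_commute[OF _ axis_Basis axis_Basis]
  and pd_conv = partial_conv[OF _ _ axis_Basis]
  and integral_pd_test = integral_partial_test_function[OF _ axis_Basis]

lemma test_mult_smooth: "smooth_fun f \<Longrightarrow> \<phi> \<in> test_functions \<Longrightarrow> (\<lambda>x. f x * \<phi> x) \<in> test_functions"
  using test_function_mult[of \<phi> f] by (simp add: mult.commute)

lemma integrable_test_mult:
  assumes "smooth_fun f" "\<phi> \<in> test_functions"
  shows "integrable lborel (\<lambda>x. f x * \<phi> x)"
  by (rule test_function_integrable[OF test_mult_smooth[OF assms]])

lemma integral_by_parts:
  assumes f: "smooth_fun f" and \<phi>: "\<phi> \<in> test_functions"
  shows "(LBINT x. f x * pd j \<phi> x) = - (LBINT x. pd j f x * \<phi> x)"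
proof -
  have "0 = (LBINT x. pd j (\<lambda>x. f x * \<phi> x) x)"
    by (rule integral_pd_test[OF test_mult_smooth[OF f \<phi>], symmetric])
  also have "\<dots> = (LBINT x. f x * pd j \<phi> x + pd j f x * \<phi> x)"
    by (simp add: partial_mult f \<phi> test_function_smooth)
  also have "\<dots> = (LBINT x. f x * pd j \<phi> x) + (LBINT x. pd j f x * \<phi> x)"
    by (intro Bochner_Integration.integral_add integrable_test_mult f smooth_pd \<phi> test_pd)
  finally show ?thesis by linarith
qed

text \<open>The \<open>n\<close>-th derivative of \<open>t \<mapsto> (d\<^sup>2 + t)\<^bsup>-1/2\<^esup>\<close>.\<close>

definition profile :: "real \<Rightarrow> nat \<Rightarrow> real \<Rightarrow> real" where
  "profile d n t = (\<Prod>k<n. - 1/2 - real k) * (d^2 + t) powr (- 1/2 - real n)"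

lemma profile_derivative:
  assumes "d > 0" "t \<ge> 0"
  shows "(profile d n has_real_derivative profile d (Suc n) t) (at t)"
proof -
  have "d^2 + t > 0" using assms by (simp add: add_pos_nonneg)
  then have "((\<lambda>t. (\<Prod>k<n. - 1/2 - real k) * (d^2 + t) powr (- 1/2 - real n)) has_real_derivative
      (\<Prod>k<n. - 1/2 - real k) * ((- 1/2 - real n) * (d^2 + t) powr (- 1/2 - real n - 1))) (at t)"
    by (auto intro!: derivative_eq_intros)
  moreover have "(\<Prod>k<n. - 1/2 - real k) * ((- 1/2 - real n) * (d^2 + t) powr (- 1/2 - real n - 1)) = profile d (Suc n) t"
    by (simp add: profile_def algebra_simps)
  ultimately show ?thesis unfolding profile_def[of d n, abs_def] by (simp only:)
qed

definition riesz :: "real \<Rightarrow> real ^ 3 \<Rightarrow> real" where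
  "riesz d x = (d^2 + x \<bullet> x) powr (- 1/2)"

lemma riesz_profile: "riesz d = (\<lambda>x. profile d 0 (x \<bullet> x))"
  by (simp add: riesz_def[abs_def] profile_def)

lemma smooth_riesz: "d > 0 \<Longrightarrow> smooth_fun (riesz d)"
  unfolding riesz_profile by (rule smooth_radial) (rule profile_derivative)

lemma pd_radial_profile:
  assumes "d > 0"
  shows "pd j (\<lambda>x::real^3. profile d n (x \<bullet> x)) = (\<lambda>x. (2 * (x $ j)) * profile d (Suc n) (x \<bullet> x))"
  by (subst partial_radial[where g="profile d n" and g'="profile d (Suc n)"])
    (auto intro!: profile_derivative assms simp: inner_axis)

lemma smooth_component: "smooth_fun (\<lambda>x::real^'n. x $ j)"
  using smooth_inner[of "axis j (1::real) :: real^'n"] by (simp add: inner_axis)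

lemma pd_component: "pd i (\<lambda>x::real^'n. x $ j) = (\<lambda>x. if i = j then 1 else 0)"
  using partial_inner[of "axis i 1" "axis j (1::real) :: real^'n"]
  by (simp add: inner_axis) (simp add: axis_def)

lemma pd_riesz:
  assumes d: "d > 0"
  shows "pd j (riesz d) = (\<lambda>x. - (x $ j) * (d^2 + x \<bullet> x) powr (- 3/2))"
  unfolding riesz_profile pd_radial_profile[OF d] by (simp add: profile_def)

lemma pd2_riesz:
  assumes d: "d > 0"
  shows "pd i (pd j (riesz d)) = (\<lambda>x. 3 * x $ i * x $ j * (d^2 + x \<bullet> x) powr (- 5/2)
     - (if i = j then (d^2 + x \<bullet> x) powr (- 3/2) else 0))"
proof -
  have s: "smooth_fun (\<lambda>x::real^3. profile d n (x \<bullet> x))" for n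
    by (rule smooth_radial) (rule profile_derivative[OF d])
  have "pd i (pd j (riesz d)) = pd i (\<lambda>x. 2 * (x $ j * profile d 1 (x \<bullet> x)))"
    unfolding riesz_profile pd_radial_profile[OF d] by (simp add: mult.assoc)
  also have "\<dots> = (\<lambda>x. 2 * (x $ j * (2 * x $ i * profile d 2 (x \<bullet> x)) + (if i = j then 1 else 0) * profile d 1 (x \<bullet> x)))"
    by (subst partial_cmult[OF smooth_mult[OF smooth_component s]], subst partial_mult[OF smooth_component s])
      (simp add: pd_radial_profile[OF d] pd_component numeral_2_eq_2)
  also have "\<dots> = (\<lambda>x. 3 * x $ i * x $ j * (d^2 + x \<bullet> x) powr (- 5/2)
     - (if i = j then (d^2 + x \<bullet> x) powr (- 3/2) else 0))"
    by (auto simp: profile_def numeral_2_eq_2 fun_eq_iff algebra_simps)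
  finally show ?thesis .
qed

lemma inner_eq_sum_squares: "(x::real^'n) \<bullet> x = (\<Sum>i\<in>UNIV. (x $ i)^2)"
  by (simp add: inner_vec_def power2_eq_square)

text \<open>Minus the Laplacian of \<open>riesz d\<close> is nonnegative and concentrates at the origin as \<open>d\<close> tends to
  zero: this makes it both an approximate identity and the source of an explicit potential.\<close>

lemma laplacian_riesz:
  assumes d: "d > 0"
  shows "- (\<Sum>j\<in>UNIV. pd j (pd j (riesz d)) x) = 3 * d^2 * (d^2 + x \<bullet> x) powr (- 5/2)"
proof -
  have pos: "d^2 + x \<bullet> x > 0" using d by (simp add: add_pos_nonneg)
  have "(d^2 + x \<bullet> x) powr (- 3/2) = (d^2 + x \<bullet> x) powr (1 + - 5/2)" by simp
  also have "\<dots> = (d^2 + x \<bullet> x) * (d^2 + x \<bullet> x) powr (- 5/2)"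
    using pos by (subst powr_add) simp
  finally have p: "(d^2 + x \<bullet> x) powr (- 3/2) = (d^2 + x \<bullet> x) * (d^2 + x \<bullet> x) powr (- 5/2)" .
  have "(\<Sum>j\<in>UNIV. pd j (pd j (riesz d)) x) =
      (\<Sum>j\<in>UNIV. 3 * (d^2 + x \<bullet> x) powr (- 5/2) * (x $ j)^2 - (d^2 + x \<bullet> x) powr (- 3/2))"
    by (simp add: pd2_riesz[OF d] power2_eq_square algebra_simps)
  also have "\<dots> = 3 * (d^2 + x \<bullet> x) powr (- 5/2) * (x \<bullet> x) - 3 * (d^2 + x \<bullet> x) powr (- 3/2)"
    by (simp only: sum_subtractf sum_distrib_left[symmetric] inner_eq_sum_squares) simp
  finally show ?thesis unfolding p by (simp add: ring_distribs)
qed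

text \<open>Bounds that do not depend on the regularisation.\<close>

lemma powr_half_bounds:
  assumes "x \<noteq> (0::real^3)"
  shows "(d^2 + x \<bullet> x) powr (- 1/2) \<le> 1 / norm x"
    "(d^2 + x \<bullet> x) powr (- 3/2) \<le> 1 / norm x ^ 3"
    "(d^2 + x \<bullet> x) powr (- 5/2) \<le> 1 / norm x ^ 5"
proof -
  have n: "norm x > 0" using assms by simp
  have *: "(d^2 + x \<bullet> x) powr (- a) \<le> norm x powr (- 2 * a)" if "a \<ge> 0" for a
  proof -
    have "(d^2 + x \<bullet> x) powr (- a) \<le> (norm x ^ 2) powr (- a)"
      using n that by (intro powr_mono2') (auto simp: dot_square_norm)
    also have "norm x ^ 2 = norm x powr 2" using n by (simp add: powr_numeral)
    finally show ?thesis unfolding powr_powr by simp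
  qed
  show "(d^2 + x \<bullet> x) powr (- 1/2) \<le> 1 / norm x"
    using *[of "1/2"] n by (simp add: powr_minus_divide)
  show "(d^2 + x \<bullet> x) powr (- 3/2) \<le> 1 / norm x ^ 3"
    using *[of "3/2"] n by (simp add: powr_minus_divide powr_numeral)
  show "(d^2 + x \<bullet> x) powr (- 5/2) \<le> 1 / norm x ^ 5"
    using *[of "5/2"] n by (simp add: powr_minus_divide powr_numeral)
qed

lemma pd_riesz_bound:
  assumes d: "d > 0" and x: "x \<noteq> 0"
  shows "\<bar>pd j (riesz d) x\<bar> \<le> 1 / norm x ^ 2"
proof -
  have "\<bar>pd j (riesz d) x\<bar> \<le> norm x * (1 / norm x ^ 3)"
    unfolding pd_riesz[OF d] abs_mult abs_minus_cancel
    by (intro mult_mono component_le_norm_cart) (use powr_half_bounds(2)[OF x, of d] in auto)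
  also have "\<dots> = 1 / norm x ^ 2" using x by (simp add: power2_eq_square power3_eq_cube)
  finally show ?thesis .
qed

lemma pd2_riesz_bound:
  assumes d: "d > 0" and x: "x \<noteq> 0"
  shows "\<bar>pd i (pd j (riesz d)) x\<bar> \<le> 4 / norm x ^ 3"
proof -
  have n: "norm x > 0" using x by simp
  have "\<bar>3 * x $ i * x $ j * (d^2 + x \<bullet> x) powr (- 5/2)\<bar> = 3 * (\<bar>x $ i\<bar> * \<bar>x $ j\<bar> * (d^2 + x \<bullet> x) powr (- 5/2))"
    by (simp add: abs_mult)
  also have "\<dots> \<le> 3 * (norm x * norm x * (1 / norm x ^ 5))"
    by (intro mult_left_mono mult_mono component_le_norm_cart mult_nonneg_nonneg) (use powr_half_bounds(3)[OF x, of d] in auto)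
  also have "\<dots> = 3 / norm x ^ 3" using n by (simp add: field_simps eval_nat_numeral)
  finally have 1: "\<bar>3 * x $ i * x $ j * (d^2 + x \<bullet> x) powr (- 5/2)\<bar> \<le> 3 / norm x ^ 3" .
  have 2: "\<bar>if i = j then (d^2 + x \<bullet> x) powr (- 3/2) else 0\<bar> \<le> 1 / norm x ^ 3"
    using powr_half_bounds(2)[OF x, of d] n by simp
  have "\<bar>pd i (pd j (riesz d)) x\<bar> \<le> 3 / norm x ^ 3 + 1 / norm x ^ 3"
    unfolding pd2_riesz[OF d] using 1 2 by linarith
  then show ?thesis by (simp add: add_divide_distrib[symmetric])
qed

lemma integrable_real_exhaust:
  fixes f :: "'a::euclidean_space \<Rightarrow> real"
  assumes f: "f \<in> borel_measurable borel" "\<And>x. f x \<ge> 0"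
    and int: "\<And>n. integrable lborel (\<lambda>x. indicator (cball 0 (real n)) x * f x)"
    and B: "\<And>n. (LBINT x. indicator (cball 0 (real n)) x * f x) \<le> B"
  shows "integrable lborel f"
proof -
  note [measurable] = f(1)
  have [measurable]: "cball (0::'a) r \<in> sets borel" for r by (simp add: borel_closed)
  define F where "F n x = ennreal (indicator (cball 0 (real n)) x * f x)" for n x
  have inc: "incseq F"
    unfolding incseq_def le_fun_def F_def
    by (auto intro!: ennreal_leI mult_right_mono f simp: indicator_def)
  have sup: "(SUP n. F n x) = ennreal (f x)" for x
  proof (rule antisym)
    show "(SUP n. F n x) \<le> ennreal (f x)"
      by (rule SUP_least) (use f(2)[of x] in \<open>auto simp: F_def indicator_def\<close>)
    obtain n where "norm x \<le> real n" using real_arch_simple by blast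
    then have "ennreal (f x) = F n x" by (simp add: F_def)
    also have "\<dots> \<le> (SUP n. F n x)" by (rule SUP_upper) simp
    finally show "ennreal (f x) \<le> (SUP n. F n x)" .
  qed
  have "(\<integral>\<^sup>+x. ennreal (f x) \<partial>lborel) = (\<integral>\<^sup>+x. (SUP n. F n x) \<partial>lborel)" by (simp add: sup)
  also have "\<dots> = (SUP n. \<integral>\<^sup>+x. F n x \<partial>lborel)"
  proof (rule nn_integral_monotone_convergence_SUP[OF inc])
    show "F i \<in> borel_measurable lborel" for i unfolding F_def[abs_def] by measurable
  qed
  also have "\<dots> \<le> ennreal B"
  proof (rule SUP_least)
    fix n
    have "(\<integral>\<^sup>+x. F n x \<partial>lborel) = ennreal (LBINT x. indicator (cball 0 (real n)) x * f x)"
      unfolding F_def using f(2) by (intro nn_integral_eq_integral int) auto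
    also have "\<dots> \<le> ennreal B" by (rule ennreal_leI[OF B])
    finally show "(\<integral>\<^sup>+x. F n x \<partial>lborel) \<le> ennreal B" .
  qed
  finally show ?thesis using f by (intro integrableI_nonneg) (auto simp: le_less_trans)
qed

definition ball_vol :: real where "ball_vol = unit_ball_vol 3"

lemma measure_cball3: "r \<ge> 0 \<Longrightarrow> measure lborel (cball (0::real^3) r) = ball_vol * r ^ 3"
  using content_cball[of r "0::real^3"] by (simp add: ball_vol_def)

lemma ball_vol_pos: "ball_vol > 0" by (simp add: ball_vol_def)

lemma integral_indicator_cball_le:
  assumes f: "integrable lborel f" and r: "r \<ge> 0" and B: "\<And>x. norm x \<le> r \<Longrightarrow> f x \<le> B"
    and z: "\<And>x::real^3. norm x > r \<Longrightarrow> f x \<le> 0"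
  shows "(LBINT x. f x) \<le> B * (ball_vol * r ^ 3)"
proof -
  have i: "integrable lborel (\<lambda>x::real^3. B * indicator (cball 0 r) x)"
    by (intro integrable_mult_right integrable_real_indicator emeasure_bounded_finite) auto
  have "(LBINT x. f x) \<le> (LBINT x. B * indicator (cball (0::real^3) r) x)"
  proof -
    have "f x \<le> B * indicator (cball 0 r) x" for x
      using B[of x] z[of x] by (cases "norm x \<le> r") (auto simp: indicator_def)
    from integral_mono[OF f i this] show ?thesis .
  qed
  then show ?thesis by (simp add: measure_cball3 r)
qed

definition bump_density :: "real^3 \<Rightarrow> real" where
  "bump_density x = 3 * (1 + x \<bullet> x) powr (- 5/2)"

lemma bump_density_pos: "bump_density x > 0"
proof -
  have "1 + x \<bullet> x > 0" by (simp add: add_pos_nonneg)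
  then show ?thesis by (simp add: bump_density_def)
qed

lemma bump_density_laplacian: "bump_density x = - (\<Sum>j\<in>UNIV. pd j (pd j (riesz 1)) x)"
  by (simp add: laplacian_riesz bump_density_def)

lemma bump_density_cont: "continuous_on UNIV bump_density"
proof -
  have "1 + x \<bullet> x \<noteq> 0" for x :: "real^3"
    by (metis add_pos_nonneg inner_ge_zero less_numeral_extra(1) less_numeral_extra(3))
  then show ?thesis unfolding bump_density_def by (intro continuous_intros) auto
qed

text \<open>Integrating by parts twice moves the Laplacian onto a cut-off at scale \<open>R\<close>; the result is
  bounded by \<open>R\<^sup>-\<^sup>1 \<cdot> R\<^sup>-\<^sup>2 \<cdot> R\<^sup>3\<close>.\<close>

lemma bump_density_integrable: "integrable lborel bump_density"
proof -
  obtain C where C: "C \<ge> 1"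
    "\<And>b c R x. b \<in> Basis \<Longrightarrow> c \<in> Basis \<Longrightarrow> R > 0 \<Longrightarrow>
       \<bar>partial_deriv c (partial_deriv b (cutoff_at R)) (x::real^3)\<bar> \<le> C / R^2"
    using cutoff_derivatives_bounded by metis
  note [measurable] = borel_measurable_continuous_onI[OF bump_density_cont]
  have s: "smooth_fun (riesz 1)" by (rule smooth_riesz) simp
  have loc: "integrable lborel (\<lambda>x. indicator (cball 0 (real n)) x * bump_density x)" for n
  proof -
    obtain B where B: "B \<ge> 0" "\<And>x. norm x \<le> real n \<Longrightarrow> \<bar>bump_density x\<bar> \<le> B"
      using continuous_bounded_on_cball[OF bump_density_cont] by blast
    have [measurable]: "cball (0::real^3) r \<in> sets borel" for r by (simp add: borel_closed)
    show ?thesis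
      by (rule integrable_bounded_support[of _ B "real n"]) (use B in \<open>auto simp: indicator_def\<close>)
  qed
  have bound: "(LBINT x. indicator (cball 0 (real n)) x * bump_density x) \<le> 24 * C * ball_vol" for n
  proof -
    define R where "R = real n + 1"
    have R: "R > 0" "R \<ge> real n" by (auto simp: R_def)
    let ?\<eta> = "cutoff_at R :: real^3 \<Rightarrow> real"
    have t: "?\<eta> \<in> test_functions" by (rule cutoff_at_test[OF R(1)])
    have sd: "smooth_fun (\<lambda>x. pd j (pd j (riesz 1)) x)" for j by (intro smooth_pd s)
    have i1: "integrable lborel (\<lambda>x. pd j (pd j (riesz 1)) x * ?\<eta> x)" for j
      by (intro integrable_test_mult smooth_pd s t)
    have i2: "integrable lborel (\<lambda>x. riesz 1 x * pd j (pd j ?\<eta>) x)" for j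
      by (intro integrable_test_mult s test_pd t)
    have eq: "bump_density x * ?\<eta> x = - (\<Sum>j\<in>UNIV. pd j (pd j (riesz 1)) x * ?\<eta> x)" for x
      by (simp add: bump_density_laplacian sum_distrib_right)
    have bi: "integrable lborel (\<lambda>x. bump_density x * ?\<eta> x)"
      unfolding eq using i1 by auto
    have "(LBINT x. indicator (cball 0 (real n)) x * bump_density x) \<le> (LBINT x. bump_density x * ?\<eta> x)"
    proof (rule integral_mono[OF loc bi])
      show "indicator (cball 0 (real n)) x * bump_density x \<le> bump_density x * ?\<eta> x" for x
        using bump_density_pos[of x] cutoff_at_nonneg[of R x] cutoff_at_1[OF R(1), of x] R(2)
        by (auto simp: indicator_def less_imp_le)
    qed
    also have "\<dots> = - (\<Sum>j\<in>UNIV. LBINT x. pd j (pd j (riesz 1)) x * ?\<eta> x)"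
      unfolding eq using i1 by simp
    also have "\<dots> = (\<Sum>j\<in>UNIV. - (LBINT x. riesz 1 x * pd j (pd j ?\<eta>) x))"
      using integral_by_parts[OF smooth_pd[OF s] t] integral_by_parts[OF s test_pd[OF t]]
      by (simp add: sum_negf)
    also have "\<dots> \<le> (\<Sum>j\<in>(UNIV::3 set). (C / R^3) * (ball_vol * (2 * R) ^ 3))"
    proof (rule sum_mono)
      fix j :: 3
      have "- (LBINT x. riesz 1 x * pd j (pd j ?\<eta>) x) = (LBINT x. - (riesz 1 x * pd j (pd j ?\<eta>) x))" by simp
      also have "\<dots> \<le> (C / R^3) * (ball_vol * (2 * R) ^ 3)"
      proof (rule integral_indicator_cball_le)
        show "integrable lborel (\<lambda>x. - (riesz 1 x * pd j (pd j ?\<eta>) x))" using i2 by simp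
        show "- (riesz 1 x * pd j (pd j ?\<eta>) x) \<le> 0" if "norm x > 2 * R" for x
          using partial2_cutoff_at_outer[OF R(1) that] by simp
        show "- (riesz 1 x * pd j (pd j ?\<eta>) x) \<le> C / R^3" for x
        proof (cases "norm x < R")
          case True
          then show ?thesis using partial2_cutoff_at_inner[OF R(1) True] C(1) R(1) by simp
        next
          case False
          then have x: "x \<noteq> 0" using R by auto
          have r: "0 \<le> riesz 1 x" "riesz 1 x \<le> 1 / R"
          proof -
            have "riesz 1 x \<le> 1 / norm x" using powr_half_bounds(1)[OF x, of 1] by (simp add: riesz_def)
            also have "\<dots> \<le> 1 / R" using False R x by (intro divide_left_mono mult_pos_pos) auto
            finally show "riesz 1 x \<le> 1 / R" .
          qed (simp add: riesz_def)
          have "- (riesz 1 x * pd j (pd j ?\<eta>) x) \<le> \<bar>riesz 1 x\<bar> * \<bar>pd j (pd j ?\<eta>) x\<bar>"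
            by (metis abs_ge_minus_self abs_mult)
          also have "\<dots> \<le> (1 / R) * (C / R^2)"
            using r R by (intro mult_mono C(2) axis_Basis) auto
          finally show ?thesis using R by (simp add: power2_eq_square power3_eq_cube)
        qed
      qed (use R in auto)
      finally show "- (LBINT x. riesz 1 x * pd j (pd j ?\<eta>) x) \<le> (C / R^3) * (ball_vol * (2 * R) ^ 3)" .
    qed
    also have "\<dots> = 24 * C * ball_vol" using R(1) by (simp add: power_mult_distrib field_simps)
    finally show ?thesis .
  qed
  show ?thesis
    by (rule integrable_real_exhaust[OF _ _ loc bound]) (auto simp: less_imp_le bump_density_pos)
qed

definition kernel_mass :: real where "kernel_mass = (LBINT x. bump_density x)"

lemma kernel_mass_pos: "kernel_mass > 0"
proof -
  have "kernel_mass \<ge> 0" unfolding kernel_mass_def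
    by (rule integral_nonneg_AE) (simp add: less_imp_le bump_density_pos)
  moreover have "kernel_mass \<noteq> 0"
  proof
    assume "kernel_mass = 0"
    then have "AE x in lborel. bump_density x = 0"
      unfolding kernel_mass_def
      by (subst (asm) integral_nonneg_eq_0_iff_AE[OF bump_density_integrable]) (auto simp: less_imp_le bump_density_pos)
    then have "AE x in (lborel :: (real^3) measure). False"
      by (rule AE_mp) (use bump_density_pos in \<open>auto simp: less_imp_neq[symmetric] intro!: AE_I2\<close>)
    then have "emeasure (lborel :: (real^3) measure) UNIV = 0"
      using AE_iff_null_sets[of UNIV lborel] by (auto simp: AE_iff_measurable)
    then show False by simp
  qed
  ultimately show ?thesis by simp
qed

text \<open>Normalised so that minus the Laplacian has integral one.\<close>

definition newton :: "real \<Rightarrow> real^3 \<Rightarrow> real" where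
  "newton d x = (1 / kernel_mass) * riesz d x"

definition unit_density :: "real^3 \<Rightarrow> real" where
  "unit_density x = bump_density x / kernel_mass"

interpretation md: mollifier unit_density
proof
  show "continuous_on UNIV unit_density"
    unfolding unit_density_def divide_inverse by (intro continuous_intros bump_density_cont)
  show "unit_density z \<ge> 0" for z
    using bump_density_pos[of z] kernel_mass_pos by (simp add: unit_density_def)
  show "integrable lborel unit_density" unfolding unit_density_def[abs_def] using bump_density_integrable by simp
  show "(LBINT z. unit_density z) = 1"
    unfolding unit_density_def using kernel_mass_pos by (simp add: kernel_mass_def[symmetric])
qed

lemma smooth_newton: "d > 0 \<Longrightarrow> smooth_fun (newton d)"
  unfolding newton_def[abs_def] by (intro smooth_mult smooth_const smooth_riesz)

lemma pd_newton: "d > 0 \<Longrightarrow> pd j (newton d) = (\<lambda>x. (1 / kernel_mass) * pd j (riesz d) x)"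
  unfolding newton_def[abs_def] by (rule partial_cmult[OF smooth_riesz])

lemma pd2_newton: "d > 0 \<Longrightarrow> pd i (pd j (newton d)) = (\<lambda>x. (1 / kernel_mass) * pd i (pd j (riesz d)) x)"
  unfolding pd_newton by (rule partial_cmult[OF smooth_pd[OF smooth_riesz]])

lemma pd_newton_bound:
  assumes "d > 0" "x \<noteq> 0"
  shows "\<bar>pd j (newton d) x\<bar> \<le> (1 / kernel_mass) / norm x ^ 2"
  using mult_left_mono[OF pd_riesz_bound[OF assms, of j], of "1 / kernel_mass"] kernel_mass_pos
  by (simp add: pd_newton[OF assms(1)] abs_mult)

lemma pd2_newton_bound:
  assumes "d > 0" "x \<noteq> 0"
  shows "\<bar>pd i (pd j (newton d)) x\<bar> \<le> (4 / kernel_mass) / norm x ^ 3"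
  using mult_left_mono[OF pd2_riesz_bound[OF assms, of i j], of "1 / kernel_mass"] kernel_mass_pos
  by (simp add: pd2_newton[OF assms(1)] abs_mult)

text \<open>Both sides are \<open>3 d\<^sup>2 (d\<^sup>2 + |x|\<^sup>2)\<^bsup>-5/2\<^esup>\<close> divided by the mass: the regularised point mass is exactly
  the rescaling of one fixed density.\<close>

lemma scaled_eq_laplacian_newton:
  assumes d: "d > 0"
  shows "md.scaled d = (\<lambda>x. - (\<Sum>j\<in>UNIV. pd j (pd j (newton d)) x))"
proof (rule ext)
  fix x :: "real^3"
  have pos: "1 + (x /\<^sub>R d) \<bullet> (x /\<^sub>R d) > 0" "d^2 + x \<bullet> x > 0"
    using d by (auto simp: add_pos_nonneg simp del: inner_scaleR_left inner_scaleR_right)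
  have e: "1 + (x /\<^sub>R d) \<bullet> (x /\<^sub>R d) = (d^2 + x \<bullet> x) / d^2"
    using d by (simp add: field_simps power2_eq_square)
  have d5: "(d^2) powr (- 5/2) = 1 / d^5"
  proof -
    have "(d^2) powr (- 5/2) = (d powr 2) powr (- 5/2)" using d by (simp add: powr_numeral)
    also have "\<dots> = d powr (- 5)" by (simp add: powr_powr)
    also have "\<dots> = 1 / d^5" using d by (simp add: powr_minus_divide powr_numeral)
    finally show ?thesis .
  qed
  have "(1 + (x /\<^sub>R d) \<bullet> (x /\<^sub>R d)) powr (- 5/2) = (d^2 + x \<bullet> x) powr (- 5/2) / (d^2) powr (- 5/2)"
    unfolding e by (rule powr_divide)
  then have p: "(1 + (x /\<^sub>R d) \<bullet> (x /\<^sub>R d)) powr (- 5/2) = d^5 * (d^2 + x \<bullet> x) powr (- 5/2)"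
    unfolding d5 by simp
  have "md.scaled d x = 3 * (d^5 * (d^2 + x \<bullet> x) powr (- 5/2)) / kernel_mass / d^3"
    unfolding md.scaled_def unit_density_def bump_density_def p by simp
  also have "\<dots> = (1 / kernel_mass) * (3 * d^2 * (d^2 + x \<bullet> x) powr (- 5/2))"
    using d by (simp add: field_simps eval_nat_numeral)
  also have "\<dots> = - (\<Sum>j\<in>UNIV. pd j (pd j (newton d)) x)"
    by (simp only: laplacian_riesz[OF d, symmetric] pd2_newton[OF d] sum_distrib_left[symmetric] mult_minus_right)
  finally show "md.scaled d x = - (\<Sum>j\<in>UNIV. pd j (pd j (newton d)) x)" .
qed

lemma smooth_scaled: "d > 0 \<Longrightarrow> smooth_fun (md.scaled d)"
  unfolding scaled_eq_laplacian_newton by (intro smooth_minus smooth_sum smooth_pd smooth_newton)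

section \<open>Weak derivatives\<close>

definition loc_Lp :: "nat \<Rightarrow> ('a::euclidean_space \<Rightarrow> real) \<Rightarrow> bool" where
  "loc_Lp p f \<longleftrightarrow> f \<in> borel_measurable borel \<and> (\<forall>r. in_Lp p (\<lambda>x. indicator (cball 0 r) x * f x))"

lemma loc_Lp_borel [measurable_dest]: "loc_Lp p f \<Longrightarrow> f \<in> borel_measurable borel"
  by (simp add: loc_Lp_def)

lemma cball_borel [measurable]: "cball (a::'a::euclidean_space) r \<in> sets borel"
  by (simp add: borel_closed)

lemma in_Lp_imp_loc_Lp: "in_Lp p f \<Longrightarrow> loc_Lp p f"
  unfolding loc_Lp_def
proof (intro conjI allI)
  assume f: "in_Lp p f"
  then show "f \<in> borel_measurable borel" by (simp add: in_Lp_def)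
  show "in_Lp p (\<lambda>x. indicator (cball 0 r) x * f x)" for r
    by (rule in_Lp_mult_bounded[OF f, where B=1]) (auto simp: indicator_def[abs_def] intro!: borel_measurable_indicator[unfolded indicator_def[abs_def]])
qed

lemma loc_Lp_mono:
  assumes f: "loc_Lp p f" and q: "q \<le> p" "q > 0"
  shows "loc_Lp q f"
  unfolding loc_Lp_def
proof (intro conjI allI)
  show fm [measurable]: "f \<in> borel_measurable borel" using f by (simp add: loc_Lp_def)
  fix r
  have "integrable lborel (\<lambda>x::'a. 1 * indicator (cball 0 r) x + \<bar>indicator (cball 0 r) x * f x\<bar> ^ p)"
    using f unfolding loc_Lp_def in_Lp_def
    by (intro Bochner_Integration.integrable_add integrable_mult_right integrable_real_indicator emeasure_bounded_finite) auto
  then have "integrable lborel (\<lambda>x. \<bar>indicator (cball 0 r) x * f x\<bar> ^ q)"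
  proof (rule Bochner_Integration.integrable_bound)
    have le: "\<bar>t\<bar> ^ q \<le> 1 + \<bar>t\<bar> ^ p" for t :: real
    proof (cases "\<bar>t\<bar> \<le> 1")
      case True then show ?thesis using power_le_one[of "\<bar>t\<bar>" q] by (simp add: add_increasing2)
    next
      case False then show ?thesis using power_increasing[of q p "\<bar>t\<bar>"] q by linarith
    qed
    show "AE x in lborel. norm (\<bar>indicator (cball 0 r) x * f x\<bar> ^ q)
        \<le> norm (1 * indicator (cball 0 r) x + \<bar>indicator (cball 0 r) x * f x\<bar> ^ p)"
      using le q by (intro AE_I2) (auto simp: indicator_def power_0_left)
  qed measurable
  then show "in_Lp q (\<lambda>x. indicator (cball 0 r) x * f x)" by (simp add: in_Lp_def)
qed

lemma loc_Lp_mult_bounded: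
  assumes f: "loc_Lp p f" and h: "h \<in> borel_measurable borel" "\<And>x. \<bar>h x\<bar> \<le> B" "\<And>x. norm x > r \<Longrightarrow> h x = 0"
  shows "in_Lp p (\<lambda>x. h x * f x)"
proof -
  have "in_Lp p (\<lambda>x. h x * (indicator (cball 0 r) x * f x))"
    using f by (intro in_Lp_mult_bounded[OF _ h(1,2)]) (simp add: loc_Lp_def)
  moreover have "h x * (indicator (cball 0 r) x * f x) = h x * f x" for x
    using h(3)[of x] by (cases "norm x > r") auto
  ultimately show ?thesis by simp
qed

lemma loc_Lp_mult_test:
  assumes f: "loc_Lp p f" and \<phi>: "\<phi> \<in> test_functions"
  shows "in_Lp p (\<lambda>x. \<phi> x * f x)"
proof -
  obtain r where "\<And>x. norm x > r \<Longrightarrow> \<phi> x = 0" using test_function_support[OF \<phi>] by metis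
  moreover obtain B where "\<And>x. \<bar>\<phi> x\<bar> \<le> B" using test_function_bounded[OF \<phi>] by metis
  ultimately show ?thesis
    by (intro loc_Lp_mult_bounded[OF f, of \<phi> B r] smooth_borel test_function_smooth \<phi>)
qed

lemma integrable_test_mult_loc:
  assumes f: "loc_Lp 1 f" and \<phi>: "\<phi> \<in> test_functions"
  shows "integrable lborel (\<lambda>x. \<phi> x * f x)" "integrable lborel (\<lambda>x. f x * \<phi> x)"
proof -
  have 1: "in_Lp 1 (\<lambda>x. \<phi> x * f x)" by (rule loc_Lp_mult_test[OF f \<phi>])
  then have "integrable lborel (\<lambda>x. \<bar>\<phi> x * f x\<bar>)" by (simp add: in_Lp_def)
  then show "integrable lborel (\<lambda>x. \<phi> x * f x)"
    using 1 by (subst (asm) integrable_abs_iff) (auto simp: in_Lp_def)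
  then show "integrable lborel (\<lambda>x. f x * \<phi> x)" by (simp add: mult.commute)
qed

lemma compact_L1_test_mult:
  assumes f: "loc_Lp 1 f" and \<phi>: "\<phi> \<in> test_functions"
  shows "compact_L1 (\<lambda>x. \<phi> x * f x)"
proof -
  obtain r where "\<And>x. norm x > r \<Longrightarrow> \<phi> x = 0" using test_function_support[OF \<phi>] by metis
  then show ?thesis using integrable_test_mult_loc[OF f \<phi>] by (auto simp: compact_L1_def)
qed

lemma compact_L1_add: "compact_L1 f \<Longrightarrow> compact_L1 g \<Longrightarrow> compact_L1 (\<lambda>x. f x + g x)"
  unfolding compact_L1_def
proof (elim conjE exE, intro conjI)
  fix r s assume "\<forall>y. r < norm y \<longrightarrow> f y = 0" "\<forall>y. s < norm y \<longrightarrow> g y = 0"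
  then show "\<exists>r. \<forall>y. r < norm y \<longrightarrow> f y + g y = 0" by (intro exI[of _ "max r s"]) auto
qed simp

lemma compact_L1_sum:
  "(\<And>i. i \<in> I \<Longrightarrow> compact_L1 (f i)) \<Longrightarrow> compact_L1 (\<lambda>x. \<Sum>i\<in>I. f i x)"
proof (induction I rule: infinite_finite_induct)
  case (insert i I)
  then show ?case by (simp add: compact_L1_add)
qed (simp_all add: compact_L1_def)

lemma conv_add:
  assumes "continuous_on UNIV K" "compact_L1 f" "compact_L1 g"
  shows "conv K (\<lambda>y. f y + g y) x = conv K f x + conv K g x"
  unfolding conv_def using conv_integrable[OF assms(1)] assms(2,3) by (simp add: distrib_left)

lemma smooth_reflect: "smooth_fun K \<Longrightarrow> smooth_fun (\<lambda>y. K (x - y))"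
  using smooth_affine[of K x "-1"] by simp

lemma pd_reflect: "smooth_fun K \<Longrightarrow> pd j (\<lambda>y. K (x - y)) = (\<lambda>y. - pd j K (x - y))"
  using partial_affine[of K _ x "-1"] by simp

definition weak_partial :: "'n::finite \<Rightarrow> (real^'n \<Rightarrow> real) \<Rightarrow> (real^'n \<Rightarrow> real) \<Rightarrow> bool" where
  "weak_partial j f g \<longleftrightarrow> (\<forall>\<phi>\<in>test_functions. (LBINT x. f x * pd j \<phi> x) = - (LBINT x. g x * \<phi> x))"

text \<open>The weak derivative is tested with \<open>y \<mapsto> \<theta> y K (x - y)\<close>.\<close>

lemma conv_weak_partial:
  assumes w: "weak_partial j f g" and f: "loc_Lp 1 f" and g: "loc_Lp 1 g"
    and \<theta>: "\<theta> \<in> test_functions" and K: "smooth_fun K"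
  shows "conv (pd j K) (\<lambda>y. \<theta> y * f y) x = conv K (\<lambda>y. \<theta> y * g y + pd j \<theta> y * f y) x"
proof -
  define \<phi> where "\<phi> y = \<theta> y * K (x - y)" for y
  have \<phi>: "\<phi> \<in> test_functions" unfolding \<phi>_def by (intro test_function_mult \<theta> smooth_reflect K)
  have d: "pd j \<phi> = (\<lambda>y. \<theta> y * (- pd j K (x - y)) + pd j \<theta> y * K (x - y))"
    unfolding \<phi>_def by (simp add: partial_mult test_function_smooth[OF \<theta>] smooth_reflect K pd_reflect)
  have c1: "compact_L1 (\<lambda>y. \<theta> y * f y)" "compact_L1 (\<lambda>y. \<theta> y * g y)" "compact_L1 (\<lambda>y. pd j \<theta> y * f y)"
    by (intro compact_L1_test_mult f g \<theta> test_pd)+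
  have kc: "continuous_on UNIV K" "continuous_on UNIV (pd j K)" by (intro smooth_continuous_on smooth_pd K)+
  note i = conv_integrable[OF kc(2) c1(1), of x] conv_integrable[OF kc(1) c1(2), of x] conv_integrable[OF kc(1) c1(3), of x]
  have "(LBINT y. f y * pd j \<phi> y) = (LBINT y. K (x - y) * (pd j \<theta> y * f y) - pd j K (x - y) * (\<theta> y * f y))"
    by (simp add: d algebra_simps)
  also have "\<dots> = conv K (\<lambda>y. pd j \<theta> y * f y) x - conv (pd j K) (\<lambda>y. \<theta> y * f y) x"
    using i by (simp add: conv_def)
  finally have 1: "(LBINT y. f y * pd j \<phi> y) = conv K (\<lambda>y. pd j \<theta> y * f y) x - conv (pd j K) (\<lambda>y. \<theta> y * f y) x" .
  have "(LBINT y. g y * \<phi> y) = conv K (\<lambda>y. \<theta> y * g y) x" by (simp add: \<phi>_def conv_def mult_ac)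
  moreover have "(LBINT y. f y * pd j \<phi> y) = - (LBINT y. g y * \<phi> y)"
    using w \<phi> by (simp add: weak_partial_def)
  ultimately show ?thesis using 1 by (simp add: conv_add[OF kc(1) c1(2,3)])
qed

text \<open>Testing with \<open>y \<mapsto> \<eta> y \<rho> (x - y)\<close> shows that all mollifications of \<open>\<eta> f\<close> vanish.\<close>

lemma fundamental_lemma:
  fixes f :: "real^3 \<Rightarrow> real"
  assumes f: "loc_Lp 1 f" and z: "\<And>\<phi>. \<phi> \<in> test_functions \<Longrightarrow> (LBINT x. f x * \<phi> x) = 0"
  shows "AE x in lborel. f x = 0"
proof -
  have "AE x in lborel. cutoff_at (real (Suc n)) x * f x = 0" for n
  proof -
    let ?\<eta> = "cutoff_at (real (Suc n)) :: real^3 \<Rightarrow> real"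
    let ?h = "\<lambda>y. ?\<eta> y * f y"
    have t: "?\<eta> \<in> test_functions" by (rule cutoff_at_test) simp
    have c: "compact_L1 ?h" by (rule compact_L1_test_mult[OF f t])
    have l: "in_Lp 1 ?h" by (rule loc_Lp_mult_test[OF f t])
    have "conv (md.scaled d) ?h x = 0" if "d > 0" for d x
    proof -
      have "conv (md.scaled d) ?h x = (LBINT y. f y * (?\<eta> y * md.scaled d (x - y)))"
        by (simp add: conv_def mult_ac)
      also have "\<dots> = 0" by (intro z test_function_mult t smooth_reflect smooth_scaled that)
      finally show ?thesis .
    qed
    then have "(\<lambda>m::nat. LBINT x. \<bar>?h x\<bar>) \<longlonglongrightarrow> 0"
      using Lp_tendstoD(3)[OF md.conv_Lp_tendsto[OF c l]] by simp
    then have "(LBINT x. \<bar>?h x\<bar>) = 0" using LIMSEQ_const_iff by blast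
    then show ?thesis
      using in_Lp_integrable[OF l] by (subst (asm) integral_nonneg_eq_0_iff_AE) auto
  qed
  then have "AE x in lborel. \<forall>n. cutoff_at (real (Suc n)) x * f x = 0" unfolding AE_all_countable by blast
  then show ?thesis
  proof eventually_elim
    case (elim x)
    obtain n where "norm x \<le> real n" using real_arch_simple by blast
    then have "cutoff_at (real (Suc n)) x = 1" by (intro cutoff_at_1) auto
    then show ?case using elim[rule_format, of n] by simp
  qed
qed

section \<open>A second-order energy identity\<close>

text \<open>Both \<open>\<eta> \<partial>\<^sub>j g \<partial>\<^sub>i\<partial>\<^sub>j g\<close> differentiated in direction \<open>i\<close> and \<open>\<eta> \<partial>\<^sub>j g \<partial>\<^sub>i\<partial>\<^sub>i g\<close> differentiated
  in direction \<open>j\<close> have integral zero, and they contain the same third-order term. This replaces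
  the \<open>L\<^sup>2\<close> theory of the second-order Riesz transforms.\<close>

lemma hessian_energy_identity:
  fixes g :: "real^3 \<Rightarrow> real"
  assumes g: "smooth_fun g" and \<eta>: "\<eta> \<in> test_functions"
  shows "(LBINT x. \<eta> x * (pd i (pd j g) x)^2) - (LBINT x. \<eta> x * (pd i (pd i g) x * pd j (pd j g) x))
    = (LBINT x. pd j \<eta> x * (pd j g x * pd i (pd i g) x)) - (LBINT x. pd i \<eta> x * (pd j g x * pd i (pd j g) x))"
proof -
  have s: "smooth_fun \<eta>" by (rule test_function_smooth[OF \<eta>])
  note sm = smooth_pd smooth_mult g s
  have int: "integrable lborel (\<lambda>x. \<phi> x * h x)" if "\<phi> \<in> test_functions" "smooth_fun h" for \<phi> h :: "real^3 \<Rightarrow> real"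
    by (rule test_function_integrable[OF test_function_mult[OF that]])
  have c: "pd i (pd i (pd j g)) = pd j (pd i (pd i g))"
    using pd_commute[OF g, of i j] pd_commute[OF smooth_pd[OF g], of i j i] by metis
  have 1: "0 = (LBINT x. pd i \<eta> x * (pd j g x * pd i (pd j g) x))
      + ((LBINT x. \<eta> x * (pd i (pd j g) x)^2) + (LBINT x. \<eta> x * (pd j g x * pd i (pd i (pd j g)) x)))"
  proof -
    have "0 = (LBINT x. pd i (\<lambda>x. \<eta> x * (pd j g x * pd i (pd j g) x)) x)"
      by (rule integral_pd_test[symmetric]) (intro test_function_mult \<eta> sm)
    also have "pd i (\<lambda>x. \<eta> x * (pd j g x * pd i (pd j g) x)) =
        (\<lambda>x. pd i \<eta> x * (pd j g x * pd i (pd j g) x) + (\<eta> x * (pd i (pd j g) x * pd i (pd j g) x) + \<eta> x * (pd j g x * pd i (pd i (pd j g)) x)))"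
      by (subst partial_mult, intro sm, intro sm, subst partial_mult, intro sm, intro sm) (simp add: algebra_simps)
    also have "(LBINT x. pd i \<eta> x * (pd j g x * pd i (pd j g) x) + (\<eta> x * (pd i (pd j g) x * pd i (pd j g) x) + \<eta> x * (pd j g x * pd i (pd i (pd j g)) x)))
      = (LBINT x. pd i \<eta> x * (pd j g x * pd i (pd j g) x))
      + ((LBINT x. \<eta> x * (pd i (pd j g) x * pd i (pd j g) x)) + (LBINT x. \<eta> x * (pd j g x * pd i (pd i (pd j g)) x)))"
      by (subst Bochner_Integration.integral_add Bochner_Integration.integral_add,
          (intro Bochner_Integration.integrable_add int test_pd \<eta> sm)+)+ (rule refl)
    finally show ?thesis by (simp add: power2_eq_square)
  qed
  have 2: "0 = (LBINT x. pd j \<eta> x * (pd j g x * pd i (pd i g) x))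
      + ((LBINT x. \<eta> x * (pd i (pd i g) x * pd j (pd j g) x)) + (LBINT x. \<eta> x * (pd j g x * pd j (pd i (pd i g)) x)))"
  proof -
    have "0 = (LBINT x. pd j (\<lambda>x. \<eta> x * (pd j g x * pd i (pd i g) x)) x)"
      by (rule integral_pd_test[symmetric]) (intro test_function_mult \<eta> sm)
    also have "pd j (\<lambda>x. \<eta> x * (pd j g x * pd i (pd i g) x)) =
        (\<lambda>x. pd j \<eta> x * (pd j g x * pd i (pd i g) x) + (\<eta> x * (pd i (pd i g) x * pd j (pd j g) x) + \<eta> x * (pd j g x * pd j (pd i (pd i g)) x)))"
      by (subst partial_mult, intro sm, intro sm, subst partial_mult, intro sm, intro sm) (simp add: algebra_simps)
    also have "(LBINT x. pd j \<eta> x * (pd j g x * pd i (pd i g) x) + (\<eta> x * (pd i (pd i g) x * pd j (pd j g) x) + \<eta> x * (pd j g x * pd j (pd i (pd i g)) x)))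
      = (LBINT x. pd j \<eta> x * (pd j g x * pd i (pd i g) x))
      + ((LBINT x. \<eta> x * (pd i (pd i g) x * pd j (pd j g) x)) + (LBINT x. \<eta> x * (pd j g x * pd j (pd i (pd i g)) x)))"
      by (subst Bochner_Integration.integral_add Bochner_Integration.integral_add,
          (intro Bochner_Integration.integrable_add int test_pd \<eta> sm)+)+ (rule refl)
    finally show ?thesis .
  qed
  show ?thesis using 1 2 unfolding c by linarith
qed

lemma conv_kernel_sum:
  assumes "\<And>i. i \<in> I \<Longrightarrow> continuous_on UNIV (K i)" "compact_L1 v"
  shows "conv (\<lambda>x. \<Sum>i\<in>I. K i x) v x = (\<Sum>i\<in>I. conv (K i) v x)"
  unfolding conv_def using conv_integrable[OF assms(1) assms(2)]
  by (simp add: sum_distrib_right Bochner_Integration.integral_sum)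

lemma conv_kernel_minus: "conv (\<lambda>x. - K x) v x = - conv K v x"
  by (simp add: conv_def)

lemma integral_sum_L1:
  fixes f :: "'i \<Rightarrow> 'a::euclidean_space \<Rightarrow> real"
  assumes "\<And>i. i \<in> I \<Longrightarrow> integrable lborel (f i)"
  shows "(\<Sum>i\<in>I. LBINT x. f i x) = (LBINT x. (\<Sum>i\<in>I. f i x))"
  using Bochner_Integration.integral_sum[of I lborel f] assms by simp

section \<open>Weak solutions without pressure\<close>

text \<open>The pressure has been eliminated by admitting only divergence-free test fields in the momentum equation.\<close>

locale steady_flow =
  fixes u :: "3 \<Rightarrow> real^3 \<Rightarrow> real" and G :: "3 \<Rightarrow> 3 \<Rightarrow> real^3 \<Rightarrow> real"
  assumes u6: "\<And>i. in_Lp 6 (u i)"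
    and G2: "\<And>i j. in_Lp 2 (G i j)"
    and weak: "\<And>i j. weak_partial j (u i) (G i j)"
    and div_free: "\<And>\<phi>. \<phi> \<in> test_functions \<Longrightarrow> (\<Sum>j\<in>UNIV. LBINT x. u j x * pd j \<phi> x) = 0"
    and momentum: "\<And>\<psi>. (\<And>i. \<psi> i \<in> test_functions) \<Longrightarrow> (\<And>x. (\<Sum>i\<in>UNIV. pd i (\<psi> i) x) = 0) \<Longrightarrow>
      (\<Sum>i\<in>UNIV. \<Sum>j\<in>UNIV. LBINT x. G i j x * pd j (\<psi> i) x)
      + (\<Sum>i\<in>UNIV. \<Sum>j\<in>UNIV. LBINT x. u j x * G i j x * \<psi> i x) = 0"
begin

lemma u_loc: "0 < q \<Longrightarrow> q \<le> 6 \<Longrightarrow> loc_Lp q (u i)"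
  using loc_Lp_mono[OF in_Lp_imp_loc_Lp[OF u6]] by blast

lemma G_loc: "0 < q \<Longrightarrow> q \<le> 2 \<Longrightarrow> loc_Lp q (G i j)"
  using loc_Lp_mono[OF in_Lp_imp_loc_Lp[OF G2]] by blast

lemma u_borel [measurable]: "u i \<in> borel_measurable borel" using u6 by (auto simp: in_Lp_def)
lemma G_borel [measurable]: "G i j \<in> borel_measurable borel" using G2 by (auto simp: in_Lp_def)

subsection \<open>Mollified velocity\<close>

definition moll :: "(real^3 \<Rightarrow> real) \<Rightarrow> 3 \<Rightarrow> nat \<Rightarrow> real^3 \<Rightarrow> real" where
  "moll \<theta> i n = conv (md.scaled (1 / real (Suc n))) (\<lambda>y. \<theta> y * u i y)"

text \<open>The weak derivative of \<open>\<theta> u\<^sub>i\<close> in direction \<open>j\<close>.\<close>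

definition cut_grad :: "(real^3 \<Rightarrow> real) \<Rightarrow> 3 \<Rightarrow> 3 \<Rightarrow> real^3 \<Rightarrow> real" where
  "cut_grad \<theta> i j y = \<theta> y * G i j y + pd j \<theta> y * u i y"

lemma compact_u: "\<theta> \<in> test_functions \<Longrightarrow> compact_L1 (\<lambda>y. \<theta> y * u i y)"
  by (rule compact_L1_test_mult[OF u_loc]) auto

lemma cut_grad_compact: "\<theta> \<in> test_functions \<Longrightarrow> compact_L1 (cut_grad \<theta> i j)"
  unfolding cut_grad_def[abs_def]
  by (intro compact_L1_add compact_L1_test_mult[OF G_loc] compact_L1_test_mult[OF u_loc] test_pd) auto

lemma cut_grad_L2: "\<theta> \<in> test_functions \<Longrightarrow> in_Lp 2 (cut_grad \<theta> i j)"
  unfolding cut_grad_def[abs_def]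
  by (intro in_Lp_add loc_Lp_mult_test[OF G_loc] loc_Lp_mult_test[OF u_loc] test_pd) auto

lemma moll_smooth: "\<theta> \<in> test_functions \<Longrightarrow> smooth_fun (moll \<theta> i n)"
  unfolding moll_def by (intro smooth_conv smooth_scaled compact_u) auto

lemma moll_pd: "\<theta> \<in> test_functions \<Longrightarrow> pd j (moll \<theta> i n) = conv (md.scaled (1 / real (Suc n))) (cut_grad \<theta> i j)"
  unfolding moll_def cut_grad_def[abs_def]
  by (subst pd_conv[OF smooth_scaled compact_u])
    (auto intro!: ext conv_weak_partial weak u_loc G_loc smooth_scaled)

lemma moll_tendsto: "\<theta> \<in> test_functions \<Longrightarrow> 0 < q \<Longrightarrow> q \<le> 6 \<Longrightarrow> Lp_tendsto q (moll \<theta> i) (\<lambda>y. \<theta> y * u i y)"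
  unfolding moll_def[abs_def] by (intro md.conv_Lp_tendsto compact_u loc_Lp_mult_test u_loc)

lemma moll_pd_tendsto: "\<theta> \<in> test_functions \<Longrightarrow> Lp_tendsto 2 (\<lambda>n. pd j (moll \<theta> i n)) (cut_grad \<theta> i j)"
  unfolding moll_pd by (rule md.conv_Lp_tendsto[OF cut_grad_compact cut_grad_L2]) auto

text \<open>A cut-off at a larger scale, which is one on a neighbourhood of the support of \<open>\<psi>\<close>.\<close>

lemma cutoff_around_test:
  assumes "\<psi> \<in> test_functions"
  obtains \<theta> where "\<theta> \<in> test_functions" "\<And>x. \<theta> x * \<psi> x = \<psi> (x::real^3)"
    "\<And>j x. pd j \<psi> x * \<theta> x = pd j \<psi> x" "\<And>j x. pd j \<theta> x * \<psi> x = 0"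
proof -
  obtain r where r: "r > 0" "\<And>x. norm x > r \<Longrightarrow> \<psi> x = 0" using test_function_support[OF assms] by metis
  have out: "pd j \<psi> x = 0" if "norm x > r" for j x by (rule partial_zero_outside[of r \<psi>]) (use r that in auto)
  have one: "cutoff_at (r + 1) x = 1" if "norm x \<le> r" for x :: "real^3" using r that by (intro cutoff_at_1) auto
  have flat: "pd j (cutoff_at (r + 1)) x = 0" if "norm x \<le> r" for x j using r that by (intro partial_cutoff_at_inner) auto
  show ?thesis
  proof (rule that[of "cutoff_at (r + 1)"])
    show "cutoff_at (r + 1) \<in> test_functions" using r by (intro cutoff_at_test) auto
    show "cutoff_at (r + 1) x * \<psi> x = \<psi> x" for x using one[of x] r(2)[of x] by (cases "norm x > r") auto
    show "pd j \<psi> x * cutoff_at (r + 1) x = pd j \<psi> x" for j x using one[of x] out[of x j] by (cases "norm x > r") auto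
    show "pd j (cutoff_at (r + 1)) x * \<psi> x = 0" for j x using flat[of x j] r(2)[of x] by (cases "norm x > r") auto
  qed
qed

text \<open>The velocity is divergence free against \<open>\<psi> u\<^sub>i\<close>; this function is not smooth and is reached
  as a limit of \<open>\<psi>\<close> times the mollified velocity.\<close>

lemma convection_divergence_form:
  assumes \<psi>: "\<psi> \<in> test_functions"
  shows "(\<Sum>j\<in>UNIV. LBINT x. u j x * G i j x * \<psi> x) = - (\<Sum>j\<in>UNIV. LBINT x. u i x * u j x * pd j \<psi> x)"
proof -
  obtain \<theta> where \<theta>: "\<theta> \<in> test_functions" "\<And>x. \<theta> x * \<psi> x = \<psi> x"
    "\<And>j x. pd j \<psi> x * \<theta> x = pd j \<psi> x" "\<And>j x. pd j \<theta> x * \<psi> x = 0"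
    using cutoff_around_test[OF \<psi>] by metis
  have uL2: "in_Lp 2 (\<lambda>x. \<phi> x * u j x)" if "\<phi> \<in> test_functions" for \<phi> j
    by (rule loc_Lp_mult_test[OF u_loc that]) auto
  have z: "(\<Sum>j\<in>UNIV. (LBINT x. (\<psi> x * u j x) * pd j (moll \<theta> i n) x) + (LBINT x. (pd j \<psi> x * u j x) * moll \<theta> i n x)) = 0" for n
  proof -
    have "0 = (\<Sum>j\<in>UNIV. LBINT x. u j x * pd j (\<lambda>x. \<psi> x * moll \<theta> i n x) x)"
      by (rule div_free[symmetric]) (intro test_function_mult \<psi> moll_smooth \<theta>)
    also have "\<dots> = (\<Sum>j\<in>UNIV. (LBINT x. (\<psi> x * u j x) * pd j (moll \<theta> i n) x) + (LBINT x. (pd j \<psi> x * u j x) * moll \<theta> i n x))"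
    proof (rule sum.cong[OF refl])
      fix j
      have "(LBINT x. u j x * pd j (\<lambda>x. \<psi> x * moll \<theta> i n x) x) =
          (LBINT x. (\<psi> x * u j x) * pd j (moll \<theta> i n) x + (pd j \<psi> x * u j x) * moll \<theta> i n x)"
        by (simp add: partial_mult test_function_smooth[OF \<psi>] moll_smooth[OF \<theta>(1)] algebra_simps)
      also have "\<dots> = (LBINT x. (\<psi> x * u j x) * pd j (moll \<theta> i n) x) + (LBINT x. (pd j \<psi> x * u j x) * moll \<theta> i n x)"
        by (intro Bochner_Integration.integral_add integrable_product_L2 uL2 \<psi> test_pd
            Lp_tendstoD(1)[OF moll_pd_tendsto] Lp_tendstoD(1)[OF moll_tendsto] \<theta>) auto
      finally show "(LBINT x. u j x * pd j (\<lambda>x. \<psi> x * moll \<theta> i n x) x) =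
          (LBINT x. (\<psi> x * u j x) * pd j (moll \<theta> i n) x) + (LBINT x. (pd j \<psi> x * u j x) * moll \<theta> i n x)" .
    qed
    finally show ?thesis by simp
  qed
  have "(\<lambda>n. \<Sum>j\<in>UNIV. (LBINT x. (\<psi> x * u j x) * pd j (moll \<theta> i n) x) + (LBINT x. (pd j \<psi> x * u j x) * moll \<theta> i n x))
    \<longlonglongrightarrow> (\<Sum>j\<in>UNIV. (LBINT x. (\<psi> x * u j x) * cut_grad \<theta> i j x) + (LBINT x. (pd j \<psi> x * u j x) * (\<theta> x * u i x)))"
    by (intro tendsto_sum tendsto_add L2_tendsto_inner Lp_tendsto_const uL2 \<psi> test_pd moll_pd_tendsto moll_tendsto \<theta>) auto
  then have "(\<Sum>j\<in>UNIV. (LBINT x. (\<psi> x * u j x) * cut_grad \<theta> i j x) + (LBINT x. (pd j \<psi> x * u j x) * (\<theta> x * u i x))) = 0"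
    unfolding z using LIMSEQ_unique tendsto_const by blast
  moreover have "(\<psi> x * u j x) * cut_grad \<theta> i j x = u j x * G i j x * \<psi> x" for j x
  proof -
    have "(\<psi> x * u j x) * cut_grad \<theta> i j x = u j x * G i j x * (\<theta> x * \<psi> x) + u j x * u i x * (pd j \<theta> x * \<psi> x)"
      by (simp add: cut_grad_def algebra_simps)
    then show ?thesis by (simp add: \<theta>)
  qed
  moreover have "(pd j \<psi> x * u j x) * (\<theta> x * u i x) = u i x * u j x * pd j \<psi> x" for j x
  proof -
    have "(pd j \<psi> x * u j x) * (\<theta> x * u i x) = u i x * u j x * (pd j \<psi> x * \<theta> x)" by (simp add: mult_ac)
    then show ?thesis by (simp add: \<theta>)
  qed
  ultimately show ?thesis by (simp add: sum.distrib)
qed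

text \<open>The same argument with the test function \<open>\<phi> u\<^sub>i\<^sup>2\<close>. The trilinear term passes to the limit because the
  mollified velocity converges in \<open>L\<^sup>4\<close> on bounded sets and its gradient in \<open>L\<^sup>2\<close>.\<close>

lemma convection_energy:
  assumes \<phi>: "\<phi> \<in> test_functions"
  shows "2 * (\<Sum>j\<in>UNIV. LBINT x. u i x * u j x * G i j x * \<phi> x) = - (\<Sum>j\<in>UNIV. LBINT x. (u i x)^2 * u j x * pd j \<phi> x)"
proof -
  obtain \<theta> where \<theta>: "\<theta> \<in> test_functions" "\<And>x. \<theta> x * \<phi> x = \<phi> x"
    "\<And>j x. pd j \<phi> x * \<theta> x = pd j \<phi> x" "\<And>j x. pd j \<theta> x * \<phi> x = 0"
    using cutoff_around_test[OF \<phi>] by metis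
  have uL4: "in_Lp 4 (\<lambda>x. \<phi> x * u j x)" if "\<phi> \<in> test_functions" for \<phi> j
    by (rule loc_Lp_mult_test[OF u_loc that]) auto
  have lim: "Lp_tendsto 2 (\<lambda>n x. (\<phi> x * u j x) * moll \<theta> i n x) (\<lambda>x. (\<phi> x * u j x) * (\<theta> x * u i x))"
    if "\<phi> \<in> test_functions" for \<phi> j
    by (intro Lp_tendsto_mult_L4 moll_tendsto \<theta> uL4 that) auto
  have lim2: "Lp_tendsto 2 (moll \<theta> i) (\<lambda>x. \<theta> x * u i x)" by (rule moll_tendsto[OF \<theta>(1)]) auto
  have z: "(\<Sum>j\<in>UNIV. 2 * (LBINT x. ((\<phi> x * u j x) * moll \<theta> i n x) * pd j (moll \<theta> i n) x)
      + (LBINT x. ((pd j \<phi> x * u j x) * moll \<theta> i n x) * moll \<theta> i n x)) = 0" for n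
  proof -
    have "0 = (\<Sum>j\<in>UNIV. LBINT x. u j x * pd j (\<lambda>x. \<phi> x * (moll \<theta> i n x * moll \<theta> i n x)) x)"
      by (rule div_free[symmetric]) (intro test_function_mult \<phi> smooth_mult moll_smooth \<theta>)
    also have "\<dots> = (\<Sum>j\<in>UNIV. 2 * (LBINT x. ((\<phi> x * u j x) * moll \<theta> i n x) * pd j (moll \<theta> i n) x)
      + (LBINT x. ((pd j \<phi> x * u j x) * moll \<theta> i n x) * moll \<theta> i n x))"
    proof (rule sum.cong[OF refl])
      fix j
      have "(LBINT x. u j x * pd j (\<lambda>x. \<phi> x * (moll \<theta> i n x * moll \<theta> i n x)) x) =
          (LBINT x. 2 * (((\<phi> x * u j x) * moll \<theta> i n x) * pd j (moll \<theta> i n) x) + ((pd j \<phi> x * u j x) * moll \<theta> i n x) * moll \<theta> i n x)"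
        by (simp add: partial_mult smooth_mult test_function_smooth[OF \<phi>] moll_smooth[OF \<theta>(1)] algebra_simps)
      also have "\<dots> = (LBINT x. 2 * (((\<phi> x * u j x) * moll \<theta> i n x) * pd j (moll \<theta> i n) x)) + (LBINT x. ((pd j \<phi> x * u j x) * moll \<theta> i n x) * moll \<theta> i n x)"
        by (intro Bochner_Integration.integral_add integrable_mult_right integrable_product_L2
            Lp_tendstoD(1)[OF lim] Lp_tendstoD(1)[OF lim2] Lp_tendstoD(1)[OF moll_pd_tendsto] \<theta> \<phi> test_pd)
      finally show "(LBINT x. u j x * pd j (\<lambda>x. \<phi> x * (moll \<theta> i n x * moll \<theta> i n x)) x) =
          2 * (LBINT x. ((\<phi> x * u j x) * moll \<theta> i n x) * pd j (moll \<theta> i n) x)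
          + (LBINT x. ((pd j \<phi> x * u j x) * moll \<theta> i n x) * moll \<theta> i n x)" by simp
    qed
    finally show ?thesis by simp
  qed
  have "(\<lambda>n. \<Sum>j\<in>UNIV. 2 * (LBINT x. ((\<phi> x * u j x) * moll \<theta> i n x) * pd j (moll \<theta> i n) x)
      + (LBINT x. ((pd j \<phi> x * u j x) * moll \<theta> i n x) * moll \<theta> i n x))
    \<longlonglongrightarrow> (\<Sum>j\<in>UNIV. 2 * (LBINT x. ((\<phi> x * u j x) * (\<theta> x * u i x)) * cut_grad \<theta> i j x)
      + (LBINT x. ((pd j \<phi> x * u j x) * (\<theta> x * u i x)) * (\<theta> x * u i x)))"
    by (intro tendsto_sum tendsto_add tendsto_mult tendsto_const L2_tendsto_inner lim lim2 moll_pd_tendsto \<theta> \<phi> test_pd)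
  then have "(\<Sum>j\<in>UNIV. 2 * (LBINT x. ((\<phi> x * u j x) * (\<theta> x * u i x)) * cut_grad \<theta> i j x)
      + (LBINT x. ((pd j \<phi> x * u j x) * (\<theta> x * u i x)) * (\<theta> x * u i x))) = 0"
    unfolding z using LIMSEQ_unique tendsto_const by blast
  moreover have "((\<phi> x * u j x) * (\<theta> x * u i x)) * cut_grad \<theta> i j x = u i x * u j x * G i j x * \<phi> x" for j x
  proof -
    have "((\<phi> x * u j x) * (\<theta> x * u i x)) * cut_grad \<theta> i j x
      = u i x * u j x * G i j x * (\<theta> x * (\<theta> x * \<phi> x)) + \<theta> x * u j x * (u i x)^2 * (pd j \<theta> x * \<phi> x)"
      by (simp add: cut_grad_def algebra_simps power2_eq_square)
    then show ?thesis by (simp add: \<theta>)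
  qed
  moreover have "((pd j \<phi> x * u j x) * (\<theta> x * u i x)) * (\<theta> x * u i x) = (u i x)^2 * u j x * pd j \<phi> x" for j x
  proof -
    have "((pd j \<phi> x * u j x) * (\<theta> x * u i x)) * (\<theta> x * u i x) = (u i x)^2 * u j x * ((pd j \<phi> x * \<theta> x) * \<theta> x)"
      by (simp add: mult_ac power2_eq_square)
    then show ?thesis by (simp add: \<theta>)
  qed
  ultimately show ?thesis by (simp add: sum.distrib sum_distrib_left)
qed

text \<open>The tensor paired with the gradient of a test field once convection is in divergence form.\<close>

definition flux :: "3 \<Rightarrow> 3 \<Rightarrow> real^3 \<Rightarrow> real" where
  "flux i j x = G i j x - u i x * u j x"

lemma flux_loc: "loc_Lp 2 (flux i j)"
  unfolding loc_Lp_def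
proof (intro conjI allI)
  show "flux i j \<in> borel_measurable borel" unfolding flux_def by measurable
  fix r
  have "in_Lp 4 (\<lambda>x. indicator (cball 0 r) x * u k x)" for k
    using u_loc[of 4 k] by (simp add: loc_Lp_def)
  then have "in_Lp 2 (\<lambda>x. (indicator (cball 0 r) x * u i x) * (indicator (cball 0 r) x * u j x))"
    by (intro in_Lp_product_L4)
  moreover have "in_Lp 2 (\<lambda>x. indicator (cball 0 r) x * G i j x)"
    using G_loc[of 2 i j] by (simp add: loc_Lp_def)
  ultimately have "in_Lp 2 (\<lambda>x. indicator (cball 0 r) x * G i j x - (indicator (cball 0 r) x * u i x) * (indicator (cball 0 r) x * u j x))"
    by (intro in_Lp_diff)
  moreover have "indicator (cball 0 r) x * G i j x - (indicator (cball 0 r) x * u i x) * (indicator (cball 0 r) x * u j x)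
      = indicator (cball 0 r) x * flux i j x" for x
    by (simp add: flux_def indicator_def)
  ultimately show "in_Lp 2 (\<lambda>x. indicator (cball 0 r) x * flux i j x)" by simp
qed

lemma flux_test_integrable: "\<phi> \<in> test_functions \<Longrightarrow> integrable lborel (\<lambda>x. flux i j x * \<phi> x)"
  by (rule integrable_test_mult_loc(2)[OF loc_Lp_mono[OF flux_loc]]) auto

lemma momentum_flux:
  assumes \<psi>: "\<And>i. \<psi> i \<in> test_functions" and d: "\<And>x. (\<Sum>i\<in>UNIV. pd i (\<psi> i) x) = 0"
  shows "(\<Sum>i\<in>UNIV. \<Sum>j\<in>UNIV. LBINT x. flux i j x * pd j (\<psi> i) x) = 0"
proof -
  have i1: "integrable lborel (\<lambda>x. G i j x * pd j (\<psi> i) x)" for i j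
    by (rule integrable_test_mult_loc(2)[OF G_loc test_pd[OF \<psi>]]) auto
  have i2: "integrable lborel (\<lambda>x. u i x * u j x * pd j (\<psi> i) x)" for i j
    using Bochner_Integration.integrable_diff[OF i1 flux_test_integrable[OF test_pd[OF \<psi>]], of i j i j j i]
    by (simp add: flux_def algebra_simps)
  have "(\<Sum>i\<in>UNIV. \<Sum>j\<in>UNIV. LBINT x. flux i j x * pd j (\<psi> i) x) =
      (\<Sum>i\<in>UNIV. \<Sum>j\<in>UNIV. (LBINT x. G i j x * pd j (\<psi> i) x) - (LBINT x. u i x * u j x * pd j (\<psi> i) x))"
    using i1 i2 by (simp add: flux_def left_diff_distrib)
  also have "\<dots> = (\<Sum>i\<in>UNIV. \<Sum>j\<in>UNIV. LBINT x. G i j x * pd j (\<psi> i) x)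
      + (\<Sum>i\<in>UNIV. - (\<Sum>j\<in>UNIV. LBINT x. u i x * u j x * pd j (\<psi> i) x))"
    by (simp add: sum_subtractf sum_negf)
  also have "\<dots> = 0" using momentum[OF \<psi> d] by (simp add: convection_divergence_form[OF \<psi>])
  finally show ?thesis .
qed

end

section \<open>A divergence-free test field at scale \<open>R\<close>\<close>

context steady_flow
begin

definition cut_vel :: "real \<Rightarrow> 3 \<Rightarrow> real^3 \<Rightarrow> real" where
  "cut_vel R i y = cutoff_at R y * u i y"

text \<open>The divergence of \<open>cut_vel R\<close>, as \<open>u\<close> is divergence free.\<close>

definition cut_div :: "real \<Rightarrow> real^3 \<Rightarrow> real" where
  "cut_div R y = (\<Sum>i\<in>UNIV. pd i (cutoff_at R) y * u i y)"

definition potential :: "real \<Rightarrow> real \<Rightarrow> real^3 \<Rightarrow> real" where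
  "potential R d = conv (newton d) (cut_div R)"

text \<open>The curl of the vector potential \<open>newton d * cut_vel R\<close>, as an antisymmetric matrix.\<close>

definition curl_pot :: "real \<Rightarrow> real \<Rightarrow> 3 \<Rightarrow> 3 \<Rightarrow> real^3 \<Rightarrow> real" where
  "curl_pot R d i k x = conv (pd i (newton d)) (cut_vel R k) x - conv (pd k (newton d)) (cut_vel R i) x"

text \<open>The factor four leaves a gap of width \<open>2R\<close> between the support of \<open>cut_vel R\<close> and the region where
  this function is not constant.\<close>

definition outer_cut :: "real \<Rightarrow> real^3 \<Rightarrow> real" where
  "outer_cut R = cutoff_at (4 * R)"

definition test_field :: "real \<Rightarrow> real \<Rightarrow> 3 \<Rightarrow> real^3 \<Rightarrow> real" where
  "test_field R d i x = (\<Sum>k\<in>UNIV. pd k (\<lambda>x. outer_cut R x * curl_pot R d i k x) x)"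

text \<open>The part of the gradient of \<open>test_field\<close> in which a derivative has fallen on the outer cut-off and
  which involves the kernel only at distance at least \<open>2R\<close>.\<close>

definition outer_err :: "real \<Rightarrow> real \<Rightarrow> 3 \<Rightarrow> 3 \<Rightarrow> real^3 \<Rightarrow> real" where
  "outer_err R d i j x = (\<Sum>k\<in>UNIV. pd j (pd k (outer_cut R)) x * curl_pot R d i k x + pd k (outer_cut R) x * pd j (curl_pot R d i k) x)
     + pd j (outer_cut R) x * pd i (potential R d) x"

lemma inner_test: "R > 0 \<Longrightarrow> cutoff_at R \<in> test_functions"
  by (rule cutoff_at_test)

lemma outer_test: "R > 0 \<Longrightarrow> outer_cut R \<in> test_functions"
  unfolding outer_cut_def by (rule cutoff_at_test) simp

lemma outer_smooth: "smooth_fun (outer_cut R)"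
  unfolding outer_cut_def by (rule smooth_cutoff_at)

lemma cut_vel_compact: "R > 0 \<Longrightarrow> compact_L1 (cut_vel R i)"
  unfolding cut_vel_def[abs_def] by (intro compact_u inner_test)

lemma cut_div_compact: "R > 0 \<Longrightarrow> compact_L1 (cut_div R)"
  unfolding cut_div_def[abs_def] by (intro compact_L1_sum compact_u test_pd inner_test)

lemma cut_div_L2: "R > 0 \<Longrightarrow> in_Lp 2 (cut_div R)"
  unfolding cut_div_def[abs_def] by (intro in_Lp_sum loc_Lp_mult_test[OF u_loc] test_pd inner_test) auto

lemma potential_smooth: "R > 0 \<Longrightarrow> d > 0 \<Longrightarrow> smooth_fun (potential R d)"
  unfolding potential_def by (intro smooth_conv smooth_newton cut_div_compact)

lemma curl_pot_smooth: "R > 0 \<Longrightarrow> d > 0 \<Longrightarrow> smooth_fun (curl_pot R d i k)"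
  unfolding curl_pot_def[abs_def] by (intro smooth_diff smooth_conv smooth_pd smooth_newton cut_vel_compact)

lemma pd_potential: "R > 0 \<Longrightarrow> d > 0 \<Longrightarrow> pd i (potential R d) = conv (pd i (newton d)) (cut_div R)"
  unfolding potential_def by (intro pd_conv smooth_newton cut_div_compact)

lemma pd2_potential: "R > 0 \<Longrightarrow> d > 0 \<Longrightarrow> pd j (pd i (potential R d)) = conv (pd j (pd i (newton d))) (cut_div R)"
  unfolding pd_potential by (intro pd_conv smooth_pd smooth_newton cut_div_compact)

lemma pd_curl_pot: "R > 0 \<Longrightarrow> d > 0 \<Longrightarrow> pd j (curl_pot R d i k)
    = (\<lambda>x. conv (pd j (pd i (newton d))) (cut_vel R k) x - conv (pd j (pd k (newton d))) (cut_vel R i) x)"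
  unfolding curl_pot_def[abs_def]
  by (subst partial_diff)
    (auto intro!: smooth_conv smooth_pd smooth_newton cut_vel_compact simp: pd_conv smooth_pd smooth_newton cut_vel_compact)

lemma curl_pot_antisym: "curl_pot R d k i x = - curl_pot R d i k x"
  by (simp add: curl_pot_def)

lemma laplacian_potential:
  assumes R: "R > 0" and d: "d > 0"
  shows "(\<Sum>j\<in>UNIV. pd j (pd j (potential R d)) x) = - conv (md.scaled d) (cut_div R) x"
proof -
  have "conv (md.scaled d) (cut_div R) x = - (\<Sum>j\<in>UNIV. conv (pd j (pd j (newton d))) (cut_div R) x)"
    unfolding scaled_eq_laplacian_newton[OF d] conv_kernel_minus
    by (subst conv_kernel_sum) (auto intro!: smooth_continuous_on smooth_pd smooth_newton d cut_div_compact R)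
  then show ?thesis by (simp add: pd2_potential[OF R d])
qed

text \<open>The velocity is tested with \<open>y \<mapsto> \<phi>\<^sub>R y N (x - y)\<close>, which moves the derivative from the kernel to the
  cut-off.\<close>

lemma sum_conv_cut_vel:
  assumes R: "R > 0" and d: "d > 0"
  shows "(\<Sum>k\<in>UNIV. conv (pd k (newton d)) (cut_vel R k) x) = potential R d x"
proof -
  have s: "smooth_fun (newton d)" by (rule smooth_newton[OF d])
  define \<phi> where "\<phi> y = cutoff_at R y * newton d (x - y)" for y
  have \<phi>: "\<phi> \<in> test_functions" unfolding \<phi>_def by (intro test_function_mult inner_test R smooth_reflect s)
  have pd\<phi>: "pd k \<phi> = (\<lambda>y. cutoff_at R y * (- pd k (newton d) (x - y)) + pd k (cutoff_at R) y * newton d (x - y))" for k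
    unfolding \<phi>_def by (simp add: partial_mult smooth_cutoff_at smooth_reflect s pd_reflect)
  have c: "compact_L1 (\<lambda>y. pd k (cutoff_at R) y * u k y)" for k by (intro compact_u test_pd inner_test R)
  have i1: "integrable lborel (\<lambda>y. newton d (x - y) * (pd k (cutoff_at R) y * u k y))" for k
    by (intro conv_integrable smooth_continuous_on s c)
  have i2: "integrable lborel (\<lambda>y. pd k (newton d) (x - y) * cut_vel R k y)" for k
    by (intro conv_integrable smooth_continuous_on smooth_pd s cut_vel_compact R)
  have "0 = (\<Sum>k\<in>UNIV. LBINT y. u k y * pd k \<phi> y)" by (rule div_free[OF \<phi>, symmetric])
  also have "\<dots> = (\<Sum>k\<in>UNIV. LBINT y. newton d (x - y) * (pd k (cutoff_at R) y * u k y) - pd k (newton d) (x - y) * cut_vel R k y)"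
    by (simp add: pd\<phi> cut_vel_def algebra_simps)
  also have "\<dots> = (\<Sum>k\<in>UNIV. LBINT y. newton d (x - y) * (pd k (cutoff_at R) y * u k y)) - (\<Sum>k\<in>UNIV. conv (pd k (newton d)) (cut_vel R k) x)"
    using i1 i2 by (simp add: conv_def sum_subtractf)
  also have "(\<Sum>k\<in>UNIV. LBINT y. newton d (x - y) * (pd k (cutoff_at R) y * u k y)) = potential R d x"
    unfolding potential_def conv_def cut_div_def by (subst integral_sum_L1[OF i1]) (simp add: sum_distrib_left)
  finally show ?thesis by simp
qed

lemma test_field_test: "R > 0 \<Longrightarrow> d > 0 \<Longrightarrow> test_field R d i \<in> test_functions"
  unfolding test_field_def[abs_def]
  by (intro test_function_sum test_pd test_function_mult outer_test curl_pot_smooth)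

text \<open>A double divergence of an antisymmetric matrix vanishes.\<close>

lemma test_field_div_free:
  assumes R: "R > 0" and d: "d > 0"
  shows "(\<Sum>i\<in>UNIV. pd i (test_field R d i) x) = 0"
proof -
  define B where "B i k x = outer_cut R x * curl_pot R d i k x" for i k x
  have Bs: "smooth_fun (B i k)" for i k
    unfolding B_def by (intro smooth_mult outer_smooth curl_pot_smooth R d)
  have BA: "B i k = (\<lambda>x. - B k i x)" for i k
    by (rule ext) (simp only: B_def curl_pot_antisym[of R d i k] mult_minus_right)
  have anti: "pd i (pd k (B i k)) x = - pd k (pd i (B k i)) x" for i k
  proof -
    have "pd i (pd k (B i k)) = pd i (pd k (\<lambda>x. - B k i x))" using BA[of i k] by (rule arg_cong)
    also have "\<dots> = (\<lambda>x. - pd i (pd k (B k i)) x)"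
      by (simp only: partial_minus[OF Bs] partial_minus[OF smooth_pd[OF Bs]])
    finally show ?thesis by (simp only: pd_commute[OF Bs[of k i], of i k])
  qed
  define S where "S = (\<Sum>i\<in>UNIV. \<Sum>k\<in>UNIV. pd i (pd k (B i k)) x)"
  have S: "(\<Sum>i\<in>UNIV. pd i (test_field R d i) x) = S"
    unfolding test_field_def[abs_def] S_def B_def[symmetric] by (simp add: partial_sum smooth_pd Bs)
  have "S = (\<Sum>k\<in>UNIV. \<Sum>i\<in>UNIV. pd i (pd k (B i k)) x)" unfolding S_def by (rule sum.swap)
  also have "\<dots> = (\<Sum>k\<in>UNIV. \<Sum>i\<in>UNIV. - pd k (pd i (B k i)) x)"
    by (intro sum.cong refl) (rule anti)
  also have "\<dots> = - S" unfolding S_def by (simp add: sum_negf)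
  finally show ?thesis using S by simp
qed

text \<open>The identity \<open>curl curl = \<nabla> div - \<Delta>\<close>: the divergence of the vector potential is \<open>potential\<close>, and its
  Laplacian is minus the mollified velocity.\<close>

lemma test_field_eq:
  assumes R: "R > 0" and d: "d > 0"
  shows "test_field R d i x = (\<Sum>k\<in>UNIV. pd k (outer_cut R) x * curl_pot R d i k x)
     + outer_cut R x * (pd i (potential R d) x + conv (md.scaled d) (cut_vel R i) x)"
proof -
  have s: "smooth_fun (newton d)" by (rule smooth_newton[OF d])
  have "(\<Sum>k\<in>UNIV. pd k (curl_pot R d i k) x) =
      (\<Sum>k\<in>UNIV. conv (pd k (pd i (newton d))) (cut_vel R k) x) - (\<Sum>k\<in>UNIV. conv (pd k (pd k (newton d))) (cut_vel R i) x)"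
    by (simp add: pd_curl_pot[OF R d] sum_subtractf)
  also have "(\<Sum>k\<in>UNIV. conv (pd k (pd i (newton d))) (cut_vel R k) x) = pd i (potential R d) x"
  proof -
    have "potential R d = (\<lambda>x. \<Sum>k\<in>UNIV. conv (pd k (newton d)) (cut_vel R k) x)"
      by (rule ext) (simp add: sum_conv_cut_vel[OF R d])
    then have "pd i (potential R d) x = (\<Sum>k\<in>UNIV. pd i (conv (pd k (newton d)) (cut_vel R k)) x)"
      by (simp add: partial_sum smooth_conv smooth_pd s cut_vel_compact R)
    also have "\<dots> = (\<Sum>k\<in>UNIV. conv (pd k (pd i (newton d))) (cut_vel R k) x)"
      by (simp add: pd_conv smooth_pd s cut_vel_compact R pd_commute[OF s, of i _])
    finally show ?thesis by simp
  qed
  also have "(\<Sum>k\<in>UNIV. conv (pd k (pd k (newton d))) (cut_vel R i) x) = - conv (md.scaled d) (cut_vel R i) x"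
    unfolding scaled_eq_laplacian_newton[OF d] conv_kernel_minus
    by (subst conv_kernel_sum) (auto intro!: smooth_continuous_on smooth_pd s cut_vel_compact R)
  finally have 1: "(\<Sum>k\<in>UNIV. pd k (curl_pot R d i k) x) = pd i (potential R d) x + conv (md.scaled d) (cut_vel R i) x" by simp
  have "test_field R d i x = (\<Sum>k\<in>UNIV. pd k (outer_cut R) x * curl_pot R d i k x + outer_cut R x * pd k (curl_pot R d i k) x)"
    unfolding test_field_def by (simp add: partial_mult outer_smooth curl_pot_smooth R d add.commute)
  then show ?thesis by (simp add: sum.distrib sum_distrib_left[symmetric] 1)
qed

lemma pd_field:
  assumes R: "R > 0" and d: "d > 0"
  shows "pd j (test_field R d i) x = (outer_err R d i j x + outer_cut R x * pd j (pd i (potential R d)) x)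
     + (pd j (outer_cut R) x * conv (md.scaled d) (cut_vel R i) x + outer_cut R x * pd j (conv (md.scaled d) (cut_vel R i)) x)"
proof -
  have sc: "smooth_fun (conv (md.scaled d) (cut_vel R i))" by (intro smooth_conv smooth_scaled d cut_vel_compact R)
  note sm = outer_smooth curl_pot_smooth[OF R d] potential_smooth[OF R d] sc
  have "test_field R d i = (\<lambda>x. (\<Sum>k\<in>UNIV. pd k (outer_cut R) x * curl_pot R d i k x)
     + outer_cut R x * (pd i (potential R d) x + conv (md.scaled d) (cut_vel R i) x))"
    by (rule ext) (rule test_field_eq[OF R d])
  then show ?thesis
    by (simp add: partial_add partial_mult partial_sum smooth_add smooth_mult smooth_sum smooth_pd sm outer_err_def algebra_simps)
qed

lemma outer_1: "R > 0 \<Longrightarrow> norm x \<le> 4 * R \<Longrightarrow> outer_cut R x = 1"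
  unfolding outer_cut_def by (intro cutoff_at_1) auto

lemma pd_outer_inner: "R > 0 \<Longrightarrow> norm x < 4 * R \<Longrightarrow> pd j (outer_cut R) x = 0"
  unfolding outer_cut_def by (intro partial_cutoff_at_inner) auto

text \<open>Testing the equation with \<open>test_field\<close> and letting the regularisation tend to zero leaves the main
  term, with the error terms bounded uniformly in the regularisation.\<close>

lemma flux_limit:
  assumes R: "R > 0"
    and W: "\<And>d. d > 0 \<Longrightarrow> \<bar>\<Sum>i\<in>UNIV. \<Sum>j\<in>UNIV. LBINT x. flux i j x * (outer_err R d i j x + outer_cut R x * pd j (pd i (potential R d)) x)\<bar> \<le> W"
  shows "\<bar>\<Sum>i\<in>UNIV. \<Sum>j\<in>UNIV. LBINT x. flux i j x * cut_grad (cutoff_at R) i j x\<bar> \<le> W"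
proof -
  let ?\<phi> = "cutoff_at R :: real^3 \<Rightarrow> real"
  have t: "?\<phi> \<in> test_functions" by (rule inner_test[OF R])
  define S where "S n = (\<Sum>i\<in>UNIV. \<Sum>j\<in>UNIV. (LBINT x. (pd j (outer_cut R) x * flux i j x) * moll ?\<phi> i n x)
      + (LBINT x. (outer_cut R x * flux i j x) * pd j (moll ?\<phi> i n) x))" for n
  have L2: "in_Lp 2 (\<lambda>x. pd j (outer_cut R) x * flux i j x)" "in_Lp 2 (\<lambda>x. outer_cut R x * flux i j x)" for i j
    by (intro loc_Lp_mult_test flux_loc test_pd outer_test R)+
  have "\<bar>S n\<bar> \<le> W" for n
  proof -
    define d where "d = 1 / real (Suc n)"
    have d: "d > 0" by (simp add: d_def)
    have moll: "moll ?\<phi> i n = conv (md.scaled d) (cut_vel R i)" for i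
      by (simp add: moll_def cut_vel_def[abs_def] d_def)
    have te: "(\<lambda>x. outer_err R d i j x + outer_cut R x * pd j (pd i (potential R d)) x) \<in> test_functions" for i j
    proof -
      have "(\<lambda>x. outer_err R d i j x) \<in> test_functions"
        unfolding outer_err_def
        by (intro test_function_add test_function_sum test_function_mult test_pd outer_test smooth_pd curl_pot_smooth potential_smooth R d)
      then show ?thesis
        by (intro test_function_add test_function_mult outer_test smooth_pd potential_smooth R d) auto
    qed
    have i1: "integrable lborel (\<lambda>x. flux i j x * (outer_err R d i j x + outer_cut R x * pd j (pd i (potential R d)) x))" for i j
      by (rule flux_test_integrable[OF te])
    have i2: "integrable lborel (\<lambda>x. (pd j (outer_cut R) x * flux i j x) * moll ?\<phi> i n x)"
      "integrable lborel (\<lambda>x. (outer_cut R x * flux i j x) * pd j (moll ?\<phi> i n) x)" for i j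
      by (intro integrable_product_L2 L2 Lp_tendstoD(1)[OF moll_tendsto] Lp_tendstoD(1)[OF moll_pd_tendsto] t; simp)+
    have "0 = (\<Sum>i\<in>UNIV. \<Sum>j\<in>UNIV. LBINT x. flux i j x * pd j (test_field R d i) x)"
      by (rule momentum_flux[OF test_field_test[OF R d] test_field_div_free[OF R d], symmetric])
    also have "\<dots> = (\<Sum>i\<in>UNIV. \<Sum>j\<in>UNIV. LBINT x. flux i j x * (outer_err R d i j x + outer_cut R x * pd j (pd i (potential R d)) x)
        + ((pd j (outer_cut R) x * flux i j x) * moll ?\<phi> i n x + (outer_cut R x * flux i j x) * pd j (moll ?\<phi> i n) x))"
      unfolding pd_field[OF R d] moll by (simp add: algebra_simps)
    also have "\<dots> = (\<Sum>i\<in>UNIV. \<Sum>j\<in>UNIV. LBINT x. flux i j x * (outer_err R d i j x + outer_cut R x * pd j (pd i (potential R d)) x)) + S n"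
      unfolding S_def using i1 i2 by (simp add: sum.distrib)
    finally show ?thesis using W[OF d] by linarith
  qed
  moreover have "S \<longlonglongrightarrow> (\<Sum>i\<in>UNIV. \<Sum>j\<in>UNIV. (LBINT x. (pd j (outer_cut R) x * flux i j x) * (?\<phi> x * u i x))
      + (LBINT x. (outer_cut R x * flux i j x) * cut_grad ?\<phi> i j x))"
    unfolding S_def[abs_def]
    by (intro tendsto_sum tendsto_add L2_tendsto_inner Lp_tendsto_const L2 moll_tendsto moll_pd_tendsto t) auto
  moreover have "(pd j (outer_cut R) x * flux i j x) * (?\<phi> x * u i x) = 0" for i j x
    using pd_outer_inner[OF R, of x j] cutoff_at_0[OF R, of x] R by (cases "norm x < 4 * R") auto
  moreover have "(outer_cut R x * flux i j x) * cut_grad ?\<phi> i j x = flux i j x * cut_grad ?\<phi> i j x" for i j x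
  proof (cases "norm x \<le> 4 * R")
    case False
    then have "cut_grad ?\<phi> i j x = 0" using R by (simp add: cut_grad_def cutoff_at_0 partial_cutoff_at_outer)
    then show ?thesis by simp
  qed (simp add: outer_1 R)
  ultimately have "S \<longlonglongrightarrow> (\<Sum>i\<in>UNIV. \<Sum>j\<in>UNIV. LBINT x. flux i j x * cut_grad ?\<phi> i j x)" by simp
  from tendsto_rabs[OF this] show ?thesis
    by (rule LIMSEQ_le_const2) (use \<open>\<And>n. \<bar>S n\<bar> \<le> W\<close> in blast)
qed

lemma uu_loc: "loc_Lp 2 (\<lambda>x. u i x * u j x)"
proof -
  have "in_Lp 2 (\<lambda>x. indicator (cball 0 r) x * G i j x - indicator (cball 0 r) x * flux i j x)" for r
    by (intro in_Lp_diff) (use flux_loc[of i j] G_loc[of 2 i j] in \<open>auto simp: loc_Lp_def\<close>)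
  then have "in_Lp 2 (\<lambda>x. indicator (cball 0 r) x * (u i x * u j x))" for r
    by (simp add: flux_def algebra_simps)
  then show ?thesis unfolding loc_Lp_def by simp
qed

text \<open>The convective contribution to the main term is half of a boundary term by \<open>convection_energy\<close>.\<close>

lemma flux_main_term:
  assumes \<phi>: "\<phi> \<in> test_functions"
  shows "(\<Sum>i\<in>UNIV. \<Sum>j\<in>UNIV. LBINT x. flux i j x * cut_grad \<phi> i j x)
    = (\<Sum>i\<in>UNIV. \<Sum>j\<in>UNIV. LBINT x. \<phi> x * (G i j x)^2)
    + (\<Sum>i\<in>UNIV. \<Sum>j\<in>UNIV. LBINT x. G i j x * (pd j \<phi> x * u i x))
    - (1/2) * (\<Sum>i\<in>UNIV. \<Sum>j\<in>UNIV. LBINT x. (u i x)^2 * u j x * pd j \<phi> x)"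
proof -
  obtain \<theta> where \<theta>: "\<theta> \<in> test_functions" "\<And>j x. pd j \<phi> x * \<theta> x = pd j \<phi> x"
    using cutoff_around_test[OF \<phi>] by metis
  obtain B where B: "\<And>x. \<bar>\<phi> x\<bar> \<le> B" using test_function_bounded[OF \<phi>] by metis
  have \<phi>m: "\<phi> \<in> borel_measurable borel" by (intro smooth_borel test_function_smooth \<phi>)
  have i1: "integrable lborel (\<lambda>x. \<phi> x * (G i j x)^2)" for i j
    using integrable_product_L2[OF in_Lp_mult_bounded[OF G2 \<phi>m B] G2, of i j i j] by (simp add: power2_eq_square mult.assoc)
  have i2: "integrable lborel (\<lambda>x. G i j x * (pd j \<phi> x * u i x))" for i j
    by (intro integrable_product_L2 G2 loc_Lp_mult_test[OF u_loc] test_pd \<phi>) auto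
  have i3: "integrable lborel (\<lambda>x. u i x * u j x * G i j x * \<phi> x)" for i j
    using integrable_product_L2[OF loc_Lp_mult_test[OF uu_loc \<phi>] G2, of i j i j] by (simp add: mult_ac)
  have i4: "integrable lborel (\<lambda>x. (u i x)^2 * u j x * pd j \<phi> x)" for i j
  proof -
    have "in_Lp 2 (\<lambda>x. \<theta> x * u i x)" by (rule loc_Lp_mult_test[OF u_loc \<theta>(1)]) auto
    then have "integrable lborel (\<lambda>x. (pd j \<phi> x * (u i x * u j x)) * (\<theta> x * u i x))"
      by (intro integrable_product_L2 loc_Lp_mult_test[OF uu_loc] test_pd \<phi>)
    moreover have "(pd j \<phi> x * (u i x * u j x)) * (\<theta> x * u i x) = (u i x)^2 * u j x * pd j \<phi> x" for x
    proof -
      have "(pd j \<phi> x * (u i x * u j x)) * (\<theta> x * u i x) = (u i x)^2 * u j x * (pd j \<phi> x * \<theta> x)"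
        by (simp add: power2_eq_square mult_ac)
      then show ?thesis by (simp add: \<theta>)
    qed
    ultimately show ?thesis by simp
  qed
  have e: "(LBINT x. flux i j x * cut_grad \<phi> i j x) = (LBINT x. \<phi> x * (G i j x)^2)
      + (LBINT x. G i j x * (pd j \<phi> x * u i x)) - (LBINT x. u i x * u j x * G i j x * \<phi> x)
      - (LBINT x. (u i x)^2 * u j x * pd j \<phi> x)" for i j
  proof -
    have "(LBINT x. flux i j x * cut_grad \<phi> i j x) = (LBINT x. \<phi> x * (G i j x)^2 + G i j x * (pd j \<phi> x * u i x)
        - u i x * u j x * G i j x * \<phi> x - (u i x)^2 * u j x * pd j \<phi> x)"
      by (intro Bochner_Integration.integral_cong refl) (simp add: flux_def cut_grad_def algebra_simps power2_eq_square)
    then show ?thesis using i1 i2 i3 i4 by simp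
  qed
  have "(\<Sum>j\<in>UNIV. LBINT x. u i x * u j x * G i j x * \<phi> x) = - (1/2) * (\<Sum>j\<in>UNIV. LBINT x. (u i x)^2 * u j x * pd j \<phi> x)" for i
    using convection_energy[OF \<phi>, of i] by linarith
  then have "(\<Sum>i\<in>UNIV. \<Sum>j\<in>UNIV. LBINT x. u i x * u j x * G i j x * \<phi> x)
      = (\<Sum>i\<in>UNIV. - (1/2) * (\<Sum>j\<in>UNIV. LBINT x. (u i x)^2 * u j x * pd j \<phi> x))" by simp
  also have "\<dots> = - (1/2) * (\<Sum>i\<in>UNIV. \<Sum>j\<in>UNIV. LBINT x. (u i x)^2 * u j x * pd j \<phi> x)"
    by (rule sum_distrib_left[symmetric])
  finally show ?thesis unfolding e sum.distrib sum_subtractf by linarith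
qed

section \<open>Bounds for the error terms\<close>

definition speed :: "real^3 \<Rightarrow> real" where
  "speed x = (\<Sum>i\<in>UNIV. \<bar>u i x\<bar>)"

lemma speed_nonneg: "speed x \<ge> 0" by (simp add: speed_def sum_nonneg)

lemma u_le_speed: "\<bar>u i x\<bar> \<le> speed x"
  unfolding speed_def by (rule member_le_sum) auto

lemma speed_L6: "in_Lp 6 speed"
proof -
  have "in_Lp 6 (\<lambda>x. \<bar>u i x\<bar>)" for i using u6[of i] by (simp add: in_Lp_def)
  then show ?thesis unfolding speed_def[abs_def] by (intro in_Lp_sum) auto
qed

lemma speed_borel [measurable]: "speed \<in> borel_measurable borel" using speed_L6 by (simp add: in_Lp_def)

lemma speed_power_integrable:
  assumes "S \<in> sets borel" "S \<subseteq> cball 0 r" "0 < q" "q \<le> 6"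
  shows "integrable lborel (\<lambda>x. indicator S x * speed x ^ q)"
proof -
  note [measurable] = assms(1)
  have "in_Lp q (\<lambda>x. indicator S x * speed x)"
    by (rule loc_Lp_mult_bounded[OF loc_Lp_mono[OF in_Lp_imp_loc_Lp[OF speed_L6] assms(4,3)], of _ 1 r])
      (use assms(2) in \<open>auto simp: indicator_def\<close>)
  then have "integrable lborel (\<lambda>x. \<bar>indicator S x * speed x\<bar> ^ q)" by (rule in_Lp_integrable)
  moreover have "\<bar>indicator S x * speed x\<bar> ^ q = indicator S x * speed x ^ q" for x
    using assms(3) by (simp add: indicator_def speed_nonneg)
  ultimately show ?thesis by simp
qed

lemma norm_diff_far:
  fixes x y :: "real^3"
  assumes "norm x \<ge> 4 * R" "norm y \<le> 2 * R" "R > 0"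
  shows "norm (x - y) \<ge> 2 * R" "x - y \<noteq> 0"
proof -
  show "norm (x - y) \<ge> 2 * R" using norm_triangle_ineq2[of x y] assms by linarith
  then show "x - y \<noteq> 0" using assms(3) by auto
qed

text \<open>For \<open>|x| \<ge> 4R\<close> and \<open>|y| \<le> 2R\<close> the kernel is evaluated at distance at least \<open>2R\<close>.\<close>

lemma far_kernel_bounds:
  assumes R: "R > 0" and d: "d > 0" and x: "norm x \<ge> 4 * R"
    and v: "compact_L1 v" "\<And>y. norm y > 2 * R \<Longrightarrow> v y = 0"
  shows "\<bar>conv (pd i (newton d)) v x\<bar> \<le> (1 / kernel_mass) / R^2 * (LBINT y. \<bar>v y\<bar>)"
    and "\<bar>conv (pd j (pd i (newton d))) v x\<bar> \<le> (1 / kernel_mass) / R^3 * (LBINT y. \<bar>v y\<bar>)"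
proof -
  have k: "1 / kernel_mass \<ge> 0" using kernel_mass_pos by simp
  have s: "smooth_fun (newton d)" by (rule smooth_newton[OF d])
  show "\<bar>conv (pd i (newton d)) v x\<bar> \<le> (1 / kernel_mass) / R^2 * (LBINT y. \<bar>v y\<bar>)"
  proof (rule conv_bound[OF smooth_continuous_on[OF smooth_pd[OF s]] v(1)])
    fix y assume "v y \<noteq> 0"
    then have y: "norm y \<le> 2 * R" using v(2) by (meson not_le)
    note far = norm_diff_far[OF x y R]
    have "\<bar>pd i (newton d) (x - y)\<bar> \<le> (1 / kernel_mass) / norm (x - y) ^ 2" by (rule pd_newton_bound[OF d far(2)])
    also have "\<dots> \<le> (1 / kernel_mass) / R^2"
      using far(1) R k by (intro divide_left_mono power_mono mult_pos_pos zero_less_power) auto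
    finally show "\<bar>pd i (newton d) (x - y)\<bar> \<le> (1 / kernel_mass) / R^2" .
  qed
  show "\<bar>conv (pd j (pd i (newton d))) v x\<bar> \<le> (1 / kernel_mass) / R^3 * (LBINT y. \<bar>v y\<bar>)"
  proof (rule conv_bound[OF smooth_continuous_on[OF smooth_pd[OF smooth_pd[OF s]]] v(1)])
    fix y assume "v y \<noteq> 0"
    then have y: "norm y \<le> 2 * R" using v(2) by (meson not_le)
    note far = norm_diff_far[OF x y R]
    have "\<bar>pd j (pd i (newton d)) (x - y)\<bar> \<le> (4 / kernel_mass) / norm (x - y) ^ 3" by (rule pd2_newton_bound[OF d far(2)])
    also have "\<dots> \<le> (4 / kernel_mass) / (2 * R)^3"
      using far(1) R kernel_mass_pos by (intro divide_left_mono power_mono mult_pos_pos zero_less_power) auto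
    also have "\<dots> \<le> (1 / kernel_mass) / R^3" using R kernel_mass_pos by (simp add: power_mult_distrib field_simps)
    finally show "\<bar>pd j (pd i (newton d)) (x - y)\<bar> \<le> (1 / kernel_mass) / R^3" .
  qed
qed

definition inner_mass :: "real \<Rightarrow> real" where
  "inner_mass R = (LBINT x. indicator (cball 0 (2 * R)) x * speed x)"

lemma speed_integrable: "integrable lborel (\<lambda>x. indicator (cball 0 r) x * speed x)"
  using speed_power_integrable[of "cball 0 r" r 1] by simp

lemma inner_mass_nonneg: "inner_mass R \<ge> 0"
  unfolding inner_mass_def by (rule integral_nonneg_AE) (simp add: speed_nonneg)

lemma cut_vel_mass: assumes R: "R > 0" shows "(LBINT y. \<bar>cut_vel R i y\<bar>) \<le> inner_mass R"
  unfolding inner_mass_def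
proof (rule integral_mono)
  show "integrable lborel (\<lambda>y. \<bar>cut_vel R i y\<bar>)" using cut_vel_compact[OF R, of i] by (simp add: compact_L1_def)
  show "\<bar>cut_vel R i y\<bar> \<le> indicator (cball 0 (2 * R)) y * speed y" for y
  proof (cases "norm y \<le> 2 * R")
    case True
    have "\<bar>cut_vel R i y\<bar> \<le> 1 * speed y"
      unfolding cut_vel_def abs_mult by (intro mult_mono u_le_speed) (auto simp: cutoff_at_nonneg cutoff_at_le_1)
    then show ?thesis using True by simp
  qed (simp add: cut_vel_def cutoff_at_0 R)
qed (rule speed_integrable)

text \<open>A constant for the first and second derivatives of the cut-offs at all scales.\<close>

definition cut_const :: real where
  "cut_const = (SOME C. C \<ge> 1 \<and> (\<forall>b\<in>Basis. \<forall>R x. R > 0 \<longrightarrow> \<bar>partial_deriv b (cutoff_at R) (x::real^3)\<bar> \<le> C / R) \<and>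
     (\<forall>b\<in>Basis. \<forall>c\<in>Basis. \<forall>R x. R > 0 \<longrightarrow> \<bar>partial_deriv c (partial_deriv b (cutoff_at R)) (x::real^3)\<bar> \<le> C / R^2))"

lemma cut_const:
  fixes x :: "real^3"
  shows "cut_const \<ge> 1" "R > 0 \<Longrightarrow> \<bar>pd j (cutoff_at R) x\<bar> \<le> cut_const / R"
    "R > 0 \<Longrightarrow> \<bar>pd k (pd j (cutoff_at R)) x\<bar> \<le> cut_const / R^2"
proof -
  have "\<exists>C\<ge>1. (\<forall>b\<in>Basis. \<forall>R x. R > 0 \<longrightarrow> \<bar>partial_deriv b (cutoff_at R) (x::real^3)\<bar> \<le> C / R) \<and>
     (\<forall>b\<in>Basis. \<forall>c\<in>Basis. \<forall>R x. R > 0 \<longrightarrow> \<bar>partial_deriv c (partial_deriv b (cutoff_at R)) (x::real^3)\<bar> \<le> C / R^2)"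
    using cutoff_derivatives_bounded by metis
  from someI_ex[OF this, folded cut_const_def]
  have *: "cut_const \<ge> 1" "\<forall>b\<in>Basis. \<forall>R x. R > 0 \<longrightarrow> \<bar>partial_deriv b (cutoff_at R) (x::real^3)\<bar> \<le> cut_const / R"
    "\<forall>b\<in>Basis. \<forall>c\<in>Basis. \<forall>R x. R > 0 \<longrightarrow> \<bar>partial_deriv c (partial_deriv b (cutoff_at R)) (x::real^3)\<bar> \<le> cut_const / R^2"
    by auto
  show "cut_const \<ge> 1" by (rule *)
  show "R > 0 \<Longrightarrow> \<bar>pd j (cutoff_at R) x\<bar> \<le> cut_const / R" by (rule bspec[OF *(2) axis_Basis, rule_format])
  show "R > 0 \<Longrightarrow> \<bar>pd k (pd j (cutoff_at R)) x\<bar> \<le> cut_const / R^2"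
    by (rule bspec[OF bspec[OF *(3) axis_Basis] axis_Basis, rule_format])
qed

lemma outer_bounds:
  assumes R: "R > 0"
  shows "\<bar>pd j (outer_cut R) x\<bar> \<le> cut_const / R" "\<bar>pd k (pd j (outer_cut R)) x\<bar> \<le> cut_const / R^2"
proof -
  have c: "cut_const \<ge> 0" using cut_const(1) by linarith
  have "\<bar>pd j (outer_cut R) x\<bar> \<le> cut_const / (4 * R)" unfolding outer_cut_def using R by (intro cut_const) auto
  also have "\<dots> \<le> cut_const / R" using R c by (intro divide_left_mono) auto
  finally show "\<bar>pd j (outer_cut R) x\<bar> \<le> cut_const / R" .
  have "\<bar>pd k (pd j (outer_cut R)) x\<bar> \<le> cut_const / (4 * R)^2" unfolding outer_cut_def using R by (intro cut_const) auto
  also have "\<dots> \<le> cut_const / R^2" using R c by (intro divide_left_mono power_mono) auto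
  finally show "\<bar>pd k (pd j (outer_cut R)) x\<bar> \<le> cut_const / R^2" .
qed

lemma outer_flat:
  assumes R: "R > 0" and x: "\<not> (4 * R \<le> norm x \<and> norm x \<le> 8 * R)"
  shows "pd j (outer_cut R) x = 0" "pd k (pd j (outer_cut R)) x = 0"
proof -
  consider "norm x < 4 * R" | "norm x > 2 * (4 * R)" using x by linarith
  then show "pd j (outer_cut R) x = 0" "pd k (pd j (outer_cut R)) x = 0"
    unfolding outer_cut_def using R
    by (cases; simp add: partial_cutoff_at_inner partial_cutoff_at_outer partial2_cutoff_at_inner partial2_cutoff_at_outer)+
qed

definition annulus :: "real \<Rightarrow> (real^3) set" where
  "annulus R = {x. R \<le> norm x \<and> norm x \<le> 8 * R}"

lemma annulus_borel [measurable]: "annulus R \<in> sets borel"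
  unfolding annulus_def by measurable

lemma cut_div_le: assumes R: "R > 0" shows "\<bar>cut_div R x\<bar> \<le> cut_const / R * (indicator (annulus R \<inter> cball 0 (2 * R)) x * speed x)"
proof (cases "R \<le> norm x \<and> norm x \<le> 2 * R")
  case True
  have "\<bar>cut_div R x\<bar> \<le> (\<Sum>i\<in>UNIV. cut_const / R * \<bar>u i x\<bar>)"
    unfolding cut_div_def by (rule order_trans[OF sum_abs sum_mono]) (unfold abs_mult, rule mult_right_mono[OF cut_const(2)[OF R]], simp)
  then show ?thesis using True R by (simp add: speed_def sum_distrib_left annulus_def)
next
  case False
  then consider "norm x < R" | "norm x > 2 * R" by linarith
  then have "cut_div R x = 0" unfolding cut_div_def using R by cases (simp_all add: partial_cutoff_at_inner partial_cutoff_at_outer)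
  moreover have "cut_const / R * (indicator (annulus R \<inter> cball 0 (2 * R)) x * speed x) \<ge> 0"
    using cut_const(1) R speed_nonneg by simp
  ultimately show ?thesis by simp
qed

lemma cut_div_support: "R > 0 \<Longrightarrow> norm y > 2 * R \<Longrightarrow> cut_div R y = 0"
  unfolding cut_div_def by (simp add: partial_cutoff_at_outer)

lemma cut_div_mass: assumes R: "R > 0" shows "(LBINT y. \<bar>cut_div R y\<bar>) \<le> cut_const / R * inner_mass R"
proof -
  have "(LBINT y. \<bar>cut_div R y\<bar>) \<le> (LBINT y. cut_const / R * (indicator (cball 0 (2 * R)) y * speed y))"
  proof (rule integral_mono)
    show "integrable lborel (\<lambda>y. \<bar>cut_div R y\<bar>)" using cut_div_compact[OF R] by (simp add: compact_L1_def)
    show "integrable lborel (\<lambda>y. cut_const / R * (indicator (cball 0 (2 * R)) y * speed y))"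
      by (intro integrable_mult_right speed_integrable)
    show "\<bar>cut_div R y\<bar> \<le> cut_const / R * (indicator (cball 0 (2 * R)) y * speed y)" for y
      by (rule order_trans[OF cut_div_le[OF R]]) (use cut_const(1) R speed_nonneg in \<open>auto intro!: mult_left_mono simp: indicator_def\<close>)
  qed
  then show ?thesis by (simp add: inner_mass_def)
qed

text \<open>The sum of the constants is \<open>12 C + C\<^sup>2\<close> with \<open>C\<close> = \<open>cut_const\<close>, which is at least one.\<close>

definition err_const :: real where "err_const = 13 * cut_const^2 / kernel_mass"

text \<open>Two derivatives in all are distributed over the two cut-offs and the kernel \<open>\<nabla>N\<close>, each worth a factor
  \<open>R\<^sup>-\<^sup>1\<close>; together with \<open>R\<^sup>-\<^sup>2\<close> from \<open>\<nabla>N\<close> itself this gives \<open>R\<^sup>-\<^sup>4\<close>.\<close>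

lemma outer_err_bound:
  assumes R: "R > 0" and d: "d > 0"
  shows "\<bar>outer_err R d i j x\<bar> \<le> err_const * inner_mass R / R^4 * indicator (annulus (4 * R) \<inter> cball 0 (8 * R)) x"
proof (cases "4 * R \<le> norm x \<and> norm x \<le> 8 * R")
  case False
  then have "outer_err R d i j x = 0" unfolding outer_err_def by (simp add: outer_flat[OF R False])
  then show ?thesis using False cut_const(1) kernel_mass_pos inner_mass_nonneg R
    by (auto simp: err_const_def indicator_def)
next
  case True
  define \<kappa> where "\<kappa> = 1 / kernel_mass"
  define m where "m = inner_mass R"
  define C where "C = cut_const"
  have k: "\<kappa> \<ge> 0" using kernel_mass_pos by (simp add: \<kappa>_def)
  have m: "m \<ge> 0" by (simp add: m_def inner_mass_nonneg)
  have C: "C \<ge> 1" by (simp add: C_def cut_const)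
  have vs: "cut_vel R i y = 0" if "norm y > 2 * R" for i y using that R by (simp add: cut_vel_def cutoff_at_0)
  have x: "norm x \<ge> 4 * R" using True by simp
  have k2: "1 / kernel_mass / R^2 \<ge> 0" "1 / kernel_mass / R^3 \<ge> 0" using kernel_mass_pos R by auto
  have b1: "\<bar>conv (pd a (newton d)) (cut_vel R b) x\<bar> \<le> \<kappa> / R^2 * m" for a b
    unfolding \<kappa>_def m_def
    by (rule order_trans[OF far_kernel_bounds(1)[OF R d x cut_vel_compact[OF R] vs] mult_left_mono[OF cut_vel_mass[OF R] k2(1)]])
  have b2: "\<bar>conv (pd c (pd a (newton d))) (cut_vel R b) x\<bar> \<le> \<kappa> / R^3 * m" for a b c
    unfolding \<kappa>_def m_def
    by (rule order_trans[OF far_kernel_bounds(2)[OF R d x cut_vel_compact[OF R] vs] mult_left_mono[OF cut_vel_mass[OF R] k2(2)]])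
  have b3: "\<bar>pd i (potential R d) x\<bar> \<le> \<kappa> / R^2 * (C / R * m)"
    unfolding pd_potential[OF R d] \<kappa>_def m_def C_def
    by (rule order_trans[OF far_kernel_bounds(1)[OF R d x cut_div_compact[OF R] cut_div_support[OF R]] mult_left_mono[OF cut_div_mass[OF R] k2(1)]])
  have v1: "\<bar>curl_pot R d i k x\<bar> \<le> 2 * \<kappa> / R^2 * m" for k
    using b1[of i k] b1[of k i] unfolding curl_pot_def by linarith
  have v2: "\<bar>pd j (curl_pot R d i k) x\<bar> \<le> 2 * \<kappa> / R^3 * m" for k
    using b2[of j i k] b2[of j k i] unfolding pd_curl_pot[OF R d] by linarith
  have t: "\<bar>pd j (pd k (outer_cut R)) x * curl_pot R d i k x + pd k (outer_cut R) x * pd j (curl_pot R d i k) x\<bar>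
      \<le> C / R^2 * (2 * \<kappa> / R^2 * m) + C / R * (2 * \<kappa> / R^3 * m)" for k
  proof -
    have "\<bar>pd j (pd k (outer_cut R)) x * curl_pot R d i k x\<bar> \<le> C / R^2 * (2 * \<kappa> / R^2 * m)"
      unfolding abs_mult C_def using C R by (intro mult_mono outer_bounds v1) (auto simp: C_def)
    moreover have "\<bar>pd k (outer_cut R) x * pd j (curl_pot R d i k) x\<bar> \<le> C / R * (2 * \<kappa> / R^3 * m)"
      unfolding abs_mult C_def using C R by (intro mult_mono outer_bounds v2) (auto simp: C_def)
    ultimately show ?thesis by linarith
  qed
  have "\<bar>outer_err R d i j x\<bar> \<le> (\<Sum>k\<in>(UNIV::3 set). C / R^2 * (2 * \<kappa> / R^2 * m) + C / R * (2 * \<kappa> / R^3 * m))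
      + C / R * (\<kappa> / R^2 * (C / R * m))"
  proof -
    have "\<bar>pd j (outer_cut R) x * pd i (potential R d) x\<bar> \<le> C / R * (\<kappa> / R^2 * (C / R * m))"
      unfolding abs_mult C_def using C R by (intro mult_mono outer_bounds b3[unfolded C_def]) (auto simp: C_def)
    moreover have "\<bar>\<Sum>k\<in>UNIV. pd j (pd k (outer_cut R)) x * curl_pot R d i k x + pd k (outer_cut R) x * pd j (curl_pot R d i k) x\<bar>
        \<le> (\<Sum>k\<in>(UNIV::3 set). C / R^2 * (2 * \<kappa> / R^2 * m) + C / R * (2 * \<kappa> / R^3 * m))"
      by (rule order_trans[OF sum_abs sum_mono]) (rule t)
    ultimately show ?thesis unfolding outer_err_def by linarith
  qed
  also have "\<dots> = (12 * C + C^2) * (\<kappa> * m / R^4)"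
    using R by (simp add: field_simps eval_nat_numeral)
  also have "\<dots> \<le> (13 * C^2) * (\<kappa> * m / R^4)"
  proof (rule mult_right_mono)
    have "C * 1 \<le> C * C" using C by (intro mult_left_mono) auto
    then show "12 * C + C^2 \<le> 13 * C^2" by (simp add: power2_eq_square)
  qed (use k m R in simp)
  also have "\<dots> = err_const * inner_mass R / R^4"
    by (simp add: err_const_def C_def m_def \<kappa>_def)
  finally show ?thesis using True R by (simp add: annulus_def)
qed

end

lemma tail_integral_tendsto_zero:
  fixes f :: "'a::euclidean_space \<Rightarrow> real"
  assumes f: "integrable lborel f"
  shows "(\<lambda>n. LBINT x. indicator {x. real n \<le> norm x} x * f x) \<longlonglongrightarrow> 0"
proof -
  have [measurable]: "f \<in> borel_measurable borel" using f by auto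
  have "(\<lambda>n. LBINT x. indicator {x. real n \<le> norm x} x * f x) \<longlonglongrightarrow> (\<integral>x. 0 \<partial>(lborel::'a measure))"
  proof (rule integral_dominated_convergence[where w="\<lambda>x. \<bar>f x\<bar>"])
    show "AE x in lborel. (\<lambda>n. indicator {x. real n \<le> norm x} x * f x) \<longlonglongrightarrow> 0"
    proof (rule AE_I2, rule tendsto_eventually)
      fix x :: 'a
      obtain k where k: "norm x < real k" using reals_Archimedean2 by blast
      have "indicator {x. real n \<le> norm x} x * f x = 0" if "n \<ge> k" for n
        using k that by (simp add: indicator_def)
      then show "\<forall>\<^sub>F n in sequentially. indicator {x. real n \<le> norm x} x * f x = 0"
        unfolding eventually_sequentially by blast
    qed
  qed (use f in \<open>auto intro!: AE_I2 simp: indicator_def\<close>)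
  then show ?thesis by simp
qed

context steady_flow
begin

text \<open>Each of the nine pairs of indices has two boundary terms; \<open>4096\<close> collects the factors \<open>8\<^sup>3\<close> and \<open>2\<^sup>3\<close> from
  the volumes of the balls of radius \<open>8R\<close> and \<open>2R\<close>.\<close>

definition hess_const :: real where
  "hess_const = 1 + 18 * (cut_const * (1 / kernel_mass)^2 * ball_vol^2 * 4096)"

lemma cut_div_mass_square:
  assumes R: "R > 0"
  shows "(LBINT y. \<bar>cut_div R y\<bar>)^2 \<le> (LBINT y. (cut_div R y)^2) * (8 * ball_vol * R^3)"
proof -
  let ?I = "\<lambda>y::real^3. indicator (cball 0 (2 * R)) y :: real"
  have I: "in_Lp 2 ?I" using in_Lp_indicator_cball[of 2 1 "2 * R"] by simp
  have eq: "cut_div R y * ?I y = cut_div R y" for y using cut_div_support[OF R, of y] by (cases "norm y > 2 * R") auto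
  have "(LBINT y. \<bar>cut_div R y\<bar>) \<le> sqrt (LBINT y. (cut_div R y)^2) * sqrt (LBINT y. (?I y)^2)"
    using integral_abs_product_le[OF cut_div_L2[OF R] I] by (simp only: eq)
  also have "(LBINT y. (?I y)^2) = (LBINT y. ?I y)"
    by (intro Bochner_Integration.integral_cong) (auto simp: indicator_def)
  also have "\<dots> = 8 * ball_vol * R^3"
    using R by (simp add: measure_cball3 power_mult_distrib)
  finally have "(LBINT y. \<bar>cut_div R y\<bar>)^2 \<le> (sqrt (LBINT y. (cut_div R y)^2) * sqrt (8 * ball_vol * R^3))^2"
    by (intro power_mono) (auto intro!: integral_nonneg_AE)
  also have "\<dots> = (LBINT y. (cut_div R y)^2) * (8 * ball_vol * R^3)"
    using R ball_vol_pos by (simp add: power_mult_distrib integral_nonneg_AE)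
  finally show ?thesis .
qed

text \<open>The energy identity compares the Hessian with the Laplacian, which is a mollification of
  \<open>cut_div R\<close>. Its boundary terms live where the kernel is small: they are of order
  \<open>R\<^sup>-\<^sup>1 R\<^sup>-\<^sup>2 R\<^sup>-\<^sup>3 R\<^sup>3\<close> times the square of the integral of \<open>|cut_div R|\<close>, and the Cauchy-Schwarz inequality on the ball
  of radius \<open>2R\<close> compensates \<open>R\<^sup>-\<^sup>3\<close>.\<close>

lemma potential_hessian_bound:
  assumes R: "R > 0" and d: "d > 0"
  shows "(\<Sum>i\<in>UNIV. \<Sum>j\<in>UNIV. LBINT x. outer_cut R x * (pd i (pd j (potential R d)) x)^2)
    \<le> hess_const * (LBINT y. (cut_div R y)^2)"
proof -
  let ?g = "potential R d"
  define \<kappa> where "\<kappa> = 1 / kernel_mass"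
  define D where "D = (LBINT y. \<bar>cut_div R y\<bar>)"
  define Q where "Q = (LBINT y. (cut_div R y)^2)"
  define b where "b = cut_const * \<kappa>^2 * ball_vol^2 * 4096 * Q"
  have k: "\<kappa> > 0" using kernel_mass_pos by (simp add: \<kappa>_def)
  have D: "D \<ge> 0" unfolding D_def by (rule integral_nonneg_AE) simp
  have C: "cut_const > 0" using cut_const(1) by linarith
  have g: "smooth_fun ?g" by (rule potential_smooth[OF R d])
  have t: "outer_cut R \<in> test_functions" by (rule outer_test[OF R])
  have bd: "\<bar>LBINT x. pd l (outer_cut R) x * (pd m ?g x * pd i (pd j ?g) x)\<bar> \<le> b" for i j l m
  proof -
    have ti: "integrable lborel (\<lambda>x. pd l (outer_cut R) x * (pd m ?g x * pd i (pd j ?g) x))"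
      by (intro test_function_integrable test_function_mult test_pd t smooth_mult smooth_pd g)
    have "\<bar>LBINT x. pd l (outer_cut R) x * (pd m ?g x * pd i (pd j ?g) x)\<bar>
        \<le> (LBINT x. \<bar>pd l (outer_cut R) x * (pd m ?g x * pd i (pd j ?g) x)\<bar>)"
      using integral_norm_bound[of lborel "\<lambda>x. pd l (outer_cut R) x * (pd m ?g x * pd i (pd j ?g) x)"] by simp
    also have "\<dots> \<le> (cut_const / R * ((\<kappa> / R^2 * D) * (\<kappa> / R^3 * D))) * (ball_vol * (8 * R)^3)"
    proof (rule integral_indicator_cball_le)
      show "integrable lborel (\<lambda>x. \<bar>pd l (outer_cut R) x * (pd m ?g x * pd i (pd j ?g) x)\<bar>)" using ti by (rule integrable_abs)
      show "\<bar>pd l (outer_cut R) x * (pd m ?g x * pd i (pd j ?g) x)\<bar> \<le> 0" if "norm x > 8 * R" for x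
        using outer_flat(1)[OF R, of x] that by simp
      show "\<bar>pd l (outer_cut R) x * (pd m ?g x * pd i (pd j ?g) x)\<bar> \<le> cut_const / R * ((\<kappa> / R^2 * D) * (\<kappa> / R^3 * D))" for x
      proof (cases "4 * R \<le> norm x \<and> norm x \<le> 8 * R")
        case False
        then show ?thesis using outer_flat(1)[OF R False] C k D R by simp
      next
        case True
        then have x: "norm x \<ge> 4 * R" by simp
        have 1: "\<bar>pd m ?g x\<bar> \<le> \<kappa> / R^2 * D"
          unfolding pd_potential[OF R d] \<kappa>_def D_def
          by (rule far_kernel_bounds(1)[OF R d x cut_div_compact[OF R] cut_div_support[OF R]])
        have 2: "\<bar>pd i (pd j ?g) x\<bar> \<le> \<kappa> / R^3 * D"
          unfolding pd2_potential[OF R d] \<kappa>_def D_def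
          by (rule far_kernel_bounds(2)[OF R d x cut_div_compact[OF R] cut_div_support[OF R]])
        show ?thesis unfolding abs_mult
          using C k D R by (intro mult_mono outer_bounds 1 2 mult_nonneg_nonneg) auto
      qed
    qed (use R in simp)
    also have "\<dots> = (cut_const * \<kappa>^2 * ball_vol * 512 / R^3) * D^2"
      using R by (simp add: field_simps eval_nat_numeral)
    also have "\<dots> \<le> (cut_const * \<kappa>^2 * ball_vol * 512 / R^3) * (Q * (8 * ball_vol * R^3))"
      using cut_div_mass_square[OF R] C R ball_vol_pos unfolding D_def Q_def by (intro mult_left_mono) auto
    also have "\<dots> = b" using R by (simp add: b_def field_simps eval_nat_numeral)
    finally show ?thesis .
  qed
  have lap: "(\<Sum>i\<in>UNIV. \<Sum>j\<in>UNIV. LBINT x. outer_cut R x * (pd i (pd i ?g) x * pd j (pd j ?g) x)) \<le> Q"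
  proof -
    have ii: "integrable lborel (\<lambda>x. outer_cut R x * (pd i (pd i ?g) x * pd j (pd j ?g) x))" for i j
      by (intro test_function_integrable test_function_mult t smooth_mult smooth_pd g)
    have "(\<Sum>i\<in>UNIV. \<Sum>j\<in>UNIV. LBINT x. outer_cut R x * (pd i (pd i ?g) x * pd j (pd j ?g) x))
        = (LBINT x. (\<Sum>i\<in>UNIV. \<Sum>j\<in>UNIV. outer_cut R x * (pd i (pd i ?g) x * pd j (pd j ?g) x)))"
      using ii by (simp add: Bochner_Integration.integral_sum)
    also have "\<dots> = (LBINT x. outer_cut R x * (conv (md.scaled d) (cut_div R) x)^2)"
    proof (intro Bochner_Integration.integral_cong refl)
      fix x
      have "(\<Sum>i\<in>UNIV. pd i (pd i ?g) x) * (\<Sum>j\<in>UNIV. pd j (pd j ?g) x)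
          = (\<Sum>i\<in>UNIV. \<Sum>j\<in>UNIV. pd i (pd i ?g) x * pd j (pd j ?g) x)" by (rule sum_product)
      then have "(\<Sum>i\<in>UNIV. \<Sum>j\<in>UNIV. outer_cut R x * (pd i (pd i ?g) x * pd j (pd j ?g) x))
          = outer_cut R x * ((\<Sum>i\<in>UNIV. pd i (pd i ?g) x) * (\<Sum>j\<in>UNIV. pd j (pd j ?g) x))"
        by (simp only: sum_distrib_left[symmetric])
      then show "(\<Sum>i\<in>UNIV. \<Sum>j\<in>UNIV. outer_cut R x * (pd i (pd i ?g) x * pd j (pd j ?g) x)) = outer_cut R x * (conv (md.scaled d) (cut_div R) x)^2"
        by (simp add: laplacian_potential[OF R d] power2_eq_square)
    qed
    also have "\<dots> \<le> (LBINT x. \<bar>conv (md.scaled d) (cut_div R) x\<bar>^2)"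
    proof (rule integral_mono)
      show "integrable lborel (\<lambda>x. outer_cut R x * (conv (md.scaled d) (cut_div R) x)^2)"
        unfolding power2_eq_square
        by (intro test_function_integrable test_function_mult t smooth_mult smooth_conv smooth_scaled d cut_div_compact R)
      show "integrable lborel (\<lambda>x. \<bar>conv (md.scaled d) (cut_div R) x\<bar>^2)"
        by (rule in_Lp_integrable[OF md.conv_in_Lp(1)[OF cut_div_compact[OF R] d _ cut_div_L2[OF R]]]) simp
      show "outer_cut R x * (conv (md.scaled d) (cut_div R) x)^2 \<le> \<bar>conv (md.scaled d) (cut_div R) x\<bar>^2" for x
        using mult_right_mono[OF cutoff_at_le_1[of "4 * R" x], of "(conv (md.scaled d) (cut_div R) x)^2"] by (simp add: outer_cut_def)
    qed
    also have "\<dots> \<le> (LBINT x. \<bar>cut_div R x\<bar>^2)"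
      by (rule md.conv_in_Lp(2)[OF cut_div_compact[OF R] d _ cut_div_L2[OF R]]) simp
    finally show ?thesis by (simp add: Q_def)
  qed
  have "(\<Sum>i\<in>UNIV. \<Sum>j\<in>UNIV. LBINT x. outer_cut R x * (pd i (pd j ?g) x)^2)
      = (\<Sum>i\<in>UNIV. \<Sum>j\<in>UNIV. (LBINT x. outer_cut R x * (pd i (pd i ?g) x * pd j (pd j ?g) x))
        + ((LBINT x. pd j (outer_cut R) x * (pd j ?g x * pd i (pd i ?g) x)) - (LBINT x. pd i (outer_cut R) x * (pd j ?g x * pd i (pd j ?g) x))))"
    using hessian_energy_identity[OF g t] by (intro sum.cong refl) (simp add: algebra_simps)
  also have "\<dots> \<le> (\<Sum>i\<in>UNIV. \<Sum>j\<in>UNIV. (LBINT x. outer_cut R x * (pd i (pd i ?g) x * pd j (pd j ?g) x)) + 2 * b)"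
  proof (intro sum_mono add_left_mono)
    fix i j
    show "(LBINT x. pd j (outer_cut R) x * (pd j ?g x * pd i (pd i ?g) x))
        - (LBINT x. pd i (outer_cut R) x * (pd j ?g x * pd i (pd j ?g) x)) \<le> 2 * b"
      using bd[where l=j and m=j and i=i and j=i] bd[where l=i and m=j and i=i and j=j] unfolding abs_le_iff by linarith
  qed
  also have "\<dots> = (\<Sum>i\<in>UNIV. \<Sum>j\<in>UNIV. LBINT x. outer_cut R x * (pd i (pd i ?g) x * pd j (pd j ?g) x)) + 18 * b"
    by (simp add: sum.distrib)
  also have "\<dots> \<le> Q + 18 * b" using lap by simp
  also have "\<dots> = hess_const * Q" by (simp add: hess_const_def b_def \<kappa>_def algebra_simps)
  finally show ?thesis by (simp add: Q_def)
qed

subsection \<open>The energy inequality at scale \<open>R\<close>\<close>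

definition moment :: "nat \<Rightarrow> real \<Rightarrow> real" where
  "moment q R = (LBINT x. indicator (annulus R) x * speed x ^ q)"

definition fourth_moment :: "real \<Rightarrow> real" where
  "fourth_moment R = (LBINT x. indicator (cball 0 (8 * R)) x * speed x ^ 4)"

definition dissipation :: real where
  "dissipation = (\<Sum>i\<in>UNIV. \<Sum>j\<in>UNIV. LBINT x. (G i j x)^2)"

lemma annulus_subset: "annulus R \<subseteq> cball 0 (8 * R)" by (auto simp: annulus_def)

lemma moment_integrable: "0 < q \<Longrightarrow> q \<le> 6 \<Longrightarrow> integrable lborel (\<lambda>x. indicator (annulus R) x * speed x ^ q)"
  by (rule speed_power_integrable[OF annulus_borel annulus_subset])

lemma moment_nonneg: "moment q R \<ge> 0"
  unfolding moment_def by (rule integral_nonneg_AE) (simp add: speed_nonneg)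

lemma fourth_moment_nonneg: "fourth_moment R \<ge> 0"
  unfolding fourth_moment_def by (rule integral_nonneg_AE) (simp add: speed_nonneg)

lemma G_le_dissipation: "(LBINT x. (G i j x)^2) \<le> dissipation"
proof -
  have nn: "(LBINT x. (G i j x)^2) \<ge> 0" for i j by (rule integral_nonneg_AE) simp
  have "(LBINT x. (G i j x)^2) \<le> (\<Sum>j\<in>UNIV. LBINT x. (G i j x)^2)"
    by (rule member_le_sum[where f="\<lambda>j. LBINT x. (G i j x)^2"]) (auto intro: nn)
  also have "\<dots> \<le> dissipation" unfolding dissipation_def
    by (rule member_le_sum[where f="\<lambda>i. \<Sum>j\<in>UNIV. LBINT x. (G i j x)^2"]) (auto intro!: sum_nonneg nn)
  finally show ?thesis .
qed

lemma dissipation_nonneg: "dissipation \<ge> 0"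
  unfolding dissipation_def by (intro sum_nonneg integral_nonneg_AE) simp

lemma annulus_speed_L2: "in_Lp 2 (\<lambda>x. indicator (annulus R) x * speed x)"
  by (rule loc_Lp_mult_bounded[OF loc_Lp_mono[OF in_Lp_imp_loc_Lp[OF speed_L6]], of _ _ 1 "8 * R"])
    (use annulus_subset in \<open>auto simp: indicator_def annulus_def\<close>)

lemma annulus_speed_square: "(LBINT x. (indicator (annulus R) x * speed x)^2) = moment 2 R"
  unfolding moment_def by (intro Bochner_Integration.integral_cong) (auto simp: indicator_def)

lemma pd_cutoff_speed_bound:
  assumes R: "R > 0"
  shows "\<bar>pd j (cutoff_at R) x\<bar> \<le> cut_const / R * indicator (annulus R) x"
proof (cases "x \<in> annulus R")
  case True then show ?thesis using cut_const(2)[OF R] by simp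
next
  case False
  then consider "norm x < R" | "norm x > 2 * R" using R by (auto simp: annulus_def)
  then have "pd j (cutoff_at R) x = 0" using R by cases (simp_all add: partial_cutoff_at_inner partial_cutoff_at_outer)
  then show ?thesis using False by simp
qed

lemma cut_div_square_le: assumes R: "R > 0" shows "(LBINT y. (cut_div R y)^2) \<le> (cut_const / R)^2 * moment 2 R"
proof -
  have "(LBINT y. (cut_div R y)^2) \<le> (LBINT y. (cut_const / R)^2 * (indicator (annulus R) y * speed y ^ 2))"
  proof (rule integral_mono)
    show "integrable lborel (\<lambda>y. (cut_div R y)^2)" using in_Lp_integrable[OF cut_div_L2[OF R]] by simp
    show "integrable lborel (\<lambda>y. (cut_const / R)^2 * (indicator (annulus R) y * speed y ^ 2))"
      by (intro integrable_mult_right moment_integrable) auto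
    show "(cut_div R y)^2 \<le> (cut_const / R)^2 * (indicator (annulus R) y * speed y ^ 2)" for y
    proof -
      have "\<bar>cut_div R y\<bar> \<le> cut_const / R * (indicator (annulus R) y * speed y)"
        by (rule order_trans[OF cut_div_le[OF R]]) (use cut_const(1) R speed_nonneg in \<open>auto intro!: mult_left_mono simp: indicator_def\<close>)
      then have "\<bar>cut_div R y\<bar>^2 \<le> (cut_const / R * (indicator (annulus R) y * speed y))^2" by (intro power_mono) auto
      also have "\<dots> = (cut_const / R)^2 * (indicator (annulus R) y * speed y ^ 2)"
        by (cases "y \<in> annulus R") (simp_all add: power_mult_distrib power_divide)
      finally show ?thesis by simp
    qed
  qed
  then show ?thesis by (simp add: moment_def)
qed

lemma flux_le: "\<bar>flux i j x\<bar> \<le> \<bar>G i j x\<bar> + speed x ^ 2"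
proof -
  have "\<bar>u i x * u j x\<bar> \<le> speed x * speed x" unfolding abs_mult by (intro mult_mono u_le_speed) (auto simp: speed_nonneg)
  then show ?thesis unfolding flux_def power2_eq_square by linarith
qed

lemma flux_annulus_L1:
  assumes R: "R > 0"
  shows "integrable lborel (\<lambda>x. indicator (annulus R) x * \<bar>flux i j x\<bar>)"
    and "(LBINT x. indicator (annulus R) x * \<bar>flux i j x\<bar>) \<le> sqrt dissipation * sqrt (512 * ball_vol * R^3) + moment 2 R"
proof -
  let ?I = "\<lambda>y::real^3. indicator (annulus R) y :: real"
  have I: "in_Lp 2 ?I" by (rule in_Lp_bounded_support[of _ 1 "8 * R"]) (auto simp: indicator_def annulus_def)
  have i1: "integrable lborel (\<lambda>x. \<bar>G i j x * ?I x\<bar>)" by (intro integrable_abs integrable_product_L2 G2 I)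
  have i2: "integrable lborel (\<lambda>x. ?I x * speed x ^ 2)" by (rule moment_integrable) auto
  have le: "?I x * \<bar>flux i j x\<bar> \<le> \<bar>G i j x * ?I x\<bar> + ?I x * speed x ^ 2" for x
    using flux_le[of i j x] by (simp add: indicator_def)
  show i3: "integrable lborel (\<lambda>x. ?I x * \<bar>flux i j x\<bar>)"
    by (rule Bochner_Integration.integrable_bound[OF Bochner_Integration.integrable_add[OF i1 i2]])
      (use le flux_loc[of i j] in \<open>auto simp: loc_Lp_def indicator_def intro!: AE_I2\<close>)
  have "(LBINT x. ?I x * \<bar>flux i j x\<bar>) \<le> (LBINT x. \<bar>G i j x * ?I x\<bar> + ?I x * speed x ^ 2)"
    by (intro integral_mono i3 Bochner_Integration.integrable_add i1 i2 le)
  also have "\<dots> = (LBINT x. \<bar>G i j x * ?I x\<bar>) + moment 2 R" using i1 i2 by (simp add: moment_def)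
  also have "(LBINT x. \<bar>G i j x * ?I x\<bar>) \<le> sqrt (LBINT x. (G i j x)^2) * sqrt (LBINT x. (?I x)^2)"
    by (rule integral_abs_product_le[OF G2 I])
  also have "\<dots> \<le> sqrt dissipation * sqrt (512 * ball_vol * R^3)"
  proof (intro mult_mono real_sqrt_le_mono G_le_dissipation)
    have "(LBINT x. (?I x)^2) \<le> 1 * (ball_vol * (8 * R)^3)"
      by (rule integral_indicator_cball_le) (use in_Lp_integrable[OF I] R in \<open>auto simp: indicator_def annulus_def power_le_one\<close>)
    then show "(LBINT x. (?I x)^2) \<le> 512 * ball_vol * R^3" by (simp add: power_mult_distrib algebra_simps)
  qed (auto simp: dissipation_nonneg intro!: integral_nonneg_AE)
  finally show "(LBINT x. ?I x * \<bar>flux i j x\<bar>) \<le> sqrt dissipation * sqrt (512 * ball_vol * R^3) + moment 2 R" by simp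
qed

lemma flux_ball_L2:
  shows "in_Lp 2 (\<lambda>x. indicator (cball 0 (8 * R)) x * flux i j x)"
    and "(LBINT x. (indicator (cball 0 (8 * R)) x * flux i j x)^2) \<le> 2 * dissipation + 2 * fourth_moment R"
proof -
  let ?I = "\<lambda>y::real^3. indicator (cball 0 (8 * R)) y :: real"
  show 1: "in_Lp 2 (\<lambda>x. ?I x * flux i j x)" using flux_loc[of i j] by (simp add: loc_Lp_def)
  have i1: "integrable lborel (\<lambda>x. (G i j x)^2)" using in_Lp_integrable[OF G2, of i j] by simp
  have i2: "integrable lborel (\<lambda>x. ?I x * speed x ^ 4)" by (rule speed_power_integrable[of _ "8 * R"]) auto
  have "(LBINT x. (?I x * flux i j x)^2) \<le> (LBINT x. 2 * (G i j x)^2 + 2 * (?I x * speed x ^ 4))"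
  proof (rule integral_mono)
    show "integrable lborel (\<lambda>x. (?I x * flux i j x)^2)" using in_Lp_integrable[OF 1] by simp
    show "integrable lborel (\<lambda>x. 2 * (G i j x)^2 + 2 * (?I x * speed x ^ 4))" using i1 i2 by simp
    show "(?I x * flux i j x)^2 \<le> 2 * (G i j x)^2 + 2 * (?I x * speed x ^ 4)" for x
    proof (cases "x \<in> cball 0 (8 * R)")
      case True
      have "(flux i j x)^2 \<le> (\<bar>G i j x\<bar> + speed x ^ 2)^2" using flux_le[of i j x] by (metis abs_ge_zero power2_abs power_mono)
      also have "\<dots> \<le> 2 * \<bar>G i j x\<bar>^2 + 2 * (speed x ^ 2)^2"
        using sum_squares_bound[of "\<bar>G i j x\<bar>" "speed x ^ 2"] by (simp add: power2_sum)
      finally show ?thesis using True by (simp flip: power_mult)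
    qed simp
  qed
  also have "\<dots> = 2 * (LBINT x. (G i j x)^2) + 2 * fourth_moment R" using i1 i2 by (simp add: fourth_moment_def)
  also have "\<dots> \<le> 2 * dissipation + 2 * fourth_moment R" using G_le_dissipation by simp
  finally show "(LBINT x. (?I x * flux i j x)^2) \<le> 2 * dissipation + 2 * fourth_moment R" .
qed

definition error_at :: "real \<Rightarrow> real" where
  "error_at R = err_const * inner_mass R / R^4 * (sqrt dissipation * sqrt (512 * ball_vol * R^3) + moment 2 R)
     + sqrt (2 * dissipation + 2 * fourth_moment R) * sqrt (hess_const * ((cut_const / R)^2 * moment 2 R))"

lemma hess_const_nonneg: "hess_const \<ge> 0"
  using cut_const(1) by (simp add: hess_const_def)

lemma error_term_bound:
  assumes R: "R > 0" and d: "d > 0"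
  shows "\<bar>LBINT x. flux i j x * (outer_err R d i j x + outer_cut R x * pd j (pd i (potential R d)) x)\<bar> \<le> error_at R"
proof -
  let ?H = "\<lambda>x. pd j (pd i (potential R d)) x"
  let ?I = "\<lambda>y::real^3. indicator (cball 0 (8 * R)) y :: real"
  have g: "smooth_fun (potential R d)" by (rule potential_smooth[OF R d])
  have te: "(\<lambda>x. outer_err R d i j x) \<in> test_functions"
    unfolding outer_err_def
    by (intro test_function_add test_function_sum test_function_mult test_pd outer_test smooth_pd curl_pot_smooth potential_smooth R d)
  have tH: "(\<lambda>x. outer_cut R x * ?H x) \<in> test_functions" by (intro test_function_mult outer_test smooth_pd g R)
  have i: "integrable lborel (\<lambda>x. flux i j x * outer_err R d i j x)" "integrable lborel (\<lambda>x. flux i j x * (outer_cut R x * ?H x))"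
    by (rule flux_test_integrable[OF te], rule flux_test_integrable[OF tH])
  define c where "c = err_const * inner_mass R / R^4"
  have c: "c \<ge> 0" using kernel_mass_pos inner_mass_nonneg R by (simp add: c_def err_const_def)
  have 1: "\<bar>LBINT x. flux i j x * outer_err R d i j x\<bar> \<le> c * (sqrt dissipation * sqrt (512 * ball_vol * R^3) + moment 2 R)"
  proof -
    have "\<bar>LBINT x. flux i j x * outer_err R d i j x\<bar> \<le> (LBINT x. \<bar>flux i j x * outer_err R d i j x\<bar>)"
      using integral_norm_bound[of lborel "\<lambda>x. flux i j x * outer_err R d i j x"] by simp
    also have "\<dots> \<le> (LBINT x. c * (indicator (annulus R) x * \<bar>flux i j x\<bar>))"
    proof (rule integral_mono)
      show "integrable lborel (\<lambda>x. c * (indicator (annulus R) x * \<bar>flux i j x\<bar>))"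
        by (intro integrable_mult_right flux_annulus_L1 R)
      show "\<bar>flux i j x * outer_err R d i j x\<bar> \<le> c * (indicator (annulus R) x * \<bar>flux i j x\<bar>)" for x
      proof -
        have "\<bar>outer_err R d i j x\<bar> \<le> c * indicator (annulus (4 * R) \<inter> cball 0 (8 * R)) x"
          unfolding c_def by (rule outer_err_bound[OF R d])
        also have "\<dots> \<le> c * indicator (annulus R) x" using c R by (intro mult_left_mono) (auto simp: indicator_def annulus_def)
        finally have "\<bar>outer_err R d i j x\<bar> \<le> c * indicator (annulus R) x" .
        from mult_left_mono[OF this, of "\<bar>flux i j x\<bar>"] show ?thesis by (simp add: abs_mult mult_ac)
      qed
    qed (use i in auto)
    also have "\<dots> = c * (LBINT x. indicator (annulus R) x * \<bar>flux i j x\<bar>)" by simp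
    also have "\<dots> \<le> c * (sqrt dissipation * sqrt (512 * ball_vol * R^3) + moment 2 R)"
      by (intro mult_left_mono flux_annulus_L1 R c)
    finally show ?thesis .
  qed
  have HL: "in_Lp 2 (\<lambda>x. outer_cut R x * ?H x)"
  proof -
    obtain r where "\<And>x. norm x > r \<Longrightarrow> outer_cut R x * ?H x = 0" using test_function_support[OF tH] by metis
    moreover obtain B where "\<And>x. \<bar>outer_cut R x * ?H x\<bar> \<le> B" using test_function_bounded[OF tH] by metis
    ultimately show ?thesis by (intro in_Lp_bounded_support[of _ B r] smooth_borel test_function_smooth tH) auto
  qed
  have H2: "(LBINT x. (outer_cut R x * ?H x)^2) \<le> hess_const * ((cut_const / R)^2 * moment 2 R)"
  proof -
    have nn: "(LBINT x. outer_cut R x * (pd i (pd j (potential R d)) x)^2) \<ge> 0" for i j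
      by (rule integral_nonneg_AE) (simp add: outer_cut_def cutoff_at_nonneg)
    have "(LBINT x. (outer_cut R x * ?H x)^2) \<le> (LBINT x. outer_cut R x * (?H x)^2)"
    proof (rule integral_mono)
      show "integrable lborel (\<lambda>x. (outer_cut R x * ?H x)^2)" using in_Lp_integrable[OF HL] by simp
      show "integrable lborel (\<lambda>x. outer_cut R x * (?H x)^2)" unfolding power2_eq_square
        by (intro test_function_integrable test_function_mult outer_test smooth_mult smooth_pd g R)
      show "(outer_cut R x * ?H x)^2 \<le> outer_cut R x * (?H x)^2" for x
      proof -
        have "outer_cut R x * outer_cut R x \<le> outer_cut R x * 1"
          unfolding outer_cut_def by (intro mult_left_mono cutoff_at_le_1 cutoff_at_nonneg)
        from mult_right_mono[OF this, of "(?H x)^2"] show ?thesis by (simp add: power2_eq_square mult_ac)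
      qed
    qed
    also have "\<dots> \<le> (\<Sum>i\<in>UNIV. LBINT x. outer_cut R x * (pd j (pd i (potential R d)) x)^2)"
      by (rule member_le_sum[where f="\<lambda>i. LBINT x. outer_cut R x * (pd j (pd i (potential R d)) x)^2"]) (auto intro: nn)
    also have "\<dots> \<le> (\<Sum>j\<in>UNIV. \<Sum>i\<in>UNIV. LBINT x. outer_cut R x * (pd j (pd i (potential R d)) x)^2)"
      by (rule member_le_sum[where f="\<lambda>j. \<Sum>i\<in>UNIV. LBINT x. outer_cut R x * (pd j (pd i (potential R d)) x)^2"])
        (auto intro!: sum_nonneg nn)
    also have "\<dots> \<le> hess_const * (LBINT y. (cut_div R y)^2)" by (rule potential_hessian_bound[OF R d])
    also have "\<dots> \<le> hess_const * ((cut_const / R)^2 * moment 2 R)"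
      by (intro mult_left_mono cut_div_square_le R hess_const_nonneg)
    finally show ?thesis .
  qed
  have 2: "\<bar>LBINT x. flux i j x * (outer_cut R x * ?H x)\<bar>
      \<le> sqrt (2 * dissipation + 2 * fourth_moment R) * sqrt (hess_const * ((cut_const / R)^2 * moment 2 R))"
  proof -
    have "flux i j x * (outer_cut R x * ?H x) = (?I x * flux i j x) * (outer_cut R x * ?H x)" for x
    proof (cases "norm x \<le> 8 * R")
      case False
      then show ?thesis using R by (simp add: outer_cut_def cutoff_at_0)
    qed simp
    then have "\<bar>LBINT x. flux i j x * (outer_cut R x * ?H x)\<bar> = \<bar>LBINT x. (?I x * flux i j x) * (outer_cut R x * ?H x)\<bar>" by presburger
    also have "\<dots> \<le> sqrt (LBINT x. (?I x * flux i j x)^2) * sqrt (LBINT x. (outer_cut R x * ?H x)^2)"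
      by (rule abs_integral_product_le[OF flux_ball_L2(1) HL])
    also have "\<dots> \<le> sqrt (2 * dissipation + 2 * fourth_moment R) * sqrt (hess_const * ((cut_const / R)^2 * moment 2 R))"
      by (intro mult_mono real_sqrt_le_mono flux_ball_L2(2) H2)
        (auto intro!: integral_nonneg_AE simp: dissipation_nonneg fourth_moment_nonneg)
    finally show ?thesis .
  qed
  have "(LBINT x. flux i j x * (outer_err R d i j x + outer_cut R x * ?H x))
      = (LBINT x. flux i j x * outer_err R d i j x) + (LBINT x. flux i j x * (outer_cut R x * ?H x))"
    using i by (simp add: distrib_left)
  then show ?thesis using 1 2 unfolding error_at_def c_def by linarith
qed

text \<open>There are nine pairs of indices, and each pair contributes at most one of every kind of term.\<close>

lemma energy_at_scale:
  assumes R: "R > 0"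
  shows "(\<Sum>i\<in>UNIV. \<Sum>j\<in>UNIV. LBINT x. cutoff_at R x * (G i j x)^2)
    \<le> 9 * error_at R + 9 * (cut_const / R * (sqrt dissipation * sqrt (moment 2 R))) + 9 * (cut_const / R * moment 3 R)"
proof -
  let ?\<phi> = "cutoff_at R :: real^3 \<Rightarrow> real"
  have t: "?\<phi> \<in> test_functions" by (rule inner_test[OF R])
  have C: "cut_const / R \<ge> 0" using cut_const(1) R by simp
  have W: "\<bar>\<Sum>i\<in>UNIV. \<Sum>j\<in>UNIV. LBINT x. flux i j x * (outer_err R d i j x + outer_cut R x * pd j (pd i (potential R d)) x)\<bar> \<le> 9 * error_at R"
    if d: "d > 0" for d
  proof -
    have "\<bar>\<Sum>i\<in>UNIV. \<Sum>j\<in>UNIV. LBINT x. flux i j x * (outer_err R d i j x + outer_cut R x * pd j (pd i (potential R d)) x)\<bar>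
        \<le> (\<Sum>i\<in>(UNIV::3 set). \<Sum>j\<in>(UNIV::3 set). error_at R)"
      by (intro order_trans[OF sum_abs] sum_mono error_term_bound R d)
    then show ?thesis by simp
  qed
  note main = flux_limit[OF R W, unfolded flux_main_term[OF t]]
  have T1: "\<bar>LBINT x. G i j x * (pd j ?\<phi> x * u i x)\<bar> \<le> cut_const / R * (sqrt dissipation * sqrt (moment 2 R))" for i j
  proof -
    have L: "in_Lp 2 (\<lambda>x. indicator (annulus R) x * speed x)" by (rule annulus_speed_L2)
    have i1: "integrable lborel (\<lambda>x. G i j x * (pd j ?\<phi> x * u i x))"
      by (intro integrable_product_L2 G2 loc_Lp_mult_test[OF u_loc] test_pd t) auto
    have "\<bar>LBINT x. G i j x * (pd j ?\<phi> x * u i x)\<bar> \<le> (LBINT x. \<bar>G i j x * (pd j ?\<phi> x * u i x)\<bar>)"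
      using integral_norm_bound[of lborel "\<lambda>x. G i j x * (pd j ?\<phi> x * u i x)"] by simp
    also have "\<dots> \<le> (LBINT x. cut_const / R * \<bar>G i j x * (indicator (annulus R) x * speed x)\<bar>)"
    proof (rule integral_mono)
      show "integrable lborel (\<lambda>x. cut_const / R * \<bar>G i j x * (indicator (annulus R) x * speed x)\<bar>)"
        by (intro integrable_mult_right integrable_abs integrable_product_L2 G2 L)
      show "\<bar>G i j x * (pd j ?\<phi> x * u i x)\<bar> \<le> cut_const / R * \<bar>G i j x * (indicator (annulus R) x * speed x)\<bar>" for x
      proof -
        have "\<bar>pd j ?\<phi> x\<bar> * \<bar>u i x\<bar> \<le> (cut_const / R * indicator (annulus R) x) * speed x"
          using C by (intro mult_mono pd_cutoff_speed_bound R u_le_speed mult_nonneg_nonneg) auto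
        from mult_left_mono[OF this, of "\<bar>G i j x\<bar>"] show ?thesis by (simp add: abs_mult speed_nonneg mult_ac)
      qed
    qed (use i1 in auto)
    also have "\<dots> = cut_const / R * (LBINT x. \<bar>G i j x * (indicator (annulus R) x * speed x)\<bar>)" by simp
    also have "\<dots> \<le> cut_const / R * (sqrt (LBINT x. (G i j x)^2) * sqrt (LBINT x. (indicator (annulus R) x * speed x)^2))"
      by (intro mult_left_mono integral_abs_product_le G2 L C)
    also have "\<dots> \<le> cut_const / R * (sqrt dissipation * sqrt (moment 2 R))"
      unfolding annulus_speed_square by (intro mult_left_mono mult_right_mono real_sqrt_le_mono G_le_dissipation C) (auto simp: moment_nonneg)
    finally show ?thesis .
  qed
  have T2: "\<bar>LBINT x. (u i x)^2 * u j x * pd j ?\<phi> x\<bar> \<le> cut_const / R * moment 3 R" for i j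
  proof -
    have "\<bar>LBINT x. (u i x)^2 * u j x * pd j ?\<phi> x\<bar> \<le> (LBINT x. cut_const / R * (indicator (annulus R) x * speed x ^ 3))"
    proof (rule order_trans[OF integral_abs_bound])
      have int: "integrable lborel (\<lambda>x. cut_const / R * (indicator (annulus R) x * speed x ^ 3))"
        by (intro integrable_mult_right moment_integrable) auto
      have le: "\<bar>(u i x)^2 * u j x * pd j ?\<phi> x\<bar> \<le> cut_const / R * (indicator (annulus R) x * speed x ^ 3)" for x
      proof -
        have "\<bar>u i x\<bar>^2 * \<bar>u j x\<bar> * \<bar>pd j ?\<phi> x\<bar> \<le> speed x ^ 2 * speed x * (cut_const / R * indicator (annulus R) x)"
          using C by (intro mult_mono power_mono pd_cutoff_speed_bound R u_le_speed mult_nonneg_nonneg) (auto simp: speed_nonneg)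
        also have "\<dots> = cut_const / R * (indicator (annulus R) x * speed x ^ 3)" by (simp add: eval_nat_numeral mult_ac)
        finally show ?thesis by (simp add: abs_mult)
      qed
      have m: "pd j ?\<phi> \<in> borel_measurable borel" by (intro smooth_borel smooth_pd smooth_cutoff_at)
      show "(LBINT x. \<bar>(u i x)^2 * u j x * pd j ?\<phi> x\<bar>) \<le> (LBINT x. cut_const / R * (indicator (annulus R) x * speed x ^ 3))"
      proof (rule integral_mono[OF _ int le])
        note [measurable] = m
        show "integrable lborel (\<lambda>x. \<bar>(u i x)^2 * u j x * pd j ?\<phi> x\<bar>)"
        proof (rule Bochner_Integration.integrable_bound[OF int])
          show "AE x in lborel. norm \<bar>(u i x)^2 * u j x * pd j ?\<phi> x\<bar> \<le> norm (cut_const / R * (indicator (annulus R) x * speed x ^ 3))"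
            unfolding real_norm_def abs_idempotent by (rule AE_I2, rule order_trans[OF le abs_ge_self])
        qed measurable
      qed
    qed
    then show ?thesis by (simp add: moment_def)
  qed
  have S1: "\<bar>\<Sum>i\<in>UNIV. \<Sum>j\<in>UNIV. LBINT x. G i j x * (pd j ?\<phi> x * u i x)\<bar> \<le> 9 * (cut_const / R * (sqrt dissipation * sqrt (moment 2 R)))"
  proof -
    have "\<bar>\<Sum>i\<in>UNIV. \<Sum>j\<in>UNIV. LBINT x. G i j x * (pd j ?\<phi> x * u i x)\<bar>
        \<le> (\<Sum>i\<in>(UNIV::3 set). \<Sum>j\<in>(UNIV::3 set). cut_const / R * (sqrt dissipation * sqrt (moment 2 R)))"
      by (intro order_trans[OF sum_abs] sum_mono T1)
    then show ?thesis by simp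
  qed
  have S2: "\<bar>\<Sum>i\<in>UNIV. \<Sum>j\<in>UNIV. LBINT x. (u i x)^2 * u j x * pd j ?\<phi> x\<bar> \<le> 9 * (cut_const / R * moment 3 R)"
  proof -
    have "\<bar>\<Sum>i\<in>UNIV. \<Sum>j\<in>UNIV. LBINT x. (u i x)^2 * u j x * pd j ?\<phi> x\<bar>
        \<le> (\<Sum>i\<in>(UNIV::3 set). \<Sum>j\<in>(UNIV::3 set). cut_const / R * moment 3 R)"
      by (intro order_trans[OF sum_abs] sum_mono T2)
    then show ?thesis by simp
  qed
  have "cut_const / R * moment 3 R \<ge> 0" using C moment_nonneg by (intro mult_nonneg_nonneg)
  then show ?thesis using main S1 S2 by linarith
qed

end

section \<open>Decay along growing scales\<close>

text \<open>A substitute for Hoelder's inequality: after integration over a set of finite measure the parameter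
  \<open>\<tau>\<close> balances the two terms.\<close>

lemma power_le_scaled_powr:
  fixes t \<tau> :: real
  assumes t: "t \<ge> 0" and \<tau>: "\<tau> > 0" and q: "q \<le> 4"
  shows "t ^ q \<le> \<tau> ^ q * (1 + \<tau> powr (- 9/2) * t powr (9/2))"
proof (cases "t \<le> \<tau>")
  case True
  have "t ^ q \<le> \<tau> ^ q * 1" using True t by (simp add: power_mono)
  also have "\<dots> \<le> \<tau> ^ q * (1 + \<tau> powr (- 9/2) * t powr (9/2))" using \<tau> by (intro mult_left_mono) auto
  finally show ?thesis .
next
  case False
  then have tp: "t > 0" and r: "t / \<tau> \<ge> 1" using \<tau> by auto
  have "(t / \<tau>) ^ q = (t / \<tau>) powr (real q)" using tp \<tau> by (simp add: powr_realpow)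
  also have "\<dots> \<le> (t / \<tau>) powr (9/2)" using r q by (intro powr_mono) auto
  also have "\<dots> = \<tau> powr (- 9/2) * t powr (9/2)"
    using tp \<tau> by (simp add: powr_divide powr_minus_divide)
  finally have "(t / \<tau>) ^ q \<le> 1 + \<tau> powr (- 9/2) * t powr (9/2)" by simp
  from mult_left_mono[OF this, of "\<tau> ^ q"] show ?thesis using \<tau> by (simp add: power_divide)
qed

text \<open>First \<open>\<sigma>\<close> is chosen to make the constant term small, then the index \<open>m\<close>.\<close>

lemma vanishing_by_scaling:
  fixes X a :: "nat \<Rightarrow> real"
  assumes X0: "\<And>m. X m \<ge> 0" and c: "c \<ge> 0" and q: "q > 0" and a: "a \<longlonglongrightarrow> 0"
    and le: "\<And>m \<sigma>. \<sigma> > 0 \<Longrightarrow> X m \<le> \<sigma> ^ q * (\<sigma> powr (- 9/2) * a m + c)"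
  shows "X \<longlonglongrightarrow> 0"
proof (rule LIMSEQ_I)
  fix e :: real assume e: "e > 0"
  define \<sigma> where "\<sigma> = min 1 (e / (2 * (c + 1)))"
  have \<sigma>: "\<sigma> > 0" "\<sigma> \<le> 1" using e c by (auto simp: \<sigma>_def)
  have "\<sigma> ^ q \<le> \<sigma> ^ 1" using \<sigma> q by (intro power_decreasing) auto
  then have "\<sigma> ^ q * c \<le> \<sigma> * c" using c by (intro mult_right_mono) auto
  also have "\<dots> \<le> e / (2 * (c + 1)) * c" using c by (intro mult_right_mono) (auto simp: \<sigma>_def)
  also have "\<dots> < e / 2" using e c by (simp add: field_simps)
  finally have 1: "\<sigma> ^ q * c < e / 2" .
  have "(\<lambda>m. \<sigma> ^ q * (\<sigma> powr (- 9/2) * a m)) \<longlonglongrightarrow> \<sigma> ^ q * (\<sigma> powr (- 9/2) * 0)"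
    by (intro tendsto_mult tendsto_const a)
  then have "(\<lambda>m. \<sigma> ^ q * (\<sigma> powr (- 9/2) * a m)) \<longlonglongrightarrow> 0" by simp
  then obtain m0 where m0: "\<And>m. m \<ge> m0 \<Longrightarrow> norm (\<sigma> ^ q * (\<sigma> powr (- 9/2) * a m) - 0) < e / 2"
    using LIMSEQ_D[of _ 0 "e/2"] e by (metis half_gt_zero)
  show "\<exists>m0. \<forall>m\<ge>m0. norm (X m - 0) < e"
  proof (intro exI allI impI)
    fix m assume "m \<ge> m0"
    then have "\<sigma> ^ q * (\<sigma> powr (- 9/2) * a m) < e / 2" using m0[of m] by (simp add: abs_less_iff)
    then have "X m < e" using le[OF \<sigma>(1), of m] 1 by (simp add: distrib_left)
    then show "norm (X m - 0) < e" using X0[of m] by simp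
  qed
qed

text \<open>A function whose weak derivative in one direction vanishes pairs equally with a test function and
  with all translates of it in that direction; integrability makes the pairing with far translates
  small.\<close>

lemma weakly_constant_L6_zero:
  fixes f :: "real^3 \<Rightarrow> real"
  assumes f: "in_Lp 6 f" and w: "weak_partial j f (\<lambda>_. 0)"
  shows "AE x in lborel. f x = 0"
proof (rule fundamental_lemma)
  have fl: "loc_Lp 1 f" by (rule loc_Lp_mono[OF in_Lp_imp_loc_Lp[OF f]]) auto
  then show "loc_Lp 1 f" .
  have zl: "loc_Lp 1 (\<lambda>_::real^3. 0)" by (simp add: loc_Lp_def in_Lp_def)
  note [measurable] = loc_Lp_borel[OF fl]
  fix h :: "real^3 \<Rightarrow> real" assume h: "h \<in> test_functions"
  obtain r where r: "r > 0" "\<And>x. norm x > r \<Longrightarrow> h x = 0" using test_function_support[OF h] by metis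
  obtain B where B: "B > 0" "\<And>x. \<bar>h x\<bar> \<le> B" using test_function_bounded[OF h] by metis
  have hs: "smooth_fun h" by (rule test_function_smooth[OF h])
  have hm [measurable]: "h \<in> borel_measurable borel" by (rule smooth_borel[OF hs])
  let ?e = "axis j 1 :: real^3"
  have ne: "norm ?e = 1" by simp
  define I where "I = (LBINT y. f y * h y)"
  have shift: "I = (LBINT y. f y * h (y - T *\<^sub>R ?e))" if T: "T > 0" for T
  proof -
    define \<theta> where "\<theta> = (cutoff_at (r + T + 1) :: real^3 \<Rightarrow> real)"
    define K where "K z = h (- z)" for z
    have \<theta>: "\<theta> \<in> test_functions" unfolding \<theta>_def using r T by (intro cutoff_at_test) auto
    have Ks: "smooth_fun K" unfolding K_def[abs_def] using smooth_affine[OF hs, of 0 "-1"] by simp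
    have c: "compact_L1 (\<lambda>y. \<theta> y * f y)" by (rule compact_L1_test_mult[OF fl \<theta>])
    have supp: "K (t *\<^sub>R ?e - y) = 0" if "0 \<le> t" "t \<le> T" "norm y > r + T" for t y
    proof -
      have "norm y \<le> norm (y - t *\<^sub>R ?e) + norm (t *\<^sub>R ?e)" using norm_triangle_ineq[of "y - t *\<^sub>R ?e" "t *\<^sub>R ?e"] by simp
      then have "norm (y - t *\<^sub>R ?e) > r" using that ne by simp
      then show ?thesis using r(2) by (simp add: K_def)
    qed
    have val: "conv K (\<lambda>y. \<theta> y * f y) (t *\<^sub>R ?e) = (LBINT y. f y * h (y - t *\<^sub>R ?e))" if "0 \<le> t" "t \<le> T" for t
      unfolding conv_def
    proof (intro Bochner_Integration.integral_cong refl)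
      fix y
      show "K (t *\<^sub>R ?e - y) * (\<theta> y * f y) = f y * h (y - t *\<^sub>R ?e)"
      proof (cases "norm y > r + T")
        case True
        then show ?thesis using supp[OF that True] by (simp add: K_def)
      next
        case False
        then have "\<theta> y = 1" unfolding \<theta>_def using r T by (intro cutoff_at_1) auto
        then show ?thesis by (simp add: K_def)
      qed
    qed
    have der: "conv (pd j K) (\<lambda>y. \<theta> y * f y) (t *\<^sub>R ?e) = 0" if "0 \<le> t" "t \<le> T" for t
    proof -
      have z0: "K (t *\<^sub>R ?e - y) * (\<theta> y * 0 + pd j \<theta> y * f y) = 0" for y
      proof (cases "norm y > r + T")
        case True then show ?thesis using supp[OF that True] by simp
      next
        case False
        then have "pd j \<theta> y = 0" unfolding \<theta>_def using r T by (intro partial_cutoff_at_inner) auto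
        then show ?thesis by simp
      qed
      have "conv K (\<lambda>y. \<theta> y * 0 + pd j \<theta> y * f y) (t *\<^sub>R ?e) = 0"
        unfolding conv_def z0 by simp
      then show ?thesis using conv_weak_partial[OF w fl zl \<theta> Ks, of "t *\<^sub>R ?e"] by simp
    qed
    obtain z where z: "0 < z" "z < T" "conv K (\<lambda>y. \<theta> y * f y) (0 + T *\<^sub>R ?e) - conv K (\<lambda>y. \<theta> y * f y) (0 + 0 *\<^sub>R ?e)
        = (T - 0) * pd j (conv K (\<lambda>y. \<theta> y * f y)) (0 + z *\<^sub>R ?e)"
      using MVT2[OF T partial_along_line[OF smooth_conv[OF Ks c], of 0 ?e]] by blast
    have "conv K (\<lambda>y. \<theta> y * f y) (T *\<^sub>R ?e) = conv K (\<lambda>y. \<theta> y * f y) (0 *\<^sub>R ?e)"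
      using z der[of z] by (simp add: pd_conv[OF Ks c])
    then show ?thesis using val[of T] val[of 0] T by (simp add: I_def)
  qed
  have f6: "integrable lborel (\<lambda>x. \<bar>f x\<bar> ^ 6)" by (rule in_Lp_integrable[OF f])
  define tail where "tail m = (LBINT x. indicator {x. real m \<le> norm x} x * \<bar>f x\<bar> ^ 6)" for m
  have tail: "tail \<longlonglongrightarrow> 0" unfolding tail_def[abs_def] by (rule tail_integral_tendsto_zero[OF f6])
  have bound: "\<bar>I\<bar> \<le> B * (\<tau> * (ball_vol * r ^ 3)) + B / \<tau> ^ 5 * tail m" if \<tau>: "\<tau> > 0" for \<tau> m
  proof -
    \<comment> \<open>The translated support lies outside the ball of radius \<open>m\<close>.\<close>
    define T where "T = r + real m"
    have T: "T > 0" using r by (simp add: T_def)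
    let ?J = "\<lambda>y. indicator (cball 0 r) (- (T *\<^sub>R ?e) + y) :: real"
    let ?L = "\<lambda>y. indicator {x. real m \<le> norm x} y * \<bar>f y\<bar> ^ 6"
    have Ji: "integrable lborel (\<lambda>x. indicator (cball (0::real^3) r) x :: real)"
      by (intro integrable_real_indicator emeasure_bounded_finite) auto
    have J: "integrable lborel ?J" by (rule integrable_shift[OF Ji])
    have JI: "(LBINT y. ?J y) = ball_vol * r ^ 3"
      using integral_shift[of "\<lambda>x. indicator (cball (0::real^3) r) x :: real" "- (T *\<^sub>R ?e)"] r by (simp add: measure_cball3)
    have L: "integrable lborel ?L"
      by (rule Bochner_Integration.integrable_bound[OF f6]) (auto intro!: AE_I2 simp: indicator_def)
    have pt: "\<bar>f y * h (y - T *\<^sub>R ?e)\<bar> \<le> B * (\<tau> * ?J y) + B / \<tau> ^ 5 * ?L y" for y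
    proof (cases "norm (y - T *\<^sub>R ?e) > r")
      case True
      have "0 \<le> B * (\<tau> * ?J y) + B / \<tau> ^ 5 * ?L y" using B \<tau> by (intro add_nonneg_nonneg mult_nonneg_nonneg) auto
      then show ?thesis using r(2)[OF True] by simp
    next
      case False
      have "norm (T *\<^sub>R ?e) \<le> norm y + norm (y - T *\<^sub>R ?e)" using norm_triangle_ineq4[of y "y - T *\<^sub>R ?e"] by simp
      then have m: "real m \<le> norm y" using False T by (simp add: T_def)
      have J1: "?J y = 1" using False by (simp add: indicator_def norm_minus_commute)
      have "\<bar>f y\<bar> \<le> \<tau> + \<bar>f y\<bar> ^ 6 / \<tau> ^ 5"
      proof (cases "\<bar>f y\<bar> \<le> \<tau>")
        case False
        then have "\<tau> ^ 5 \<le> \<bar>f y\<bar> ^ 5" using \<tau> by (intro power_mono) auto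
        then have "\<bar>f y\<bar> * \<tau> ^ 5 \<le> \<bar>f y\<bar> * \<bar>f y\<bar> ^ 5" by (intro mult_left_mono) auto
        then have "\<bar>f y\<bar> \<le> \<bar>f y\<bar> ^ 6 / \<tau> ^ 5" using \<tau> by (simp add: field_simps eval_nat_numeral)
        then show ?thesis using \<tau> by linarith
      qed (use \<tau> in \<open>simp add: add_increasing2\<close>)
      from mult_mono[OF this B(2)[of "y - T *\<^sub>R ?e"]] have "\<bar>f y * h (y - T *\<^sub>R ?e)\<bar> \<le> (\<tau> + \<bar>f y\<bar> ^ 6 / \<tau> ^ 5) * B"
        using \<tau> by (simp add: abs_mult)
      then show ?thesis unfolding J1 using m by (simp add: algebra_simps)
    qed
    have int: "integrable lborel (\<lambda>y. B * (\<tau> * ?J y) + B / \<tau> ^ 5 * ?L y)"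
      by (intro Bochner_Integration.integrable_add integrable_mult_right J L)
    have "\<bar>I\<bar> \<le> (LBINT y. \<bar>f y * h (y - T *\<^sub>R ?e)\<bar>)"
      unfolding shift[OF T] by (rule integral_abs_bound)
    also have "\<dots> \<le> (LBINT y. B * (\<tau> * ?J y) + B / \<tau> ^ 5 * ?L y)"
    proof (rule integral_mono[OF _ int pt])
      show "integrable lborel (\<lambda>y. \<bar>f y * h (y - T *\<^sub>R ?e)\<bar>)"
      proof (rule Bochner_Integration.integrable_bound[OF int])
        show "AE y in lborel. norm \<bar>f y * h (y - T *\<^sub>R ?e)\<bar> \<le> norm (B * (\<tau> * ?J y) + B / \<tau> ^ 5 * ?L y)"
          unfolding real_norm_def abs_idempotent by (rule AE_I2, rule order_trans[OF pt abs_ge_self])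
      qed measurable
    qed
    also have "\<dots> = B * (\<tau> * (LBINT y. ?J y)) + B / \<tau> ^ 5 * tail m"
      using J L unfolding tail_def by simp
    finally show ?thesis unfolding JI .
  qed
  have le: "\<bar>I\<bar> \<le> B * (\<tau> * (ball_vol * r ^ 3))" if \<tau>: "\<tau> > 0" for \<tau>
  proof -
    have "(\<lambda>m. B * (\<tau> * (ball_vol * r ^ 3)) + B / \<tau> ^ 5 * tail m) \<longlonglongrightarrow> B * (\<tau> * (ball_vol * r ^ 3)) + B / \<tau> ^ 5 * 0"
      by (intro tendsto_add tendsto_mult tendsto_const tail)
    then show ?thesis using LIMSEQ_le_const[of _ _ "\<bar>I\<bar>"] bound[OF \<tau>] by fastforce
  qed
  have "\<bar>I\<bar> \<le> 0 + e" if e: "e > 0" for e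
  proof -
    define p where "p = B * (ball_vol * r ^ 3)"
    have p: "p > 0" using B r ball_vol_pos by (simp add: p_def)
    have "\<bar>I\<bar> \<le> B * (e / p * (ball_vol * r ^ 3))" using e p by (intro le) simp
    also have "\<dots> = e / p * p" by (simp add: p_def)
    finally show ?thesis using p by simp
  qed
  then have "\<bar>I\<bar> \<le> 0" by (rule field_le_epsilon)
  then show "(LBINT x. f x * h x) = 0" by (simp add: I_def)
qed

context steady_flow
begin

text \<open>The scales \<open>R = n\<^sup>3\<close> make the fractional powers of \<open>R\<close> in Hoelder's inequality
  natural powers of \<open>n\<close>.\<close>

lemma speed_power_scaling:
  assumes u92: "integrable lborel (\<lambda>x. speed x powr (9/2))"
    and S: "S \<in> sets borel" "S \<subseteq> cball 0 (8 * n^3)" and n: "n > 0" and \<sigma>: "\<sigma> > 0" and q: "0 < q" "q \<le> 4"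
  shows "(LBINT x. indicator S x * speed x ^ q)
    \<le> (\<sigma> / n^2) ^ q * n^9 * (\<sigma> powr (- 9/2) * (LBINT x. indicator S x * speed x powr (9/2)) + 512 * ball_vol)"
proof -
  define \<tau> where "\<tau> = \<sigma> / n^2"
  have \<tau>: "\<tau> > 0" using n \<sigma> by (simp add: \<tau>_def)
  have "(n^2) powr (- 9/2) = (n powr 2) powr (- 9/2)" using n by (simp add: powr_numeral)
  also have "\<dots> = n powr (- 9)" by (simp add: powr_powr)
  also have "\<dots> = 1 / n^9" using n by (simp add: powr_minus_divide powr_numeral)
  finally have n9: "(n^2) powr (- 9/2) = 1 / n^9" .
  have "\<tau> powr (- 9/2) = \<sigma> powr (- 9/2) / (n^2) powr (- 9/2)" unfolding \<tau>_def by (rule powr_divide)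
  then have \<tau>p: "\<tau> powr (- 9/2) = \<sigma> powr (- 9/2) * n^9" unfolding n9 by simp
  note [measurable] = S(1)
  let ?S = "indicator S :: real^3 \<Rightarrow> real"
  have i1: "integrable lborel (\<lambda>x. ?S x * speed x powr (9/2))"
    by (rule Bochner_Integration.integrable_bound[OF u92]) (auto intro!: AE_I2 simp: indicator_def)
  have i2: "integrable lborel ?S"
  proof -
    have "bounded S" using S(2) bounded_cball bounded_subset by blast
    then show ?thesis by (intro integrable_real_indicator emeasure_bounded_finite) auto
  qed
  have vol: "(LBINT x. ?S x) \<le> 1 * (ball_vol * (8 * n^3)^3)"
    by (rule integral_indicator_cball_le[OF i2]) (use n S(2) in \<open>auto simp: indicator_def\<close>)
  have "(LBINT x. ?S x * speed x ^ q) \<le> (LBINT x. \<tau> ^ q * (?S x + \<tau> powr (- 9/2) * (?S x * speed x powr (9/2))))"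
  proof (rule integral_mono)
    show "integrable lborel (\<lambda>x. ?S x * speed x ^ q)" using q by (intro speed_power_integrable[OF S]) auto
    show "integrable lborel (\<lambda>x. \<tau> ^ q * (?S x + \<tau> powr (- 9/2) * (?S x * speed x powr (9/2))))"
      by (intro integrable_mult_right Bochner_Integration.integrable_add i1 i2)
    show "?S x * speed x ^ q \<le> \<tau> ^ q * (?S x + \<tau> powr (- 9/2) * (?S x * speed x powr (9/2)))" for x
      using power_le_scaled_powr[OF speed_nonneg[of x] \<tau> q(2)] by (simp add: indicator_def)
  qed
  also have "\<dots> = \<tau> ^ q * ((LBINT x. ?S x) + \<tau> powr (- 9/2) * (LBINT x. ?S x * speed x powr (9/2)))"
    using i1 i2 by simp
  also have "\<dots> \<le> \<tau> ^ q * (1 * (ball_vol * (8 * n^3)^3) + \<tau> powr (- 9/2) * (LBINT x. ?S x * speed x powr (9/2)))"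
    using \<tau> vol by (intro mult_left_mono add_right_mono) auto
  also have "\<dots> = (\<sigma> / n^2) ^ q * n^9 * (\<sigma> powr (- 9/2) * (LBINT x. ?S x * speed x powr (9/2)) + 512 * ball_vol)"
    unfolding \<tau>p unfolding \<tau>_def by (simp add: power_mult_distrib algebra_simps flip: power_mult)
  finally show ?thesis .
qed

text \<open>The annuli move to infinity, so the integrals of \<open>speed\<close> to the power \<open>9/2\<close> over them tend to zero.\<close>

lemma normalised_moment_vanishes:
  assumes u92: "integrable lborel (\<lambda>x. speed x powr (9/2))" and q: "0 < q" "q \<le> 4"
  shows "(\<lambda>m. moment q (real (Suc m) ^ 3) * real (Suc m) ^ (2 * q) / real (Suc m) ^ 9) \<longlonglongrightarrow> 0"
proof (rule vanishing_by_scaling[where c="512 * ball_vol" and q=q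
      and a="\<lambda>m. LBINT x. indicator (annulus (real (Suc m) ^ 3)) x * speed x powr (9/2)"])
  show "0 \<le> moment q (real (Suc m) ^ 3) * real (Suc m) ^ (2 * q) / real (Suc m) ^ 9" for m
    using moment_nonneg by simp
  show "(\<lambda>m. LBINT x. indicator (annulus (real (Suc m) ^ 3)) x * speed x powr (9/2)) \<longlonglongrightarrow> 0"
  proof (rule tendsto_zero_dominated)
    show "(\<lambda>m. LBINT x. indicator {x. real (Suc m) \<le> norm x} x * speed x powr (9/2)) \<longlonglongrightarrow> 0"
      using tail_integral_tendsto_zero[OF u92] by (rule LIMSEQ_Suc)
    fix m
    show "0 \<le> (LBINT x. indicator (annulus (real (Suc m) ^ 3)) x * speed x powr (9/2))"
      by (rule integral_nonneg_AE) simp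
    show "(LBINT x. indicator (annulus (real (Suc m) ^ 3)) x * speed x powr (9/2))
        \<le> (LBINT x. indicator {x. real (Suc m) \<le> norm x} x * speed x powr (9/2))"
    proof (rule integral_mono)
      show "integrable lborel (\<lambda>x. indicator (annulus (real (Suc m) ^ 3)) x * speed x powr (9/2))"
        by (rule Bochner_Integration.integrable_bound[OF u92]) (auto intro!: AE_I2 simp: indicator_def)
      show "integrable lborel (\<lambda>x. indicator {x. real (Suc m) \<le> norm x} x * speed x powr (9/2))"
        by (rule Bochner_Integration.integrable_bound[OF u92]) (auto intro!: AE_I2 simp: indicator_def)
      have "real (Suc m) ^ 1 \<le> real (Suc m) ^ 3" by (intro power_increasing) auto
      then have "annulus (real (Suc m) ^ 3) \<subseteq> {x. real (Suc m) \<le> norm x}" by (auto simp: annulus_def)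
      then show "indicator (annulus (real (Suc m) ^ 3)) x * speed x powr (9/2) \<le> indicator {x. real (Suc m) \<le> norm x} x * speed x powr (9/2)" for x
        by (auto simp: indicator_def)
    qed
  qed
  fix m and \<sigma> :: real assume \<sigma>: "\<sigma> > 0"
  let ?n = "real (Suc m)"
  have n: "?n > 0" by simp
  let ?a = "LBINT x. indicator (annulus (?n ^ 3)) x * speed x powr (9/2)"
  have "moment q (?n ^ 3) \<le> (\<sigma> / ?n^2) ^ q * ?n^9 * (\<sigma> powr (- 9/2) * ?a + 512 * ball_vol)"
    unfolding moment_def by (rule speed_power_scaling[OF u92 annulus_borel annulus_subset n \<sigma> q])
  then have "moment q (?n ^ 3) * ?n ^ (2 * q) / ?n ^ 9
      \<le> (\<sigma> / ?n^2) ^ q * ?n^9 * (\<sigma> powr (- 9/2) * ?a + 512 * ball_vol) * ?n ^ (2 * q) / ?n ^ 9"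
    by (intro divide_right_mono mult_right_mono) auto
  also have "\<dots> = ((\<sigma> / ?n^2) ^ q * ?n ^ (2 * q)) * (\<sigma> powr (- 9/2) * ?a + 512 * ball_vol)"
    using n by (simp del: of_nat_Suc)
  also have "(\<sigma> / ?n^2) ^ q * ?n ^ (2 * q) = \<sigma> ^ q"
    using n by (simp add: power_divide power_mult del: of_nat_Suc)
  finally show "moment q (?n ^ 3) * ?n ^ (2 * q) / ?n ^ 9 \<le> \<sigma> ^ q * (\<sigma> powr (- 9/2) * ?a + 512 * ball_vol)" .
qed (use ball_vol_pos q in auto)

text \<open>With \<open>R = n\<^sup>3\<close> the mass on a ball is at most of order \<open>n\<^sup>7\<close> and the fourth moment of order \<open>n\<close>, while
  \<open>n\<^sup>-\<^sup>5\<close> and \<open>n\<^sup>-\<^sup>3\<close> times the second and third moment on the annulus tend to zero.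
  The powers of \<open>n\<close> in \<open>energy_at_scale\<close> then add up to at most zero.\<close>

lemma energy_vanishes:
  assumes u92: "integrable lborel (\<lambda>x. speed x powr (9/2))"
  shows "(\<lambda>m. \<Sum>i\<in>UNIV. \<Sum>j\<in>UNIV. LBINT x. cutoff_at (real (Suc m) ^ 3) x * (G i j x)^2) \<longlonglongrightarrow> 0"
proof -
  define n where "n m = real (Suc m)" for m
  define x2 where "x2 m = moment 2 (n m ^ 3) / n m ^ 5" for m
  define x3 where "x3 m = moment 3 (n m ^ 3) / n m ^ 3" for m
  define K where "K = (LBINT x. speed x powr (9/2)) + 512 * ball_vol"
  define C where "C = cut_const"
  define D where "D = dissipation"
  define h where "h = hess_const"
  have n: "n m \<ge> 1" "n m > 0" for m by (auto simp: n_def)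
  have pos: "C \<ge> 0" "D \<ge> 0" "h \<ge> 0" "err_const \<ge> 0"
    using cut_const(1) dissipation_nonneg hess_const_nonneg kernel_mass_pos by (auto simp: C_def D_def h_def err_const_def)
  have K: "K \<ge> 0" unfolding K_def using ball_vol_pos by (intro add_nonneg_nonneg integral_nonneg_AE) auto
  have x2: "x2 \<longlonglongrightarrow> 0"
  proof -
    have "moment 2 (n m ^ 3) * n m ^ (2 * 2) / n m ^ 9 = x2 m" for m
      using n(2)[of m] by (simp add: x2_def field_simps eval_nat_numeral)
    then show ?thesis using normalised_moment_vanishes[OF u92, of 2] by (simp add: n_def[symmetric] del: of_nat_Suc)
  qed
  have x3: "x3 \<longlonglongrightarrow> 0"
  proof -
    have "moment 3 (n m ^ 3) * n m ^ (2 * 3) / n m ^ 9 = x3 m" for m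
      using n(2)[of m] by (simp add: x3_def field_simps eval_nat_numeral)
    then show ?thesis using normalised_moment_vanishes[OF u92, of 3] by (simp add: n_def[symmetric] del: of_nat_Suc)
  qed
  have x2nn: "x2 m \<ge> 0" for m using moment_nonneg n(2)[of m] by (simp add: x2_def)
  have m2: "moment 2 (n m ^ 3) = n m ^ 5 * x2 m" for m using n(2)[of m] by (simp add: x2_def)
  have m3: "moment 3 (n m ^ 3) = n m ^ 3 * x3 m" for m using n(2)[of m] by (simp add: x3_def)
  have ball: "(LBINT x. indicator (cball 0 r) x * speed x ^ q) \<le> (1 / n m ^ 2) ^ q * n m ^ 9 * K"
    if "r \<le> 8 * n m ^ 3" "0 < q" "q \<le> 4" for q m r
  proof -
    have "(LBINT x. indicator (cball 0 r) x * speed x ^ q)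
      \<le> (1 / n m ^ 2) ^ q * n m ^ 9 * (1 powr (- 9/2) * (LBINT x. indicator (cball 0 r) x * speed x powr (9/2)) + 512 * ball_vol)"
      by (rule speed_power_scaling[OF u92]) (use that n in auto)
    also have "\<dots> \<le> (1 / n m ^ 2) ^ q * n m ^ 9 * K"
    proof (rule mult_left_mono)
      have "(LBINT x. indicator (cball 0 r) x * speed x powr (9/2)) \<le> (LBINT x. speed x powr (9/2))"
        by (rule integral_mono[OF _ u92], rule Bochner_Integration.integrable_bound[OF u92])
          (auto intro!: AE_I2 simp: indicator_def)
      then show "1 powr (- 9/2) * (LBINT x. indicator (cball 0 r) x * speed x powr (9/2)) + 512 * ball_vol \<le> K"
        by (simp add: K_def)
    qed (use n(2)[of m] in simp)
    finally show ?thesis .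
  qed
  have mass: "inner_mass (n m ^ 3) \<le> n m ^ 7 * K" for m
    using ball[of "2 * n m ^ 3" m 1] n(2)[of m] by (simp add: inner_mass_def field_simps eval_nat_numeral)
  have fourth: "fourth_moment (n m ^ 3) \<le> n m * K" for m
    using ball[of "8 * n m ^ 3" m 4] n(2)[of m] by (simp add: fourth_moment_def field_simps eval_nat_numeral)
  define bnd where "bnd m = 9 * (err_const * K * (sqrt D * (sqrt (512 * ball_vol) * sqrt (1 / n m)) + x2 m)
      + sqrt ((2 * D + 2 * K) * (h * C^2 * x2 m))) + 9 * (C * (sqrt D * sqrt (x2 m))) + 9 * (C * x3 m)" for m
  have le: "(\<Sum>i\<in>UNIV. \<Sum>j\<in>UNIV. LBINT x. cutoff_at (n m ^ 3) x * (G i j x)^2) \<le> bnd m" for m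
  proof -
    let ?n = "n m"
    have np: "?n > 0" "?n \<ge> 1" using n by auto
    have R: "?n ^ 3 > 0" using np by simp
    have e1: "err_const * inner_mass (?n^3) / (?n^3)^4 * (sqrt D * sqrt (512 * ball_vol * (?n^3)^3) + moment 2 (?n^3))
        \<le> err_const * K * (sqrt D * (sqrt (512 * ball_vol) * sqrt (1 / ?n)) + x2 m)"
    proof -
      have s: "sqrt (512 * ball_vol * (?n^3)^3) = ?n^5 * (sqrt (512 * ball_vol) * sqrt (1 / ?n))"
      proof -
        have "512 * ball_vol * (?n^3)^3 = (?n^5)^2 * (512 * ball_vol * (1 / ?n))"
          using np by (simp add: field_simps eval_nat_numeral)
        then have "sqrt (512 * ball_vol * (?n^3)^3) = sqrt ((?n^5)^2) * (sqrt (512 * ball_vol) * sqrt (1 / ?n))"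
          by (simp only: real_sqrt_mult)
        also have "sqrt ((?n^5)^2) = ?n^5" using np by (subst real_sqrt_abs) simp
        finally show ?thesis .
      qed
      have "err_const * inner_mass (?n^3) / (?n^3)^4 * (sqrt D * sqrt (512 * ball_vol * (?n^3)^3) + moment 2 (?n^3))
          = err_const * inner_mass (?n^3) / (?n^3)^4 * ?n^5 * (sqrt D * (sqrt (512 * ball_vol) * sqrt (1 / ?n)) + x2 m)"
        unfolding s m2 by (simp add: algebra_simps add_divide_distrib)
      also have "\<dots> \<le> err_const * (?n^7 * K) / (?n^3)^4 * ?n^5 * (sqrt D * (sqrt (512 * ball_vol) * sqrt (1 / ?n)) + x2 m)"
        using pos ball_vol_pos np x2nn mass by (intro mult_right_mono divide_right_mono mult_left_mono add_nonneg_nonneg mult_nonneg_nonneg) auto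
      also have "err_const * (?n^7 * K) / (?n^3)^4 * ?n^5 = err_const * K"
        using np by (simp add: field_simps eval_nat_numeral)
      finally show ?thesis .
    qed
    have e2: "sqrt (2 * D + 2 * fourth_moment (?n^3)) * sqrt (h * ((C / ?n^3)^2 * moment 2 (?n^3)))
        \<le> sqrt ((2 * D + 2 * K) * (h * C^2 * x2 m))"
    proof -
      have a: "h * ((C / ?n^3)^2 * moment 2 (?n^3)) = (h * C^2 * x2 m) / ?n"
        unfolding m2 using np by (simp add: field_simps eval_nat_numeral)
      have "2 * D + 2 * fourth_moment (?n^3) \<le> ?n * (2 * D + 2 * K)"
      proof -
        have "1 * (2 * D) \<le> ?n * (2 * D)" using np pos by (intro mult_right_mono) auto
        then show ?thesis using fourth[of m] by (simp add: algebra_simps)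
      qed
      then have "(2 * D + 2 * fourth_moment (?n^3)) * ((h * C^2 * x2 m) / ?n) \<le> (?n * (2 * D + 2 * K)) * ((h * C^2 * x2 m) / ?n)"
        using pos x2nn[of m] np by (intro mult_right_mono) auto
      also have "\<dots> = (2 * D + 2 * K) * (h * C^2 * x2 m)" using np by simp
      finally show ?thesis unfolding a real_sqrt_mult[symmetric] by (rule real_sqrt_le_mono)
    qed
    have e3: "C / ?n^3 * (sqrt D * sqrt (moment 2 (?n^3))) \<le> C * (sqrt D * sqrt (x2 m))"
    proof -
      have "sqrt (moment 2 (?n^3)) \<le> sqrt ((?n^3)^2 * x2 m)"
      proof (rule real_sqrt_le_mono)
        have "?n^5 \<le> ?n^6" using np by (intro power_increasing) auto
        then have "?n^5 \<le> (?n^3)^2" by (simp flip: power_mult)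
        then show "moment 2 (?n^3) \<le> (?n^3)^2 * x2 m" unfolding m2 by (intro mult_right_mono x2nn)
      qed
      also have "\<dots> = ?n^3 * sqrt (x2 m)" using np by (simp only: real_sqrt_mult real_sqrt_abs) simp
      finally have "C / ?n^3 * (sqrt D * sqrt (moment 2 (?n^3))) \<le> C / ?n^3 * (sqrt D * (?n^3 * sqrt (x2 m)))"
        using pos np by (intro mult_left_mono) auto
      then show ?thesis using np by simp
    qed
    have e4: "C / ?n^3 * moment 3 (?n^3) = C * x3 m" unfolding m3 using np by simp
    have "(\<Sum>i\<in>UNIV. \<Sum>j\<in>UNIV. LBINT x. cutoff_at (?n ^ 3) x * (G i j x)^2)
        \<le> 9 * error_at (?n^3) + 9 * (C / ?n^3 * (sqrt D * sqrt (moment 2 (?n^3)))) + 9 * (C / ?n^3 * moment 3 (?n^3))"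
      using energy_at_scale[OF R] unfolding C_def D_def .
    also have "\<dots> \<le> bnd m"
      unfolding error_at_def bnd_def C_def[symmetric] D_def[symmetric] h_def[symmetric]
      by (intro add_mono mult_left_mono e1 e2 e3 eq_refl[OF e4]) auto
    finally show ?thesis .
  qed
  have inv: "(\<lambda>m. 1 / n m) \<longlonglongrightarrow> 0"
    using LIMSEQ_inverse_real_of_nat by (simp add: n_def inverse_eq_divide)
  have "bnd \<longlonglongrightarrow> 9 * (err_const * K * (sqrt D * (sqrt (512 * ball_vol) * sqrt 0) + 0)
      + sqrt ((2 * D + 2 * K) * (h * C^2 * 0))) + 9 * (C * (sqrt D * sqrt 0)) + 9 * (C * 0)"
    unfolding bnd_def[abs_def]
    by (intro tendsto_add tendsto_mult tendsto_const tendsto_real_sqrt inv x2 x3)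
  then have "bnd \<longlonglongrightarrow> 0" by simp
  then have "(\<lambda>m. \<Sum>i\<in>UNIV. \<Sum>j\<in>UNIV. LBINT x. cutoff_at (n m ^ 3) x * (G i j x)^2) \<longlonglongrightarrow> 0"
    by (rule tendsto_zero_dominated[rotated 2]) (auto intro!: le sum_nonneg integral_nonneg_AE simp: cutoff_at_nonneg)
  then show ?thesis by (simp add: n_def)
qed

lemma gradient_zero:
  assumes u92: "integrable lborel (\<lambda>x. speed x powr (9/2))"
  shows "AE x in lborel. G i j x = 0"
proof -
  have ball: "AE x in lborel. indicator (cball 0 (real k)) x * (G i j x)^2 = 0" for k
  proof -
    have gi: "integrable lborel (\<lambda>x. (G i j x)^2)" for i j using in_Lp_integrable[OF G2, of i j] by simp
    have ci: "integrable lborel (\<lambda>x. cutoff_at R x * (G i j x)^2)" for R i j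
    proof (rule Bochner_Integration.integrable_bound[OF gi[of i j]])
      have [measurable]: "cutoff_at R \<in> borel_measurable (borel :: (real^3) measure)" by (intro smooth_borel smooth_cutoff_at)
      show "(\<lambda>x. cutoff_at R x * (G i j x)^2) \<in> borel_measurable lborel" by measurable
      show "AE x in lborel. norm (cutoff_at R x * (G i j x)^2) \<le> norm ((G i j x)^2)"
        using mult_right_mono[OF cutoff_at_le_1, of "(G i j _)^2" R] by (intro AE_I2) (simp add: abs_mult cutoff_at_nonneg)
    qed
    have bi: "integrable lborel (\<lambda>x. indicator (cball 0 (real k)) x * (G i j x)^2)"
      by (rule Bochner_Integration.integrable_bound[OF gi[of i j]]) (auto intro!: AE_I2 simp: indicator_def)
    have nn: "0 \<le> (LBINT x. cutoff_at R x * (G i j x)^2)" for R i j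
      by (rule integral_nonneg_AE) (simp add: cutoff_at_nonneg)
    have "(LBINT x. indicator (cball 0 (real k)) x * (G i j x)^2) \<le> 0"
    proof (rule LIMSEQ_le_const[OF energy_vanishes[OF u92]], intro exI allI impI)
      fix m assume m: "m \<ge> k"
      let ?R = "real (Suc m) ^ 3"
      have R: "?R > 0" by simp
      have "real (Suc m) ^ 1 \<le> ?R" by (intro power_increasing) auto
      then have kR: "real k \<le> ?R" using m by simp
      have "(LBINT x. indicator (cball 0 (real k)) x * (G i j x)^2) \<le> (LBINT x. cutoff_at ?R x * (G i j x)^2)"
      proof (rule integral_mono[OF bi ci])
        show "indicator (cball 0 (real k)) x * (G i j x)^2 \<le> cutoff_at ?R x * (G i j x)^2" for x
          using kR cutoff_at_1[OF R, of x] cutoff_at_nonneg[of ?R x] by (intro mult_right_mono) (auto simp: indicator_def)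
      qed
      also have "\<dots> \<le> (\<Sum>j\<in>UNIV. LBINT x. cutoff_at ?R x * (G i j x)^2)"
        by (rule member_le_sum[where f="\<lambda>j. LBINT x. cutoff_at ?R x * (G i j x)^2"]) (auto intro: nn)
      also have "\<dots> \<le> (\<Sum>i\<in>UNIV. \<Sum>j\<in>UNIV. LBINT x. cutoff_at ?R x * (G i j x)^2)"
        by (rule member_le_sum[where f="\<lambda>i. \<Sum>j\<in>UNIV. LBINT x. cutoff_at ?R x * (G i j x)^2"]) (auto intro!: sum_nonneg nn)
      finally show "(LBINT x. indicator (cball 0 (real k)) x * (G i j x)^2)
          \<le> (\<Sum>i\<in>UNIV. \<Sum>j\<in>UNIV. LBINT x. cutoff_at ?R x * (G i j x)^2)" .
    qed
    moreover have "(LBINT x. indicator (cball 0 (real k)) x * (G i j x)^2) \<ge> 0" by (rule integral_nonneg_AE) simp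
    ultimately have "(LBINT x. indicator (cball 0 (real k)) x * (G i j x)^2) = 0" by simp
    then show ?thesis by (subst (asm) integral_nonneg_eq_0_iff_AE[OF bi]) auto
  qed
  then have "AE x in lborel. \<forall>k. indicator (cball 0 (real k)) x * (G i j x)^2 = 0" unfolding AE_all_countable by blast
  then show ?thesis
  proof eventually_elim
    case (elim x)
    obtain k where "norm x \<le> real k" using real_arch_simple by blast
    then show ?case using elim[rule_format, of k] by simp
  qed
qed

theorem velocity_zero:
  assumes u92: "integrable lborel (\<lambda>x. speed x powr (9/2))"
  shows "AE x in lborel. u i x = 0"
proof (rule weakly_constant_L6_zero[OF u6])
  show "weak_partial 1 (u i) (\<lambda>_. 0)"
    unfolding weak_partial_def
  proof
    fix \<phi> :: "real^3 \<Rightarrow> real" assume \<phi>: "\<phi> \<in> test_functions"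
    have "(LBINT x. G i 1 x * \<phi> x) = 0"
      by (rule integral_eq_zero_AE) (use gradient_zero[OF u92, of i 1] in eventually_elim, simp)
    then show "(LBINT x. u i x * pd 1 \<phi> x) = - (LBINT x. 0 * \<phi> x)"
      using weak[of 1 i] \<phi> by (simp add: weak_partial_def)
  qed
qed

end

section \<open>Integrability of the velocity to the power \<open>9/2\<close>\<close>

text \<open>Where \<open>t \<ge> r\<^bsup>-10/9\<^esup>\<close> the excess exponent costs at most a factor \<open>r\<^bsup>(5/3) R0/r\<^esup>\<close>, which is
  bounded; elsewhere \<open>t\<^bsup>9/2\<^esup>\<close> is at most \<open>r\<^sup>-\<^sup>5\<close>. The power \<open>-10/9\<close> is chosen to produce the integrable \<open>r\<^sup>-\<^sup>5\<close>.\<close>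

lemma powr_le_variable_exponent:
  fixes t r R0 :: real
  assumes t: "t \<ge> 0" and R0: "R0 > 0" and r: "r \<ge> R0" "r \<ge> 1"
  shows "t powr (9/2) \<le> exp (5/3 * R0) * t powr (9/2 + 3/2 * (R0 / r)) + r powr (- 5)"
proof (cases "t \<ge> r powr (- 10/9)")
  case False
  then have "t powr (9/2) \<le> (r powr (- 10/9)) powr (9/2)" using t by (intro powr_mono2) auto
  also have "\<dots> = r powr (- 5)" by (simp add: powr_powr)
  finally show ?thesis by (simp add: add_increasing)
next
  case True
  define e where "e = 3/2 * (R0 / r)"
  have e: "e \<ge> 0" using R0 r by (simp add: e_def)
  have rp: "r powr (- 10/9) > 0" using r by simp
  then have tp: "t > 0" using True by linarith
  have "e * ln r \<le> 3/2 * R0"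
  proof -
    have "ln r \<le> r" using ln_le_minus_one[of r] r by linarith
    then have "e * ln r \<le> e * r" using e by (intro mult_left_mono)
    then show ?thesis using r by (simp add: e_def)
  qed
  then have b: "r powr (10/9 * e) \<le> exp (5/3 * R0)" using r by (simp add: powr_def)
  have "t powr (- e) \<le> (r powr (- 10/9)) powr (- e)" using True rp e by (intro powr_mono2') auto
  also have "\<dots> = r powr (10/9 * e)" by (simp add: powr_powr)
  also note b
  finally have te: "t powr (- e) \<le> exp (5/3 * R0)" .
  have "t powr (9/2) = t powr (- e) * t powr (9/2 + e)" by (simp flip: powr_add)
  also have "\<dots> \<le> exp (5/3 * R0) * t powr (9/2 + e)" by (intro mult_right_mono te) auto
  finally show ?thesis using add_increasing2[of "r powr (- 5)"] by (simp add: e_def)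
qed

text \<open>The remainder is a multiple of \<^const>\<open>bump_density\<close>, which is integrable.\<close>

lemma powr_le_eps_exponent:
  assumes R0: "R0 > 3/2" and t: "t \<ge> 0"
  shows "t powr (9/2) \<le> exp (5/3 * R0) * t powr (9/2 + eps_exponent R0 x)
    + (2 powr (5/2) + (1 + R0^2) powr (5/2)) * (1 + x \<bullet> x) powr (- 5/2)"
proof -
  have pos: "1 + x \<bullet> x > 0" by (simp add: add_pos_nonneg)
  show ?thesis
  proof (cases "norm x < R0")
    case True
    have "t powr (9/2) \<le> t powr 6 + 1"
    proof (cases "t \<le> 1")
      case True then show ?thesis using powr_mono2[of "9/2" t 1] t by (simp add: add_increasing)
    next
      case False then show ?thesis using powr_mono[of "9/2" 6 t] by simp
    qed
    moreover have "t powr 6 \<le> exp (5/3 * R0) * t powr 6"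
      using mult_right_mono[of 1 "exp (5/3 * R0)" "t powr 6"] R0 by simp
    moreover have "1 \<le> (2 powr (5/2) + (1 + R0^2) powr (5/2)) * (1 + x \<bullet> x) powr (- 5/2)"
    proof -
      have "x \<bullet> x \<le> R0^2" using True by (simp add: dot_square_norm power_mono)
      then have "(1 + x \<bullet> x) powr (5/2) \<le> (1 + R0^2) powr (5/2)" using pos by (intro powr_mono2) auto
      then have "(1 + x \<bullet> x) powr (5/2) \<le> 2 powr (5/2) + (1 + R0^2) powr (5/2)" by (simp add: add_increasing)
      from mult_right_mono[OF this, of "(1 + x \<bullet> x) powr (- 5/2)"] show ?thesis
        using pos by (simp flip: powr_add)
    qed
    ultimately show ?thesis using True by (simp add: eps_exponent_def)
  next
    case False
    then have r: "norm x \<ge> R0" "norm x \<ge> 1" "norm x > 0" using R0 by auto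
    have "norm x powr (- 5) \<le> 2 powr (5/2) * (1 + x \<bullet> x) powr (- 5/2)"
    proof -
      have "1 + x \<bullet> x \<le> 2 * norm x ^ 2" using r power_mono[of 1 "norm x" 2] by (simp add: dot_square_norm)
      then have "(2 * norm x ^ 2) powr (- 5/2) \<le> (1 + x \<bullet> x) powr (- 5/2)" using pos by (intro powr_mono2') auto
      moreover have "(2 * norm x ^ 2) powr (- 5/2) = 2 powr (- 5/2) * norm x powr (- 5)"
      proof -
        have "(norm x ^ 2) powr (- 5/2) = (norm x powr 2) powr (- 5/2)" using r by (simp add: powr_numeral)
        also have "\<dots> = norm x powr (- 5)" unfolding powr_powr by simp
        finally show ?thesis by (simp add: powr_mult)
      qed
      ultimately have "2 powr (5/2) * (2 powr (- 5/2) * norm x powr (- 5)) \<le> 2 powr (5/2) * (1 + x \<bullet> x) powr (- 5/2)"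
        by (intro mult_left_mono) auto
      moreover have "2 powr (5/2) * 2 powr (- 5/2) = (1::real)" by (subst powr_add[symmetric]) simp
      ultimately show ?thesis unfolding mult.assoc[symmetric] by (simp only: mult_1_left)
    qed
    also have "\<dots> \<le> (2 powr (5/2) + (1 + R0^2) powr (5/2)) * (1 + x \<bullet> x) powr (- 5/2)"
      by (intro mult_right_mono) auto
    finally show ?thesis
      using powr_le_variable_exponent[OF t _ r(1,2)] R0 False by (simp add: eps_exponent_def)
  qed
qed

section \<open>From the distributional formulation to Borel representatives\<close>

text \<open>Tonelli's theorem is available for products of Borel measures, not for their completions.\<close>

definition borel_rep :: "('a::euclidean_space \<Rightarrow> real) \<Rightarrow> 'a \<Rightarrow> real" where
  "borel_rep f = (SOME g. g \<in> borel_measurable borel \<and> (AE x in lborel. f x = g x))"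

lemma borel_rep:
  assumes "f \<in> borel_measurable lebesgue"
  shows "borel_rep f \<in> borel_measurable borel" "AE x in lborel. f x = borel_rep f x"
proof -
  have "\<exists>g. g \<in> borel_measurable borel \<and> (AE x in lborel. f x = g x)"
    using completion_ex_borel_measurable_real[OF assms] by auto
  from someI_ex[OF this, folded borel_rep_def]
  show "borel_rep f \<in> borel_measurable borel" "AE x in lborel. f x = borel_rep f x" by auto
qed

lemma distr_of_borel_version:
  assumes f: "f \<in> borel_measurable lebesgue" and g: "g \<in> borel_measurable borel"
    and eq: "AE x in lborel. f x = g x" and \<phi>: "\<phi> \<in> borel_measurable borel"
  shows "distr_of f \<phi> = (LBINT x. g x * \<phi> x)"
proof -
  note [measurable] = g \<phi>
  have gl: "(\<lambda>x. g x * \<phi> x) \<in> borel_measurable lborel" by measurable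
  have fl: "(\<lambda>x. f x * \<phi> x) \<in> borel_measurable lebesgue"
    by (intro borel_measurable_times f measurable_completion) (use \<phi> in simp)
  have "distr_of f \<phi> = (LINT x|lebesgue. g x * \<phi> x)"
    unfolding distr_of_def
  proof (rule integral_cong_AE[OF fl measurable_completion[OF gl]])
    show "AE x in lebesgue. f x * \<phi> x = g x * \<phi> x" using AE_completion[OF eq] by eventually_elim simp
  qed
  then show ?thesis using integral_completion[OF gl] by simp
qed

lemma Lp_space_component:
  fixes w :: "real^3 \<Rightarrow> 'b::euclidean_space"
  assumes w: "w \<in> Lp_space (real p)" and p: "p > 0" and c: "c \<in> borel_measurable borel"
    and le: "AE x in lborel. \<bar>c x\<bar> \<le> norm (w x)"
  shows "in_Lp p c"
  unfolding in_Lp_def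
proof
  note [measurable] = c
  have "(\<integral>\<^sup>+x. ennreal (\<bar>c x\<bar> ^ p) \<partial>lborel) = (\<integral>\<^sup>+x. ennreal (\<bar>c x\<bar> ^ p) \<partial>lebesgue)"
    by (rule nn_integral_completion[symmetric])
  also have "\<dots> \<le> (\<integral>\<^sup>+x. ennreal (norm (w x) powr real p) \<partial>lebesgue)"
  proof (rule nn_integral_mono_AE)
    show "AE x in lebesgue. ennreal (\<bar>c x\<bar> ^ p) \<le> ennreal (norm (w x) powr real p)"
      using AE_completion[OF le]
    proof eventually_elim
      case (elim x)
      have "\<bar>c x\<bar> ^ p \<le> norm (w x) ^ p" using elim by (intro power_mono) auto
      also have "\<dots> = norm (w x) powr real p" using p by (cases "w x = 0") (auto simp: powr_realpow)
      finally show ?case by (rule ennreal_leI)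
    qed
  qed
  also have "\<dots> < \<infinity>" using w by (simp add: Lp_space_def)
  finally show "integrable lborel (\<lambda>x. \<bar>c x\<bar> ^ p)" by (intro integrableI_nonneg) auto
qed (rule c)

lemma locally_integrable_measurable:
  fixes f :: "real^3 \<Rightarrow> 'b::euclidean_space"
  assumes "locally_integrable f"
  shows "f \<in> borel_measurable lebesgue"
proof (rule borel_measurable_LIMSEQ_metric)
  show "(\<lambda>x. indicator (cball 0 (real n)) x *\<^sub>R f x) \<in> borel_measurable lebesgue" for n
    using assms unfolding locally_integrable_def set_integrable_def by (auto intro: borel_measurable_integrable)
  show "(\<lambda>n. indicator (cball 0 (real n)) x *\<^sub>R f x) \<longlonglongrightarrow> f x" for x
  proof (rule tendsto_eventually)
    obtain k where k: "norm x \<le> real k" using real_arch_simple by blast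
    show "\<forall>\<^sub>F n in sequentially. indicator (cball 0 (real n)) x *\<^sub>R f x = f x"
      unfolding eventually_sequentially by (rule exI[of _ k]) (use k in \<open>auto simp: indicator_def\<close>)
  qed
qed

lemma locally_integrable_component:
  fixes f :: "real^3 \<Rightarrow> 'b::euclidean_space"
  assumes f: "locally_integrable f" and c: "c \<in> borel_measurable borel"
    and le: "AE x in lborel. \<bar>c x\<bar> \<le> norm (f x)"
  shows "loc_Lp 1 c"
  unfolding loc_Lp_def
proof (intro conjI allI c)
  fix r
  note [measurable] = c
  have i: "integrable lebesgue (\<lambda>x. indicator (cball 0 r) x *\<^sub>R f x)"
    using f unfolding locally_integrable_def set_integrable_def by auto
  have m: "(\<lambda>x. indicator (cball 0 r) x * c x) \<in> borel_measurable lborel" by measurable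
  have "integrable lebesgue (\<lambda>x. indicator (cball 0 r) x * c x)"
  proof (rule Bochner_Integration.integrable_bound[OF i measurable_completion[OF m]])
    show "AE x in lebesgue. norm (indicator (cball 0 r) x * c x) \<le> norm (indicator (cball 0 r) x *\<^sub>R f x)"
      using AE_completion[OF le] by eventually_elim (simp add: indicator_def)
  qed
  then have "integrable lborel (\<lambda>x. indicator (cball 0 r) x * c x)" using integrable_completion[OF m] by simp
  then have "integrable lborel (\<lambda>x. \<bar>indicator (cball 0 r) x * c x\<bar>)" by (rule integrable_abs)
  then show "in_Lp 1 (\<lambda>x. indicator (cball 0 r) x * c x)" using m by (simp add: in_Lp_def)
qed

lemma vec_nth_borel: "(\<lambda>x::('b::euclidean_space)^'n. x $ i) \<in> borel_measurable borel"
  by (intro borel_measurable_continuous_onI continuous_intros)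

text \<open>Integrals over the completed measure do not change when Borel representatives are substituted.\<close>

lemma weak_gradient_borel:
  fixes u :: "real^3 \<Rightarrow> real^3" and G :: "real^3 \<Rightarrow> real^3^3"
  assumes g: "has_weak_gradient u G"
    and U: "U \<in> borel_measurable borel" "AE x in lborel. u x $ i = U x"
    and H: "H \<in> borel_measurable borel" "AE x in lborel. G x $ i $ j = H x"
  shows "weak_partial j U H"
  unfolding weak_partial_def
proof
  fix \<phi> :: "real^3 \<Rightarrow> real" assume \<phi>: "\<phi> \<in> test_functions"
  have um: "u \<in> borel_measurable lebesgue" and Gm: "G \<in> borel_measurable lebesgue"
    using g by (auto simp: has_weak_gradient_def intro: locally_integrable_measurable)
  have um': "(\<lambda>x. u x $ i) \<in> borel_measurable lebesgue" by (rule measurable_compose[OF um vec_nth_borel])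
  have "(\<lambda>x. G x $ i) \<in> borel_measurable lebesgue" by (rule measurable_compose[OF Gm vec_nth_borel])
  then have Gm': "(\<lambda>x. G x $ i $ j) \<in> borel_measurable lebesgue" by (rule measurable_compose[OF _ vec_nth_borel])
  have sm: "\<phi> \<in> borel_measurable borel" "pd j \<phi> \<in> borel_measurable borel"
    by (intro smooth_borel test_function_smooth test_pd \<phi>)+
  have "distr_partial j (distr_of (\<lambda>x. u x $ i)) \<phi> = distr_of (\<lambda>x. G x $ i $ j) \<phi>"
    using g \<phi> by (simp add: has_weak_gradient_def)
  then show "(LBINT x. U x * pd j \<phi> x) = - (LBINT x. H x * \<phi> x)"
    unfolding distr_deriv_def
    using distr_of_borel_version[OF um' U(1) U(2) sm(2)] distr_of_borel_version[OF Gm' H(1) H(2) sm(1)] by linarith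
qed

text \<open>Applied to the divergence of a test field, this makes the pressure term vanish.\<close>

lemma distribution_sum:
  assumes P: "distribution P" and "finite I" and "\<And>i. i \<in> I \<Longrightarrow> \<phi> i \<in> test_functions"
  shows "P (\<lambda>x. \<Sum>i\<in>I. \<phi> i x) = (\<Sum>i\<in>I. P (\<phi> i))"
proof -
  have add: "P (\<lambda>x. \<phi> x + \<psi> x) = P \<phi> + P \<psi>" if "\<phi> \<in> test_functions" "\<psi> \<in> test_functions" for \<phi> \<psi>
    by (rule P[unfolded distribution_def, THEN conjunct1, rule_format, OF that])
  have scale: "P (\<lambda>x. c * \<phi> x) = c * P \<phi>" if "\<phi> \<in> test_functions" for \<phi> c
    by (rule P[unfolded distribution_def, THEN conjunct2, THEN conjunct1, rule_format, OF that])
  show ?thesis using assms(2,3)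
  proof (induction I rule: finite_induct)
    case empty
    show ?case using scale[OF test_function_zero, of 0] by simp
  next
    case (insert i I)
    have "(\<lambda>x. \<Sum>i\<in>I. \<phi> i x) \<in> test_functions" using insert.prems by (intro test_function_sum) auto
    from add[OF _ this, of "\<phi> i"] show ?case using insert by simp
  qed
qed

theorem theorem1p1:
  fixes R0 :: real and u :: "real ^ 3 \<Rightarrow> real ^ 3"
  assumes "R0 > 3/2"
    and "u \<in> homogeneous_H1"
    and "stationary_NS_solution u"
    and "u \<in> var_Lp_space UNIV (\<lambda>x. 9/2 + eps_exponent R0 x)"
  shows "AE x in lebesgue. u x = 0"
proof -
  obtain G where u6: "u \<in> Lp_space 6" and G: "has_weak_gradient u G" and G2: "G \<in> Lp_space 2"
    using assms(2) by (auto simp: homogeneous_H1_def)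
  obtain P G' where P: "distribution P" and G': "has_weak_gradient u G'"
    and mom: "\<And>i \<phi>. \<phi> \<in> test_functions \<Longrightarrow>
           - (\<Sum>j\<in>UNIV. distr_partial j (distr_partial j (distr_of (\<lambda>x. u x $ i))) \<phi>)
           + distr_of (\<lambda>x. (G' x *v u x) $ i) \<phi> + distr_partial i P \<phi> = 0"
    and dv: "\<And>\<phi>. \<phi> \<in> test_functions \<Longrightarrow> (\<Sum>j\<in>UNIV. distr_partial j (distr_of (\<lambda>x. u x $ j)) \<phi>) = 0"
    using assms(3) unfolding stationary_NS_solution_def by blast
  have um: "u \<in> borel_measurable lebesgue" using u6 by (simp add: Lp_space_def)
  have Gm: "G \<in> borel_measurable lebesgue" "G' \<in> borel_measurable lebesgue"
    using G G' by (auto simp: has_weak_gradient_def intro: locally_integrable_measurable)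
  have um': "(\<lambda>x. u x $ i) \<in> borel_measurable lebesgue" for i
    by (rule measurable_compose[OF um vec_nth_borel])
  have Gm1: "(\<lambda>x. G x $ i $ j) \<in> borel_measurable lebesgue" for i j
    by (rule measurable_compose[OF measurable_compose[OF Gm(1) vec_nth_borel] vec_nth_borel])
  have Gm2: "(\<lambda>x. G' x $ i $ j) \<in> borel_measurable lebesgue" for i j
    by (rule measurable_compose[OF measurable_compose[OF Gm(2) vec_nth_borel] vec_nth_borel])
  define U where "U i = borel_rep (\<lambda>x. u x $ i)" for i
  define H where "H i j = borel_rep (\<lambda>x. G x $ i $ j)" for i j
  define H' where "H' i j = borel_rep (\<lambda>x. G' x $ i $ j)" for i j
  have U: "U i \<in> borel_measurable borel" "AE x in lborel. u x $ i = U i x" for i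
    unfolding U_def by (rule borel_rep[OF um'])+
  have H: "H i j \<in> borel_measurable borel" "AE x in lborel. G x $ i $ j = H i j x" for i j
    unfolding H_def by (rule borel_rep[OF Gm1])+
  have H': "H' i j \<in> borel_measurable borel" "AE x in lborel. G' x $ i $ j = H' i j x" for i j
    unfolding H'_def by (rule borel_rep[OF Gm2])+
  note [measurable] = U(1) H(1) H'(1)

  have U6: "in_Lp 6 (U i)" for i
  proof (rule Lp_space_component[of u 6])
    show "AE x in lborel. \<bar>U i x\<bar> \<le> norm (u x)"
      using U(2)[of i] by eventually_elim (metis component_le_norm_cart)
  qed (use u6 U in auto)
  have nn: "\<bar>A $ i $ j\<bar> \<le> norm A" for A :: "real^3^3" and i j
    using component_le_norm_cart[of "A $ i" j] Finite_Cartesian_Product.norm_nth_le[of A i] by linarith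
  have H2: "in_Lp 2 (H i j)" for i j
  proof (rule Lp_space_component[of G 2])
    show "AE x in lborel. \<bar>H i j x\<bar> \<le> norm (G x)"
      using H(2)[of i j] by eventually_elim (metis nn)
  qed (use G2 H in auto)
  have Hl: "loc_Lp 1 (H i j)" for i j by (rule loc_Lp_mono[OF in_Lp_imp_loc_Lp[OF H2]]) auto
  have Hl': "loc_Lp 1 (H' i j)" for i j
  proof (rule locally_integrable_component[of G'])
    show "locally_integrable G'" using G' by (simp add: has_weak_gradient_def)
    show "AE x in lborel. \<bar>H' i j x\<bar> \<le> norm (G' x)"
      using H'(2)[of i j] by eventually_elim (metis nn)
  qed (rule H')
  have w: "weak_partial j (U i) (H i j)" for i j by (rule weak_gradient_borel[OF G U(1) U(2) H(1) H(2)])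
  have w': "weak_partial j (U i) (H' i j)" for i j by (rule weak_gradient_borel[OF G' U(1) U(2) H'(1) H'(2)])

  text \<open>The equation and the function space each come with a weak gradient of their own. Square
    integrability is known for the one and the equation for the other.\<close>
  have HH': "AE x in lborel. H i j x = H' i j x" for i j
  proof -
    have "AE x in lborel. H i j x - H' i j x = 0"
    proof (rule fundamental_lemma)
      have "in_Lp 1 (\<lambda>x. indicator (cball 0 r) x * H i j x - indicator (cball 0 r) x * H' i j x)" for r
        using Hl[of i j] Hl'[of i j] by (intro in_Lp_diff) (auto simp: loc_Lp_def)
      then show "loc_Lp 1 (\<lambda>x. H i j x - H' i j x)" by (simp add: loc_Lp_def right_diff_distrib)
      fix \<phi> :: "real^3 \<Rightarrow> real" assume \<phi>: "\<phi> \<in> test_functions"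
      have "(LBINT x. H i j x * \<phi> x) = (LBINT x. H' i j x * \<phi> x)"
        using w[of j i] w'[of j i] \<phi> by (simp add: weak_partial_def)
      then show "(LBINT x. (H i j x - H' i j x) * \<phi> x) = 0"
        using integrable_test_mult_loc(2)[OF Hl \<phi>, of i j] integrable_test_mult_loc(2)[OF Hl' \<phi>, of i j]
        by (simp add: left_diff_distrib)
    qed
    then show ?thesis by eventually_elim simp
  qed

  have uU: "distr_of (\<lambda>x. u x $ i) \<phi> = (LBINT x. U i x * \<phi> x)" if "\<phi> \<in> test_functions" for i \<phi>
    by (rule distr_of_borel_version[OF um' U(1) U(2) smooth_borel[OF test_function_smooth[OF that]]])
  have divU: "(\<Sum>j\<in>UNIV. LBINT x. U j x * pd j \<phi> x) = 0" if \<phi>: "\<phi> \<in> test_functions" for \<phi>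
    using dv[OF \<phi>] by (simp add: distr_deriv_def uU test_pd \<phi> sum_negf)
  have conv_term: "distr_of (\<lambda>x. (G' x *v u x) $ i) \<phi> = (\<Sum>j\<in>UNIV. LBINT x. U j x * H i j x * \<phi> x)"
    if \<phi>: "\<phi> \<in> test_functions" for i \<phi>
  proof -
    have m: "(\<lambda>x. (G' x *v u x) $ i) \<in> borel_measurable lebesgue"
      unfolding matrix_vector_mult_def by (simp, intro borel_measurable_sum borel_measurable_times Gm2 um')
    have "AE x in lborel. \<forall>j\<in>(UNIV::3 set). G' x $ i $ j * u x $ j = U j x * H i j x"
    proof (rule AE_finite_allI)
      fix j :: 3
      show "AE x in lborel. G' x $ i $ j * u x $ j = U j x * H i j x"
        using U(2)[of j] H'(2)[of i j] HH'[of i j] by eventually_elim simp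
    qed simp
    then have ae: "AE x in lborel. (G' x *v u x) $ i = (\<Sum>j\<in>UNIV. U j x * H i j x)"
      by eventually_elim (simp add: matrix_vector_mult_def)
    have "distr_of (\<lambda>x. (G' x *v u x) $ i) \<phi> = (LBINT x. (\<Sum>j\<in>UNIV. U j x * H i j x) * \<phi> x)"
      by (rule distr_of_borel_version[OF m _ ae smooth_borel[OF test_function_smooth[OF \<phi>]]]) measurable
    also have "\<dots> = (LBINT x. (\<Sum>j\<in>UNIV. U j x * H i j x * \<phi> x))" by (simp add: sum_distrib_right)
    also have "\<dots> = (\<Sum>j\<in>UNIV. LBINT x. U j x * H i j x * \<phi> x)"
    proof (rule Bochner_Integration.integral_sum)
      fix j
      have "in_Lp 2 (\<lambda>x. \<phi> x * U j x)"
        by (rule loc_Lp_mult_test[OF loc_Lp_mono[OF in_Lp_imp_loc_Lp[OF U6]] \<phi>]) auto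
      from integrable_product_L2[OF this H2, of i j]
      show "integrable lborel (\<lambda>x. U j x * H i j x * \<phi> x)" by (simp add: mult_ac)
    qed
    finally show ?thesis .
  qed

  have momU: "(\<Sum>i\<in>UNIV. \<Sum>j\<in>UNIV. LBINT x. H i j x * pd j (\<psi> i) x)
      + (\<Sum>i\<in>UNIV. \<Sum>j\<in>UNIV. LBINT x. U j x * H i j x * \<psi> i x) = 0"
    if \<psi>: "\<And>i. \<psi> i \<in> test_functions" and dz: "\<And>x. (\<Sum>i\<in>UNIV. pd i (\<psi> i) x) = 0" for \<psi> :: "3 \<Rightarrow> real^3 \<Rightarrow> real"
  proof -
    have "distr_partial j (distr_partial j (distr_of (\<lambda>x. u x $ i))) (\<psi> i) = - (LBINT x. H i j x * pd j (\<psi> i) x)" for i j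
      using w[of j i] test_pd[OF \<psi>, of j i] by (simp add: distr_deriv_def uU test_pd \<psi> weak_partial_def)
    then have 1: "(\<Sum>j\<in>UNIV. LBINT x. H i j x * pd j (\<psi> i) x)
        + (\<Sum>j\<in>UNIV. LBINT x. U j x * H i j x * \<psi> i x) = P (pd i (\<psi> i))" for i
      using mom[OF \<psi>, of i i] conv_term[OF \<psi>, of i i] by (simp add: distr_deriv_def sum_negf)
    have "(\<Sum>i\<in>UNIV. P (pd i (\<psi> i))) = P (\<lambda>x. \<Sum>i\<in>UNIV. pd i (\<psi> i) x)"
      by (rule distribution_sum[OF P, symmetric]) (auto intro: test_pd \<psi>)
    also have "\<dots> = 0" using distribution_sum[OF P, of "{}"] dz by simp
    finally show ?thesis using 1 by (simp flip: sum.distrib)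
  qed

  interpret flow: steady_flow U H
    by (unfold_locales; (rule U6 H2 w divU momU; assumption)?)

  have "integrable lborel (\<lambda>x. flow.speed x powr (9/2))"
  proof -
    obtain l where l: "l > 0" "(\<integral>\<^sup>+ x\<in>UNIV. ennreal ((norm (u x) / l) powr (9/2 + eps_exponent R0 x)) \<partial>lebesgue) \<le> 1"
    proof -
      have "var_Lp_norm UNIV (\<lambda>x. 9/2 + eps_exponent R0 x) u < \<infinity>" using assms(4) by (simp add: var_Lp_space_def)
      then show ?thesis using that unfolding var_Lp_norm_def INF_less_iff by auto
    qed
    define K where "K = exp (5/3 * R0)"
    define K' where "K' = (2 powr (5/2) + (1 + R0^2) powr (5/2))"
    have K: "K \<ge> 0" "K' \<ge> 0" by (auto simp: K_def K'_def)
    have bm [measurable]: "bump_density \<in> borel_measurable borel" by (rule borel_measurable_continuous_onI[OF bump_density_cont])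
    have em: "(\<lambda>x. 9/2 + eps_exponent R0 x) \<in> borel_measurable lebesgue"
      by (rule eps_exponent_admissible(1)[OF assms(1)])
    have nm: "(\<lambda>x. norm (u x) / l) \<in> borel_measurable lebesgue"
      using um by (intro borel_measurable_divide borel_measurable_norm) auto
    have pm: "(\<lambda>x. ennreal ((norm (u x) / l) powr (9/2 + eps_exponent R0 x))) \<in> borel_measurable lebesgue"
      by (intro measurable_ennreal powr_real_measurable nm em measurable_compose[OF _ measurable_ennreal])
    have bl: "(\<lambda>x. ennreal (bump_density x)) \<in> borel_measurable lebesgue"
      by (rule measurable_completion) measurable
    have sp: "AE x in lborel. ennreal (flow.speed x powr (9/2))
        \<le> ennreal ((3 * l) powr (9/2)) * (ennreal K * ennreal ((norm (u x) / l) powr (9/2 + eps_exponent R0 x)) + ennreal (K' / 3) * ennreal (bump_density x))"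
    proof -
      have "AE x in lborel. \<forall>i\<in>(UNIV::3 set). u x $ i = U i x" by (rule AE_finite_allI) (auto intro: U(2))
      then show ?thesis
      proof eventually_elim
        case (elim x)
        define t where "t = norm (u x) / l"
        have t: "t \<ge> 0" using l by (simp add: t_def)
        have "flow.speed x \<le> (\<Sum>i\<in>(UNIV::3 set). norm (u x))"
          unfolding flow.speed_def using elim by (intro sum_mono) (metis UNIV_I component_le_norm_cart)
        then have "flow.speed x \<le> (3 * l) * t" using l by (simp add: t_def)
        then have "flow.speed x powr (9/2) \<le> ((3 * l) * t) powr (9/2)" using flow.speed_nonneg by (intro powr_mono2) auto
        also have "\<dots> = (3 * l) powr (9/2) * t powr (9/2)" using l t by (intro powr_mult)
        also have "\<dots> \<le> (3 * l) powr (9/2) * (K * t powr (9/2 + eps_exponent R0 x) + K' / 3 * bump_density x)"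
          using powr_le_eps_exponent[OF assms(1) t, of x] by (intro mult_left_mono) (auto simp: K_def K'_def bump_density_def)
        finally show ?case
          using K t less_imp_le[OF bump_density_pos[of x]] unfolding t_def[symmetric]
          by (simp add: ennreal_mult[symmetric] ennreal_plus[symmetric] ennreal_leI del: ennreal_plus)
      qed
    qed
    have "(\<integral>\<^sup>+x. ennreal (flow.speed x powr (9/2)) \<partial>lborel) = (\<integral>\<^sup>+x. ennreal (flow.speed x powr (9/2)) \<partial>lebesgue)"
      by (rule nn_integral_completion[symmetric])
    also have "\<dots> \<le> (\<integral>\<^sup>+x. ennreal ((3 * l) powr (9/2)) * (ennreal K * ennreal ((norm (u x) / l) powr (9/2 + eps_exponent R0 x)) + ennreal (K' / 3) * ennreal (bump_density x)) \<partial>lebesgue)"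
      by (rule nn_integral_mono_AE[OF AE_completion[OF sp]])
    also have "\<dots> = ennreal ((3 * l) powr (9/2)) * (ennreal K * (\<integral>\<^sup>+x. ennreal ((norm (u x) / l) powr (9/2 + eps_exponent R0 x)) \<partial>lebesgue)
        + ennreal (K' / 3) * (\<integral>\<^sup>+x. ennreal (bump_density x) \<partial>lebesgue))"
      using pm bl by (simp add: nn_integral_cmult nn_integral_add)
    also have "\<dots> < \<infinity>"
    proof -
      have "(\<integral>\<^sup>+x. ennreal (bump_density x) \<partial>lebesgue) < \<infinity>"
        using nn_integral_eq_integral[OF bump_density_integrable] by (simp add: nn_integral_completion less_imp_le bump_density_pos)
      moreover have "(\<integral>\<^sup>+x. ennreal ((norm (u x) / l) powr (9/2 + eps_exponent R0 x)) \<partial>lebesgue) < \<infinity>"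
        using l(2) by (simp add: le_less_trans[OF _ ennreal_one_less_top])
      ultimately show ?thesis by (simp add: ennreal_mult_less_top)
    qed
    finally show ?thesis by (intro integrableI_nonneg) auto
  qed
  from flow.velocity_zero[OF this] have z: "AE x in lborel. U i x = 0" for i .
  have "AE x in lborel. u x $ i = 0" for i using U(2)[of i] z[of i] by eventually_elim simp
  then have "AE x in lborel. \<forall>i\<in>(UNIV::3 set). u x $ i = 0" by (intro AE_finite_allI) auto
  then have "AE x in lborel. u x = 0" by eventually_elim (simp add: vec_eq_iff)
  then show ?thesis by (rule AE_completion)
qed

end
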